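(* Let $h$ be a unipotent element in $GL(n,q)$ of type $\mu$ (that is, $\mu$ is the partition of $n$ whose parts are the sizes of the Jordan blocks of $h$). Then the proportion of $g$ in $GL(n,q)$ such that $gg^{\tau}$ is conjugate to $h$ (in $GL(n,q)$) is $0$ unless all even parts of $\mu$ have even multiplicity. If all even parts of $\mu$ have even multiplicity, then the proportion is $$\frac{1}{q^{n(\mu)+\frac{n}{2}-\frac{o(\mu)}{2}}\ \prod_i (1-1/q^2)(1-1/q^4) \cdots (1-1/q^{2 \lfloor m_i(\mu)/2 \rfloor})}.$$
   Context: $q$ is a prime power and $GL(n,q)$ is the general linear group over the field $F_q$ with $q$ elements. For $g\in GL(n,q)$, $g'$ is the transpose and $g^\tau=(g')^{-1}$. For a partition $\mu$: $m_i(\mu)$ is the number of parts equal to $i$, $o(\mu)$ is the number of odd parts (counted with multiplicity), $\mu'_i=m_i(\mu)+m_{i+1}(\mu)+\cdots$ are the parts of the dual partition, and $n(\mu)=\sum_i\binom{\mu_i'}{2}$. Empty products equal $1$. *)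

theory Defs
  imports Complex_Main "HOL-Library.Cardinality" "Jordan_Normal_Form.Jordan_Normal_Form"
begin

definition GL :: "nat \<Rightarrow> 'a::field mat monoid" where
  "GL n = units_of (ring_mat TYPE('a) n ())"

lemma group_GL: "group (GL n)"
proof -
  interpret ring "ring_mat TYPE('a::field) n ()" by (rule ring_mat)
  show ?thesis unfolding GL_def by (rule units_group)
qed

definition inverse_transpose :: "nat \<Rightarrow> 'a::field mat \<Rightarrow> 'a mat" where
  "inverse_transpose n g = inv\<^bsub>GL n\<^esub> (transpose_mat g)"

definition conjugate_in_GL :: "nat \<Rightarrow> 'a::field mat \<Rightarrow> 'a mat \<Rightarrow> bool" where
  "conjugate_in_GL n g h \<longleftrightarrow>
     (\<exists>x \<in> carrier (GL n). g = x \<otimes>\<^bsub>GL n\<^esub> h \<otimes>\<^bsub>GL n\<^esub> inv\<^bsub>GL n\<^esub> x)"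

definition unipotent :: "nat \<Rightarrow> 'a::field mat \<Rightarrow> bool" where
  "unipotent n h \<longleftrightarrow> h \<in> carrier (GL n) \<and> (\<exists>k. (h - 1\<^sub>m n) ^\<^sub>m k = 0\<^sub>m n n)"

text \<open>
  A partition is the multiset of its (positive) parts. In a Jordan normal form, given by a list of
  pairs of block size and eigenvalue, all block sizes are positive.
\<close>

definition has_jordan_type :: "'a::field mat \<Rightarrow> nat multiset \<Rightarrow> bool" where
  "has_jordan_type h \<mu> \<longleftrightarrow> (\<exists>n_as. jordan_nf h n_as \<and> mset (map fst n_as) = \<mu>)"

definition num_odd_parts :: "nat multiset \<Rightarrow> nat" where
  "num_odd_parts \<mu> = size {# p \<in># \<mu>. odd p #}"

text \<open>The sum \<open>m\<^sub>i + m\<^sub>i\<^sub>+\<^sub>1 + \<dots>\<close>, restricted to the indices with nonzero multiplicity.\<close>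

definition dual_part :: "nat multiset \<Rightarrow> nat \<Rightarrow> nat" where
  "dual_part \<mu> i = (\<Sum>j \<in> {j \<in> set_mset \<mu>. i \<le> j}. count \<mu> j)"

text \<open>No part exceeds the sum of all parts, so the dual parts of larger index vanish.\<close>

definition n_stat :: "nat multiset \<Rightarrow> nat" where
  "n_stat \<mu> = (\<Sum>i = 1..sum_mset \<mu>. dual_part \<mu> i choose 2)"

definition proportion :: "'b set \<Rightarrow> ('b \<Rightarrow> bool) \<Rightarrow> real" where
  "proportion A P = real (card {x \<in> A. P x}) / real (card A)"

end

theory Submission
  imports Defs
begin

text \<open>
  The equation \<open>g g\<^sup>\<tau> = h\<close> says \<open>g = h g'\<close>. Counting pairs \<open>(g, x)\<close> with
  \<open>g g\<^sup>\<tau> = x h x\<^sup>-\<^sup>1\<close> in two ways shows that the proportion is the quotient of the number of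
  invertible solutions of \<open>g = h g'\<close> by the order of the centralizer of \<open>h\<close>, and both numbers
  depend only on the conjugacy class of \<open>h\<close>. Let \<open>k\<close> be the largest part of \<open>\<mu>\<close> and \<open>m\<close> its
  multiplicity, and write \<open>h\<close> as the direct sum of an \<open>h\<^sub>1\<close> of type \<open>k\<^sup>m\<close> and an \<open>h\<^sub>2\<close> with smaller
  parts. In a solution, and likewise in a centralizing matrix, the diagonal block belonging to \<open>h\<^sub>1\<close>
  is automatically invertible: a left null vector of it may be chosen fixed by \<open>h\<^sub>1\<close>, hence in the
  image of \<open>(h\<^sub>1 - 1)\<^sup>k\<^sup>-\<^sup>1\<close>, and the off-diagonal block annihilates such vectors because \<open>h\<^sub>2\<close> has
  only smaller parts. Taking Schur complements then makes both counts multiplicative up to a power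
  of \<open>q\<close>. For the type \<open>k\<^sup>m\<close> the solutions are parametrized by those for \<open>(k - 2)\<^sup>m\<close> together with a
  free \<open>m \<times> m\<close> block, which leaves the numbers of invertible symmetric matrices (\<open>k = 1\<close>) and of
  matrices \<open>A\<close> with \<open>A - A'\<close> invertible (\<open>k = 2\<close>). Using \<open>A - A'\<close> for alternating forms makes the
  argument uniform in the characteristic.
\<close>

section \<open>Reduction to a centralizer quotient\<close>

text \<open>Writing the condition as \<open>g = h * g'\<close> makes it linear in \<open>g\<close>;
  invertibility stays behind as a separate determinant condition, which is reduced to a single
  \<open>m\<close> by \<open>m\<close> block. The largest part has to be split off first: only then
  does the upper off-diagonal block vanish on the last layer, which is what forces the pivot block
  to be invertible. The exponent comes from the off-diagonal blocks. In a form the lower one is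
  determined by the upper one, in a centralizing matrix both are free, so each splitting costs a
  factor \<open>q^(m*b)\<close>, where \<open>b\<close> is the sum of the smaller parts. This is the
  cross term in \<open>n(mu)\<close> when \<open>m\<close> is added to each of the first
  \<open>k\<close> dual parts. For the type \<open>k^m\<close> the order of \<open>GL(m,q)\<close>
  cancels: it is \<open>q^(m choose 2) * phi\<close> times the number of invertible symmetric
  matrices and, for even \<open>m\<close>, \<open>phi\<close> times the number of \<open>A\<close>
  with \<open>A - A'\<close> invertible. Hence odd and even \<open>k\<close> lead to the same
  product, and for even \<open>k\<close> and odd \<open>m\<close> there is no solution, since
  alternating matrices of odd size are singular.\<close>

lemma card_carrier_mat:
  "finite (carrier_mat nr nc :: 'a::finite mat set)"
  "card (carrier_mat nr nc :: 'a::finite mat set) = CARD('a) ^ (nr * nc)"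
proof -
  let ?F = "({..<nr} \<times> {..<nc}) \<rightarrow>\<^sub>E (UNIV :: 'a set)"
  have bij: "bij_betw (mat nr nc) ?F (carrier_mat nr nc)"
  proof (rule bij_betw_byWitness[where f' = "\<lambda>X. restrict (\<lambda>ij. X $$ ij) ({..<nr} \<times> {..<nc})"])
    show "\<forall>f \<in> ?F. restrict (\<lambda>ij. mat nr nc f $$ ij) ({..<nr} \<times> {..<nc}) = f"
      by (fastforce simp: fun_eq_iff restrict_def PiE_def extensional_def)
    show "\<forall>X \<in> carrier_mat nr nc. mat nr nc (restrict (\<lambda>ij. X $$ ij) ({..<nr} \<times> {..<nc})) = X"
      by (auto intro!: eq_matI)
    show "(\<lambda>X. restrict (\<lambda>ij. X $$ ij) ({..<nr} \<times> {..<nc})) ` carrier_mat nr nc \<subseteq> ?F"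
      by (intro image_subsetI) (simp only: restrict_PiE_iff, simp)
  qed auto
  have fin: "finite ?F" by (intro finite_PiE) auto
  show "finite (carrier_mat nr nc :: 'a mat set)" using bij_betw_finite[OF bij] fin by simp
  show "card (carrier_mat nr nc :: 'a mat set) = CARD('a) ^ (nr * nc)"
    using bij_betw_same_card[OF bij] by (simp add: card_PiE)
qed

lemma card_GT_1: "CARD('a::{field,finite}) > 1"
proof -
  have "card {0, 1 :: 'a} \<le> CARD('a)" by (rule card_mono) auto
  then show ?thesis by simp
qed

lemma det_nonzero_inverse:
  fixes X :: "'a::field mat"
  assumes "X \<in> carrier_mat n n" "det X \<noteq> 0"
  obtains Y where "Y \<in> carrier_mat n n" "X * Y = 1\<^sub>m n" "Y * X = 1\<^sub>m n" "det Y \<noteq> 0"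
proof -
  from det_non_zero_imp_unit[OF assms, of "()"] obtain Y where Y: "Y \<in> carrier_mat n n"
    "X * Y = 1\<^sub>m n" "Y * X = 1\<^sub>m n"
    by (auto simp: Units_def ring_mat_def)
  have "det X * det Y = 1" using det_mult[OF assms(1) Y(1)] Y(2) by simp
  then have "det Y \<noteq> 0" by auto
  then show ?thesis using that Y by blast
qed

lemma det_nonzeroI:
  fixes X :: "'a::field mat"
  assumes "X \<in> carrier_mat n n" "Y \<in> carrier_mat n n" "X * Y = 1\<^sub>m n"
  shows "det X \<noteq> 0"
proof -
  have "det X * det Y = 1" using det_mult[OF assms(1,2)] assms(3) by simp
  then show ?thesis by auto
qed

text \<open>The matrices \<open>g\<close> with \<open>g g\<^sup>\<tau> = h\<close>, that is, the Gram matrices of the nondegenerate bilinear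
  forms with asymmetry \<open>h\<close>.\<close>

definition forms :: "'a::field mat \<Rightarrow> 'a mat set" where
  "forms h = {g \<in> carrier_mat (dim_row h) (dim_row h). det g \<noteq> 0 \<and> g = h * transpose_mat g}"

definition centralizer :: "'a::field mat \<Rightarrow> 'a mat set" where
  "centralizer h = {x \<in> carrier_mat (dim_row h) (dim_row h). det x \<noteq> 0 \<and> x * h = h * x}"

section \<open>Invariance of both counts under similarity\<close>

lemma similar_matE:
  assumes "similar_mat A B" "A \<in> carrier_mat n n"
  obtains P Q where "P \<in> carrier_mat n n" "Q \<in> carrier_mat n n" "B \<in> carrier_mat n n"
    "P * Q = 1\<^sub>m n" "Q * P = 1\<^sub>m n" "A = P * B * Q" "B = Q * A * P"
proof -
  from assms(1) obtain P Q where w: "similar_mat_wit A B P Q" unfolding similar_mat_def by auto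
  note d = similar_mat_witD2[OF assms(2) w]
  note d' = similar_mat_witD2[OF d(5) similar_mat_wit_sym[OF w]]
  show ?thesis using that d d' by blast
qed

text \<open>A change of basis acts on Gram matrices by congruence, \<open>g\<close> to
  \<open>Q * g * Q'\<close>, and this conjugates the asymmetry. An injection is enough, because
  similarity is symmetric and the reverse inequality is another instance.\<close>

lemma similar_mat_card_forms_le:
  fixes h h' :: "'a::{field,finite} mat"
  assumes "similar_mat h h'" "h \<in> carrier_mat n n"
  shows "card (forms h) \<le> card (forms h')"
proof -
  obtain P Q where P[simp]: "P \<in> carrier_mat n n" and Q[simp]: "Q \<in> carrier_mat n n"
    and h'[simp]: "h' \<in> carrier_mat n n"
    and PQ: "P * Q = 1\<^sub>m n" and QP: "Q * P = 1\<^sub>m n" and h'eq: "h' = Q * h * P"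
    using similar_matE[OF assms] by metis
  note h[simp] = assms(2)
  have [simp]: "dim_row h = n" "dim_row h' = n" using h h' by (auto simp del: h h')
  let ?f = "\<lambda>g. Q * g * transpose_mat Q"
  have TP: "transpose_mat Q * transpose_mat P = 1\<^sub>m n"
    using transpose_mult[OF P Q] PQ by simp
  have inj: "P * ?f g * transpose_mat P = g" if "g \<in> carrier_mat n n" for g
  proof -
    have "P * ?f g * transpose_mat P = (P * Q) * g * (transpose_mat Q * transpose_mat P)"
      using that by (simp add: assoc_mult_mat[of _ n n _ n _ n] mult_carrier_mat[of _ n n])
    then show ?thesis using that by (simp add: PQ TP)
  qed
  show ?thesis
  proof (rule card_inj_on_le)
    show "inj_on ?f (forms h)"
      by (rule inj_on_inverseI[of _ "\<lambda>g. P * g * transpose_mat P"]) (auto simp: forms_def inj)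
    show "?f ` forms h \<subseteq> forms h'"
    proof safe
      fix g assume "g \<in> forms h"
      then have g[simp]: "g \<in> carrier_mat n n" and dg: "det g \<noteq> 0" and eq: "g = h * transpose_mat g"
        by (auto simp: forms_def)
      have "det Q \<noteq> 0" using det_nonzeroI[OF Q P QP] .
      then have "det (?f g) \<noteq> 0" using dg
        by (simp add: det_mult[of _ n] det_transpose[of _ n] mult_carrier_mat[of _ n n])
      moreover have "?f g = h' * transpose_mat (?f g)"
      proof -
        have "transpose_mat (?f g) = Q * (transpose_mat g * transpose_mat Q)"
          by (simp add: transpose_mult[of _ n n _ n] mult_carrier_mat[of _ n n])
        then have "h' * transpose_mat (?f g) = Q * (h * ((P * Q) * (transpose_mat g * transpose_mat Q)))"
          unfolding h'eq
          by (simp add: assoc_mult_mat[of _ n n _ n _ n] mult_carrier_mat[of _ n n])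
        also have "\<dots> = Q * (h * transpose_mat g) * transpose_mat Q"
          by (simp add: PQ assoc_mult_mat[of _ n n _ n _ n] mult_carrier_mat[of _ n n] left_mult_one_mat[of _ n n])
        finally show ?thesis using eq by simp
      qed
      ultimately show "?f g \<in> forms h'" by (simp add: forms_def mult_carrier_mat[of _ n n])
    qed
    show "finite (forms h')"
      by (rule finite_subset[OF _ card_carrier_mat(1)[of n n]]) (auto simp: forms_def)
  qed
qed

lemma similar_mat_card_centralizer_le:
  fixes h h' :: "'a::{field,finite} mat"
  assumes "similar_mat h h'" "h \<in> carrier_mat n n"
  shows "card (centralizer h) \<le> card (centralizer h')"
proof -
  obtain P Q where P[simp]: "P \<in> carrier_mat n n" and Q[simp]: "Q \<in> carrier_mat n n"
    and h'[simp]: "h' \<in> carrier_mat n n"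
    and PQ: "P * Q = 1\<^sub>m n" and QP: "Q * P = 1\<^sub>m n" and h'eq: "h' = Q * h * P"
    using similar_matE[OF assms] by metis
  note h[simp] = assms(2)
  have [simp]: "dim_row h = n" "dim_row h' = n" using h h' by (auto simp del: h h')
  let ?f = "\<lambda>g. Q * g * P"
  have conj: "Q * g * P * (Q * g' * P) = Q * (g * g') * P"
    if "g \<in> carrier_mat n n" "g' \<in> carrier_mat n n" for g g'
  proof -
    have "Q * g * P * (Q * g' * P) = Q * g * (P * Q) * (g' * P)"
      using that by (simp add: assoc_mult_mat[of _ n n _ n _ n] mult_carrier_mat[of _ n n])
    also have "\<dots> = Q * (g * g') * P"
      using that by (simp add: PQ assoc_mult_mat[of _ n n _ n _ n] mult_carrier_mat[of _ n n]
          right_mult_one_mat[of _ n n] left_mult_one_mat[of _ n n])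
    finally show ?thesis .
  qed
  have inj: "P * ?f g * Q = g" if "g \<in> carrier_mat n n" for g
  proof -
    have "P * ?f g * Q = (P * Q) * g * (P * Q)"
      using that by (simp add: assoc_mult_mat[of _ n n _ n _ n] mult_carrier_mat[of _ n n])
    then show ?thesis using that by (simp add: PQ)
  qed
  show ?thesis
  proof (rule card_inj_on_le)
    show "inj_on ?f (centralizer h)"
      by (rule inj_on_inverseI[of _ "\<lambda>g. P * g * Q"]) (auto simp: centralizer_def inj)
    show "?f ` centralizer h \<subseteq> centralizer h'"
    proof safe
      fix g assume "g \<in> centralizer h"
      then have g[simp]: "g \<in> carrier_mat n n" and dg: "det g \<noteq> 0" and eq: "g * h = h * g"
        by (auto simp: centralizer_def)
      have "det Q \<noteq> 0" "det P \<noteq> 0" using det_nonzeroI[OF Q P QP] det_nonzeroI[OF P Q PQ] by auto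
      then have "det (?f g) \<noteq> 0" using dg by (simp add: det_mult[of _ n] mult_carrier_mat[of _ n n])
      moreover have "?f g * h' = h' * ?f g"
        unfolding h'eq by (simp add: conj eq)
      ultimately show "?f g \<in> centralizer h'"
        by (simp add: centralizer_def mult_carrier_mat[of _ n n])
    qed
    show "finite (centralizer h')"
      by (rule finite_subset[OF _ card_carrier_mat(1)[of n n]]) (auto simp: centralizer_def)
  qed
qed

lemma similar_mat_card_eq:
  fixes h h' :: "'a::{field,finite} mat"
  assumes "similar_mat h h'"
  shows "card (forms h) = card (forms h')" "card (centralizer h) = card (centralizer h')"
proof -
  obtain n where n: "h \<in> carrier_mat n n" "h' \<in> carrier_mat n n"
    using similar_matD[OF assms] by auto
  note s = similar_mat_sym[OF assms]
  show "card (forms h) = card (forms h')"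
    by (intro antisym similar_mat_card_forms_le[OF assms n(1)] similar_mat_card_forms_le[OF s n(2)])
  show "card (centralizer h) = card (centralizer h')"
    by (intro antisym similar_mat_card_centralizer_le[OF assms n(1)]
        similar_mat_card_centralizer_le[OF s n(2)])
qed

section \<open>From the group to matrix equations, and the double count\<close>

lemma carrier_GL: "carrier (GL n) = {X \<in> carrier_mat n n. det X \<noteq> (0::'a::field)}"
  using unit_imp_det_non_zero[of _ n "()"] det_non_zero_imp_unit[of _ n "()"]
  by (auto simp: GL_def units_of_def Units_def ring_mat_def)

lemma mult_GL: "x \<otimes>\<^bsub>GL n\<^esub> y = x * y"
  by (simp add: GL_def units_of_def ring_mat_def)

lemma one_GL: "\<one>\<^bsub>GL n\<^esub> = 1\<^sub>m n"
  by (simp add: GL_def units_of_def ring_mat_def)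

lemma inv_GL:
  assumes "x \<in> carrier (GL n)"
  shows "inv\<^bsub>GL n\<^esub> x \<in> carrier_mat n n" "det (inv\<^bsub>GL n\<^esub> x) \<noteq> 0"
    "x * inv\<^bsub>GL n\<^esub> x = 1\<^sub>m n" "inv\<^bsub>GL n\<^esub> x * x = 1\<^sub>m n"
  using group.inv_closed[OF group_GL assms] group.r_inv[OF group_GL assms]
    group.l_inv[OF group_GL assms]
  by (auto simp: mult_GL one_GL carrier_GL)

text \<open>Multiplying by the transpose removes the inverse. What remains is linear in
  \<open>g\<close>, so that later it can be solved entry by entry.\<close>

lemma mult_inverse_transpose_eq_iff:
  assumes g: "g \<in> carrier (GL n)" and y: "y \<in> carrier_mat n n"
  shows "g \<otimes>\<^bsub>GL n\<^esub> inverse_transpose n g = y \<longleftrightarrow> g = y * transpose_mat g"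
proof -
  have gc: "g \<in> carrier_mat n n" and tg: "transpose_mat g \<in> carrier (GL n)" "transpose_mat g \<in> carrier_mat n n"
    using g by (auto simp: carrier_GL det_transpose)
  note i = inv_GL[OF tg(1)]
  show ?thesis unfolding mult_GL inverse_transpose_def
  proof
    assume "g * inv\<^bsub>GL n\<^esub> transpose_mat g = y"
    then have "y * transpose_mat g = g * (inv\<^bsub>GL n\<^esub> transpose_mat g * transpose_mat g)"
      using assoc_mult_mat[OF gc i(1) tg(2)] by simp
    then show "g = y * transpose_mat g" using i gc by simp
  next
    assume "g = y * transpose_mat g"
    then have "g * inv\<^bsub>GL n\<^esub> transpose_mat g = y * transpose_mat g * inv\<^bsub>GL n\<^esub> transpose_mat g" by simp
    also have "\<dots> = y * (transpose_mat g * inv\<^bsub>GL n\<^esub> transpose_mat g)"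
      using i y tg by (simp add: assoc_mult_mat[of _ n n _ n _ n])
    finally show "g * inv\<^bsub>GL n\<^esub> transpose_mat g = y" using i y by simp
  qed
qed

text \<open>Orbit and stabilizer: \<open>x\<close> conjugates \<open>h\<close> to the same matrix as
  \<open>x0\<close> exactly if \<open>x0^-1 * x\<close> centralizes \<open>h\<close>, so the
  conjugators form a coset of the centralizer.\<close>

lemma card_conjugators:
  fixes h :: "'a::{field,finite} mat"
  assumes h: "h \<in> carrier_mat n n" and x0: "x0 \<in> carrier (GL n)"
  shows "card {x \<in> carrier (GL n). x0 * h * inv\<^bsub>GL n\<^esub> x0 = x * h * inv\<^bsub>GL n\<^esub> x} = card (centralizer h)"
proof -
  let ?i = "\<lambda>x. inv\<^bsub>GL n\<^esub> x"
  have dh: "dim_row h = n" using h by auto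
  note x0c = x0[unfolded carrier_GL]
  have x0m: "x0 \<in> carrier_mat n n" "det x0 \<noteq> 0" using x0c by auto
  note i0 = inv_GL[OF x0]
  have m: "x * y \<in> carrier_mat n n" if "x \<in> carrier_mat n n" "y \<in> carrier_mat n n" for x y :: "'a mat"
    using that by simp
  note as = assoc_mult_mat[of _ n n _ n _ n]
  have key: "x0 * h * ?i x0 = x * h * ?i x \<longleftrightarrow> (?i x0 * x) * h = h * (?i x0 * x)"
    if x: "x \<in> carrier (GL n)" for x
  proof -
    have xm: "x \<in> carrier_mat n n" using x by (auto simp: carrier_GL)
    note i = inv_GL[OF x]
    show ?thesis
    proof
      assume e: "x0 * h * ?i x0 = x * h * ?i x"
      have "?i x0 * x * h = ?i x0 * (x * h * ?i x) * x"
        using i i0 xm x0m h by (simp add: as m)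
      also have "\<dots> = (?i x0 * x0) * h * (?i x0 * x)"
        unfolding e[symmetric] using i(1) i0(1) xm x0m h by (simp add: as m)
      finally show "(?i x0 * x) * h = h * (?i x0 * x)"
        using i0 h m[OF i0(1) xm] by simp
    next
      assume e: "(?i x0 * x) * h = h * (?i x0 * x)"
      have "x * h * ?i x = (x0 * ?i x0) * x * h * ?i x" using i i0 xm x0m h by simp
      also have "\<dots> = x0 * ((?i x0 * x) * h) * ?i x"
        using i(1) i0(1) xm x0m h by (simp add: as m)
      also have "\<dots> = x0 * h * ?i x0 * (x * ?i x)"
        unfolding e using i(1) i0(1) xm x0m h by (simp add: as m)
      also have "\<dots> = x0 * h * ?i x0" using i i0 xm x0m h m by simp
      finally show "x0 * h * ?i x0 = x * h * ?i x" by simp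
    qed
  qed
  have "bij_betw (\<lambda>x. ?i x0 * x) {x \<in> carrier (GL n). x0 * h * ?i x0 = x * h * ?i x} (centralizer h)"
  proof (rule bij_betw_byWitness[where f' = "\<lambda>y. x0 * y"])
    show "\<forall>a\<in>{x \<in> carrier (GL n). x0 * h * ?i x0 = x * h * ?i x}. x0 * (?i x0 * a) = a"
      using i0 x0m by (auto simp: carrier_GL assoc_mult_mat[of _ n n _ n _ n, symmetric])
    show "\<forall>y\<in>centralizer h. ?i x0 * (x0 * y) = y"
      using i0 x0m by (auto simp: centralizer_def dh assoc_mult_mat[of _ n n _ n _ n, symmetric])
    show "(\<lambda>x. ?i x0 * x) ` {x \<in> carrier (GL n). x0 * h * ?i x0 = x * h * ?i x} \<subseteq> centralizer h"
      using i0 by (auto simp: key centralizer_def dh) (auto simp: carrier_GL det_mult)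
    show "(*) x0 ` centralizer h \<subseteq> {x \<in> carrier (GL n). x0 * h * ?i x0 = x * h * ?i x}"
    proof safe
      fix y assume y: "y \<in> centralizer h"
      then show c: "x0 * y \<in> carrier (GL n)"
        using x0m by (auto simp: centralizer_def carrier_GL dh det_mult)
      have "?i x0 * (x0 * y) = y"
        using i0 x0m y by (auto simp: centralizer_def dh assoc_mult_mat[of _ n n _ n _ n, symmetric])
      then show "x0 * h * ?i x0 = (x0 * y) * h * ?i (x0 * y)"
        unfolding key[OF c] using y by (simp add: centralizer_def)
    qed
  qed
  then show ?thesis by (rule bij_betw_same_card)
qed

lemma proportion_conjugate:
  fixes h :: "'a::{field,finite} mat"
  assumes h: "h \<in> carrier (GL n)"
  shows "proportion (carrier (GL n))
          (\<lambda>g. conjugate_in_GL n (g \<otimes>\<^bsub>GL n\<^esub> inverse_transpose n g) h) =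
         real (card (forms h)) / real (card (centralizer h))"
proof -
  let ?G = "carrier (GL n) :: 'a mat set"
  let ?c = "\<lambda>x. x * h * inv\<^bsub>GL n\<^esub> x"
  let ?y = "\<lambda>g. g \<otimes>\<^bsub>GL n\<^esub> inverse_transpose n g"
  let ?S = "{g \<in> ?G. conjugate_in_GL n (?y g) h}"
  have hc: "h \<in> carrier_mat n n" using h by (auto simp: carrier_GL)
  have fin: "finite ?G"
    by (rule finite_subset[OF _ card_carrier_mat(1)[of n n]]) (auto simp: carrier_GL)
  have "1\<^sub>m n \<in> ?G" by (simp add: carrier_GL)
  then have G0: "card ?G \<noteq> 0" using fin by auto
  have "1\<^sub>m n \<in> centralizer h" using hc by (auto simp: centralizer_def)
  moreover have "finite (centralizer h)"
    by (rule finite_subset[OF _ card_carrier_mat(1)[of n n]]) (use hc in \<open>auto simp: centralizer_def\<close>)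
  ultimately have C0: "card (centralizer h) \<noteq> 0" by auto
  have row: "card {g \<in> ?G. ?y g = ?c x} = card (forms h)" if x: "x \<in> ?G" for x
  proof -
    have xm: "x \<in> carrier_mat n n" using x by (auto simp: carrier_GL)
    note i = inv_GL[OF x]
    have c: "?c x \<in> carrier_mat n n" using xm i hc by simp
    have "similar_mat (?c x) h"
      by (rule similar_matI[of _ _ x "inv\<^bsub>GL n\<^esub> x" n]) (use xm i hc c in auto)
    then have "card (forms (?c x)) = card (forms h)" by (rule similar_mat_card_eq)
    moreover have "{g \<in> ?G. ?y g = ?c x} = forms (?c x)"
      using c xm by (auto simp: forms_def mult_inverse_transpose_eq_iff carrier_GL)
    ultimately show ?thesis by simp
  qed
  \<comment> \<open>A \<open>g\<close> outside \<open>?S\<close> occurs in no pair; any other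
    \<open>g\<close> occurs with a full coset of the centralizer.\<close>
  have col: "card {x \<in> ?G. ?y g = ?c x} = (if g \<in> ?S then card (centralizer h) else 0)"
    if g: "g \<in> ?G" for g
  proof (cases "g \<in> ?S")
    case True
    then obtain x0 where x0: "x0 \<in> ?G" "?y g = ?c x0" by (auto simp: conjugate_in_GL_def mult_GL)
    then show ?thesis using card_conjugators[OF hc x0(1)] by (simp only: x0(2) True if_True)
  next
    case False
    then have "{x \<in> ?G. ?y g = ?c x} = {}" using g by (auto simp: conjugate_in_GL_def mult_GL)
    then show ?thesis by (simp only: False if_False card.empty)
  qed
  have "card ?G * card (forms h) = (\<Sum>x\<in>?G. card {g \<in> ?G. ?y g = ?c x})" by (simp add: row)
  also have "\<dots> = (\<Sum>x\<in>?G. \<Sum>g\<in>?G. if ?y g = ?c x then 1 else 0)"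
    using fin by (simp add: sum.If_cases Int_def)
  also have "\<dots> = (\<Sum>g\<in>?G. \<Sum>x\<in>?G. if ?y g = ?c x then 1 else 0)" by (rule sum.swap)
  also have "\<dots> = (\<Sum>g\<in>?G. card {x \<in> ?G. ?y g = ?c x})"
    using fin by (simp add: sum.If_cases Int_def)
  also have "\<dots> = (\<Sum>g\<in>?G. if g \<in> ?S then card (centralizer h) else 0)"
    by (intro sum.cong refl col)
  also have "\<dots> = card ?S * card (centralizer h)"
  proof -
    have "?G \<inter> ?S = ?S" by blast
    then show ?thesis using fin by (subst sum.If_cases) simp_all
  qed
  finally have "real (card ?G) * real (card (forms h)) = real (card ?S) * real (card (centralizer h))"
    by (simp only: of_nat_mult[symmetric])
  then show ?thesis using G0 C0 unfolding proportion_def by (simp add: field_simps)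
qed

section \<open>Counting invertible matrices\<close>

lemma four_block_mat_inject:
  assumes "A \<in> carrier_mat a c" "B \<in> carrier_mat a d" "C \<in> carrier_mat b c" "D \<in> carrier_mat b d"
    and "A' \<in> carrier_mat a c" "B' \<in> carrier_mat a d" "C' \<in> carrier_mat b c" "D' \<in> carrier_mat b d"
  shows "four_block_mat A B C D = four_block_mat A' B' C' D' \<longleftrightarrow> A = A' \<and> B = B' \<and> C = C' \<and> D = D'"
    (is "?X = ?X' \<longleftrightarrow> _")
proof
  assume eq: "?X = ?X'"
  have split: "split_block (four_block_mat A B C D) a c = (A, B, C, D)"
    if "A \<in> carrier_mat a c" "B \<in> carrier_mat a d" "C \<in> carrier_mat b c" "D \<in> carrier_mat b d"
    for A B C D :: "'a mat"
    using that unfolding split_block_def Let_def by (auto intro!: eq_matI)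
  show "A = A' \<and> B = B' \<and> C = C' \<and> D = D'"
    using split[OF assms(1-4), unfolded eq split[OF assms(5-8)]] by simp
qed simp

lemma four_block_matE:
  assumes "X \<in> carrier_mat (a + b) (c + d)"
  obtains A B C D where "A \<in> carrier_mat a c" "B \<in> carrier_mat a d" "C \<in> carrier_mat b c"
    "D \<in> carrier_mat b d" "X = four_block_mat A B C D"
proof -
  obtain A B C D where "split_block X a c = (A, B, C, D)" by (metis prod_cases4)
  from split_block[OF this, of b d] show ?thesis using that assms by auto
qed

text \<open>The lower right block is written as \<open>T + R * Y * Q\<close> with \<open>Y\<close>
  inverse to \<open>P\<close>, so that \<open>T\<close> is the Schur complement. Block elimination
  factors the matrix into a unipotent lower and an upper block triangular one.\<close>

lemma det_four_block_mat_schur: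
  fixes P :: "'a::field mat"
  assumes P: "P \<in> carrier_mat a a" and Q: "Q \<in> carrier_mat a b" and R: "R \<in> carrier_mat b a"
    and T: "T \<in> carrier_mat b b" and Y: "Y \<in> carrier_mat a a" and YP: "Y * P = 1\<^sub>m a"
  shows "det (four_block_mat P Q R (T + R * Y * Q)) = det P * det T"
proof -
  let ?L = "four_block_mat (1\<^sub>m a) (0\<^sub>m a b) (R * Y) (1\<^sub>m b)"
  let ?U = "four_block_mat P Q (0\<^sub>m b a) T"
  have RYP: "R * Y * P = R"
    using assoc_mult_mat[OF R Y P] YP R by simp
  have "?L * ?U = four_block_mat P Q R (R * Y * Q + T)"
    using P Q R T Y by (subst mult_four_block_mat) (auto simp: RYP mult_carrier_mat[of _ b a])
  also have "R * Y * Q + T = T + R * Y * Q"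
    using P Q R T Y by (intro comm_add_mat[of _ b b]) auto
  finally have "det (four_block_mat P Q R (T + R * Y * Q)) = det (?L * ?U)" by simp
  also have "\<dots> = det ?L * det ?U"
    by (rule det_mult[of _ "a + b"]) (use P Q R T Y in auto)
  also have "det ?L = 1"
    by (subst det_four_block_mat_upper_right_zero[of _ a _ b]) (use P Q R T Y in auto)
  also have "det ?U = det P * det T"
    by (rule det_four_block_mat_lower_left_zero[OF P Q _ T]) simp
  finally show ?thesis by simp
qed

section \<open>The order of \<open>GL(m,q)\<close>, by counting first rows\<close>

definition unit_row :: "nat \<Rightarrow> 'a::field mat" where
  "unit_row m = mat 1 m (\<lambda>(i, j). if j = 0 then 1 else 0)"

lemma unit_row_carrier [simp]: "unit_row m \<in> carrier_mat 1 m" "unit_row m \<in> carrier_mat (Suc 0) m"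
  by (simp_all add: unit_row_def)

lemma unit_row_dim [simp]: "dim_row (unit_row m) = 1" "dim_col (unit_row m) = m"
  by (simp_all add: unit_row_def)

lemma unit_row_index [simp]: "j < m \<Longrightarrow> unit_row m $$ (0, j) = (if j = 0 then 1 else 0)"
  by (simp add: unit_row_def)

lemma unit_row_mult_index:
  assumes "X \<in> carrier_mat (Suc m) k" "j < k"
  shows "(unit_row (Suc m) * X) $$ (0, j) = X $$ (0, j)"
proof -
  have "(unit_row (Suc m) * X) $$ (0, j) = (\<Sum>i<Suc m. (if i = 0 then 1 else 0) * X $$ (i, j))"
    using assms by (auto simp: unit_row_def scalar_prod_def lessThan_atLeast0 intro!: sum.cong)
  then show ?thesis by (simp add: if_distrib[of "\<lambda>x. x * _"] del: sum.lessThan_Suc cong: if_cong)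
qed

lemma ex_det_nonzero_first_row:
  fixes v :: "'a::field mat"
  assumes v: "v \<in> carrier_mat 1 (Suc m)" and v0: "v \<noteq> 0\<^sub>m 1 (Suc m)"
  shows "\<exists>P \<in> carrier_mat (Suc m) (Suc m). det P \<noteq> 0 \<and> unit_row (Suc m) * P = v"
proof -
  let ?n = "Suc m"
  have "\<exists>p < ?n. v $$ (0, p) \<noteq> 0"
  proof (rule ccontr)
    assume "\<not> (\<exists>p < ?n. v $$ (0, p) \<noteq> 0)"
    then have "v = 0\<^sub>m 1 ?n" using v by (intro eq_matI) auto
    then show False using v0 by simp
  qed
  then obtain p where p: "p < ?n" "v $$ (0, p) \<noteq> 0" by blast
  \<comment> \<open>If \<open>v\<close> has a nonzero entry at \<open>p\<close>, it can replace the
    unit row number \<open>p\<close> in a basis. So \<open>v\<close> becomes row 0, the displaced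
    first unit row goes to row \<open>p\<close>, and all other rows are those of the identity. For
    \<open>p = 0\<close> the first clause takes precedence.\<close>
  define P where "P = mat ?n ?n (\<lambda>(i, j). if i = 0 then v $$ (0, j)
    else if i = p then (if j = 0 then 1 else 0) else if i = j then 1 else 0)"
  have P: "P \<in> carrier_mat ?n ?n" by (simp add: P_def)
  have "det P \<noteq> 0"
  proof
    assume "det P = 0"
    then obtain x where x: "x \<in> carrier_vec ?n" "x \<noteq> 0\<^sub>v ?n" "P *\<^sub>v x = 0\<^sub>v ?n"
      using det_0_iff_vec_prod_zero_field[OF P] by auto
    have s: "(\<Sum>j<?n. P $$ (i, j) * x $ j) = 0" if "i < ?n" for i
    proof -
      have "(\<Sum>j<?n. P $$ (i, j) * x $ j) = (P *\<^sub>v x) $ i" using that P x(1) by (simp add: scalar_prod_def lessThan_atLeast0 del: sum.op_ivl_Suc)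
      then show ?thesis using x(3) that by simp
    qed
    have 1: "x $ i = 0" if i: "i < ?n" "i \<noteq> 0" "i \<noteq> p" for i
    proof -
      have "(\<Sum>j<?n. P $$ (i, j) * x $ j) = (\<Sum>j<?n. if j = i then x $ i else 0)"
        using i by (intro sum.cong) (auto simp: P_def)
      then show ?thesis using s[OF i(1)] i by (simp del: sum.lessThan_Suc)
    qed
    have 2: "x $ 0 = 0" if p0: "p \<noteq> 0"
    proof -
      have "(\<Sum>j<?n. P $$ (p, j) * x $ j) = (\<Sum>j<?n. if j = 0 then x $ 0 else 0)"
        using p p0 by (intro sum.cong) (auto simp: P_def)
      then show ?thesis using s[OF p(1)] p by (simp del: sum.lessThan_Suc)
    qed
    have 3: "x $ p = 0"
    proof -
      have "(\<Sum>j<?n. P $$ (0, j) * x $ j) = (\<Sum>j<?n. if j = p then v $$ (0, p) * x $ p else 0)"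
        using 1 2 by (intro sum.cong) (auto simp: P_def)
      then show ?thesis using s[of 0] p by (simp del: sum.lessThan_Suc)
    qed
    have "x = 0\<^sub>v ?n"
    proof (rule eq_vecI)
      fix i assume "i < dim_vec (0\<^sub>v ?n :: 'a vec)"
      then show "x $ i = 0\<^sub>v ?n $ i" using 1[of i] 2 3 by (cases "i = p"; cases "i = 0") auto
    qed (use x in simp)
    then show False using x by simp
  qed
  moreover have "unit_row ?n * P = v"
  proof (rule eq_matI)
    fix i j assume "i < dim_row v" "j < dim_col v"
    then have ij: "i = 0" "j < ?n" using v by auto
    show "(unit_row ?n * P) $$ (i, j) = v $$ (i, j)"
      unfolding ij(1) unit_row_mult_index[OF P ij(2)] using ij by (simp add: P_def)
  qed (use v P in auto)
  ultimately show ?thesis using P by blast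
qed

lemma card_carrier_mat_nonzero:
  "card {v \<in> carrier_mat a b. v \<noteq> (0\<^sub>m a b :: 'a::{field,finite} mat)} = CARD('a) ^ (a * b) - 1"
proof -
  have "{v \<in> carrier_mat a b. v \<noteq> (0\<^sub>m a b :: 'a mat)} = carrier_mat a b - {0\<^sub>m a b}" by auto
  then show ?thesis by (simp add: card_Diff_singleton card_carrier_mat)
qed

abbreviation inv_mats :: "nat \<Rightarrow> 'a::field mat set" where
  "inv_mats m \<equiv> {X \<in> carrier_mat m m. det X \<noteq> 0}"

lemma finite_mats: "S \<subseteq> carrier_mat a b \<Longrightarrow> finite (S :: 'a::finite mat set)"
  by (rule finite_subset[OF _ card_carrier_mat(1)])

text \<open>Right multiplication by an invertible matrix with first row \<open>v\<close> carries
  first row \<open>unit_row\<close> to first row \<open>v\<close>, so the count does not depend on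
  \<open>v\<close>. For first row \<open>unit_row\<close> the column below the 1 is free and the
  remaining block must be invertible.\<close>

lemma card_inv_mats_row:
  fixes v :: "'a::{field,finite} mat"
  assumes v: "v \<in> carrier_mat 1 (Suc m)" and v0: "v \<noteq> 0\<^sub>m 1 (Suc m)"
  shows "card {X \<in> inv_mats (Suc m). unit_row (Suc m) * X = v} =
    CARD('a) ^ m * card (inv_mats m :: 'a mat set)"
proof -
  let ?n = "Suc m"
  let ?e = "unit_row ?n :: 'a mat"
  obtain P where P: "P \<in> carrier_mat ?n ?n" "det P \<noteq> 0" "?e * P = v"
    using ex_det_nonzero_first_row[OF assms] by blast
  from det_nonzero_inverse[OF P(1,2)] obtain Y where
    Y: "Y \<in> carrier_mat ?n ?n" "P * Y = 1\<^sub>m ?n" "Y * P = 1\<^sub>m ?n" "det Y \<noteq> 0" by blast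
  have e: "?e \<in> carrier_mat 1 ?n" by simp
  have vY: "v * Y = ?e" unfolding P(3)[symmetric] using assoc_mult_mat[OF e P(1) Y(1)] Y(2) by simp
  have 1: "bij_betw (\<lambda>X. X * P) {X \<in> inv_mats ?n. ?e * X = ?e} {X \<in> inv_mats ?n. ?e * X = v}"
  proof (rule bij_betw_byWitness[where f' = "\<lambda>X. X * Y"])
    show "\<forall>X\<in>{X \<in> inv_mats ?n. ?e * X = ?e}. X * P * Y = X"
      using P Y by (auto simp: assoc_mult_mat[of _ ?n ?n _ ?n _ ?n])
    show "\<forall>X\<in>{X \<in> inv_mats ?n. ?e * X = v}. X * Y * P = X"
      using P Y by (auto simp: assoc_mult_mat[of _ ?n ?n _ ?n _ ?n])
    show "(\<lambda>X. X * P) ` {X \<in> inv_mats ?n. ?e * X = ?e} \<subseteq> {X \<in> inv_mats ?n. ?e * X = v}"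
      using P by (auto simp: det_mult[of _ ?n] assoc_mult_mat[OF e _ P(1), symmetric])
    show "(\<lambda>X. X * Y) ` {X \<in> inv_mats ?n. ?e * X = v} \<subseteq> {X \<in> inv_mats ?n. ?e * X = ?e}"
      using Y vY by (auto simp: det_mult[of _ ?n] assoc_mult_mat[OF e _ Y(1), symmetric])
  qed
  let ?f = "\<lambda>(w, X). four_block_mat (1\<^sub>m 1) (0\<^sub>m 1 m) w X :: 'a mat"
  have 2: "bij_betw ?f (carrier_mat m 1 \<times> inv_mats m) {X \<in> inv_mats ?n. ?e * X = ?e}"
    unfolding bij_betw_def
  proof
    show "inj_on ?f (carrier_mat m 1 \<times> inv_mats m)"
      by (rule inj_onI) (auto simp: four_block_mat_inject[of _ 1 1 _ m _ m])
    show "?f ` (carrier_mat m 1 \<times> inv_mats m) = {X \<in> inv_mats ?n. ?e * X = ?e}"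
    proof (intro equalityI subsetI)
      fix X assume "X \<in> ?f ` (carrier_mat m 1 \<times> inv_mats m)"
      then obtain w Z where wZ: "w \<in> carrier_mat m 1" "Z \<in> carrier_mat m m" "det Z \<noteq> 0" "X = ?f (w, Z)" by auto
      have X: "X \<in> carrier_mat ?n ?n" using wZ four_block_carrier_mat[of "1\<^sub>m 1" 1 1 Z m m] by simp
      have "det X = det Z" using wZ by (simp add: det_four_block_mat_upper_right_zero[of _ 1 _ m])
      moreover have "?e * X = ?e"
      proof (rule eq_matI)
        fix i j assume "i < dim_row ?e" "j < dim_col ?e"
        then have ij: "i = 0" "j < ?n" by auto
        show "(?e * X) $$ (i, j) = ?e $$ (i, j)"
          unfolding ij(1) unit_row_mult_index[OF X ij(2)] using ij wZ by auto
      qed (use X in auto)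
      ultimately show "X \<in> {X \<in> inv_mats ?n. ?e * X = ?e}" using X wZ by auto
    next
      fix X assume "X \<in> {X \<in> inv_mats ?n. ?e * X = ?e}"
      then have X: "X \<in> carrier_mat ?n ?n" "det X \<noteq> 0" "?e * X = ?e" by auto
      then have "X \<in> carrier_mat (1 + m) (1 + m)" by simp
      from four_block_matE[OF this] obtain A B C D where X4: "A \<in> carrier_mat 1 1" "B \<in> carrier_mat 1 m" "C \<in> carrier_mat m 1"
        "D \<in> carrier_mat m m" "X = four_block_mat A B C D" by blast
      have r: "X $$ (0, j) = (if j = 0 then 1 else 0)" if "j < ?n" for j
        using unit_row_mult_index[OF X(1) that] that unfolding X(3) by simp
      have "A = 1\<^sub>m 1" using r[of 0] X4 by (intro eq_matI) auto
      moreover have "B = 0\<^sub>m 1 m"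
      proof (rule eq_matI)
        fix i j assume "i < dim_row (0\<^sub>m 1 m :: 'a mat)" "j < dim_col (0\<^sub>m 1 m :: 'a mat)"
        then show "B $$ (i, j) = 0\<^sub>m 1 m $$ (i, j)" using r[of "Suc j"] X4 by auto
      qed (use X4 in auto)
      ultimately have X': "X = ?f (C, D)" using X4 by simp
      then have "det X = det D" using X4 by (simp add: det_four_block_mat_upper_right_zero[of _ 1 _ m])
      then show "X \<in> ?f ` (carrier_mat m 1 \<times> inv_mats m)" by (intro image_eqI[of _ _ "(C, D)"]) (use X' X X4 in auto)
    qed
  qed
  from bij_betw_same_card[OF 1] bij_betw_same_card[OF 2] show ?thesis
    by (simp add: card_cartesian_product card_carrier_mat)
qed

lemma card_inv_mats_Suc:
  "card (inv_mats (Suc m) :: 'a::{field,finite} mat set) =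
    (CARD('a) ^ Suc m - 1) * (CARD('a) ^ m * card (inv_mats m :: 'a mat set))"
proof -
  let ?n = "Suc m"
  let ?V = "{v \<in> carrier_mat 1 ?n. v \<noteq> (0\<^sub>m 1 ?n :: 'a mat)}"
  let ?e = "unit_row ?n :: 'a mat"
  have "inv_mats ?n = (\<Union>v\<in>?V. {X \<in> inv_mats ?n. ?e * X = v})"
  proof (intro equalityI subsetI)
    fix X :: "'a mat" assume X: "X \<in> inv_mats ?n"
    have "?e * X \<noteq> 0\<^sub>m 1 ?n"
    proof
      assume 0: "?e * X = 0\<^sub>m 1 ?n"
      obtain Y where Y: "Y \<in> carrier_mat ?n ?n" "X * Y = 1\<^sub>m ?n"
        using X det_nonzero_inverse[of X ?n] by blast
      have "?e = ?e * X * Y" using X Y assoc_mult_mat[of ?e 1 ?n X ?n Y ?n] by simp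
      then have "?e = 0\<^sub>m 1 ?n" using 0 Y by simp
      then have "?e $$ (0, 0) = 0\<^sub>m 1 ?n $$ (0, 0)" by (rule arg_cong)
      then show False by simp
    qed
    moreover have "?e * X \<in> carrier_mat 1 ?n" using X by (intro mult_carrier_mat[of _ 1 ?n]) auto
    ultimately have "?e * X \<in> ?V" by blast
    then show "X \<in> (\<Union>v\<in>?V. {X \<in> inv_mats ?n. ?e * X = v})" using X by blast
  qed auto
  then have "card (inv_mats ?n :: 'a mat set) = card (\<Union>v\<in>?V. {X \<in> inv_mats ?n. ?e * X = v})" by (rule arg_cong)
  also have "\<dots> = (\<Sum>v\<in>?V. card {X \<in> inv_mats ?n. ?e * X = v})"
    by (rule card_UN_disjoint) (auto intro: finite_mats[of _ 1 ?n] finite_mats[of _ ?n ?n])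
  also have "\<dots> = (\<Sum>v\<in>?V. CARD('a) ^ m * card (inv_mats m :: 'a mat set))"
    by (intro sum.cong refl card_inv_mats_row) auto
  finally show ?thesis by (simp add: card_carrier_mat_nonzero)
qed

text \<open>The sign \<open>s\<close> distinguishes the two applications: \<open>s = 1\<close> gives
  symmetric matrices whose first basis vector is isotropic, \<open>s = - 1\<close> gives differences
  \<open>A - A'\<close>.\<close>

abbreviation border :: "'a::field \<Rightarrow> 'a mat \<Rightarrow> 'a mat \<Rightarrow> 'a mat" where
  "border s v Y \<equiv> four_block_mat (0\<^sub>m 1 1) v (s \<cdot>\<^sub>m transpose_mat v) Y"

text \<open>Congruence by the direct sum of 1 and \<open>P\<close> replaces \<open>v\<close> by
  \<open>v * P\<close> and \<open>\<Phi> Y\<close> by \<open>P' * \<Phi> Y * P\<close>. The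
  parameters \<open>K\<close> and \<open>\<Phi>\<close> are abstract in order to cover symmetric
  \<open>Y\<close> with \<open>\<Phi>\<close> the identity and arbitrary \<open>Y\<close> with
  \<open>\<Phi> Y = Y - Y'\<close>.\<close>

lemma card_border_le:
  fixes v :: "'a::{field,finite} mat"
  assumes P: "P \<in> carrier_mat m m" "det P \<noteq> 0" and v: "v \<in> carrier_mat 1 m"
    and K: "K \<subseteq> carrier_mat m m"
    and closed: "\<And>Y. Y \<in> K \<Longrightarrow> transpose_mat P * Y * P \<in> K"
    and \<Phi>: "\<And>Y. Y \<in> K \<Longrightarrow> \<Phi> Y \<in> carrier_mat m m"
    and equiv: "\<And>Y. Y \<in> K \<Longrightarrow> \<Phi> (transpose_mat P * Y * P) = transpose_mat P * \<Phi> Y * P"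
  shows "card {Y \<in> K. det (border s v (\<Phi> Y)) \<noteq> 0} \<le> card {Y \<in> K. det (border s (v * P) (\<Phi> Y)) \<noteq> 0}"
proof (rule card_inj_on_le)
  let ?f = "\<lambda>Y. transpose_mat P * Y * P"
  have TP: "transpose_mat P \<in> carrier_mat m m" using P by simp
  from det_nonzero_inverse[OF P] obtain Q where Q: "Q \<in> carrier_mat m m" "P * Q = 1\<^sub>m m" by metis
  have TQ: "transpose_mat Q * transpose_mat P = 1\<^sub>m m"
    using transpose_mult[OF P(1) Q(1)] Q(2) by simp
  show "inj_on ?f {Y \<in> K. det (border s v (\<Phi> Y)) \<noteq> 0}"
  proof (rule inj_on_inverseI[of _ "\<lambda>Y. transpose_mat Q * Y * Q"])
    fix Y assume "Y \<in> {Y \<in> K. det (border s v (\<Phi> Y)) \<noteq> 0}"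
    then have Y: "Y \<in> carrier_mat m m" using K by auto
    have "transpose_mat Q * ?f Y * Q = (transpose_mat Q * transpose_mat P) * Y * (P * Q)"
      using P Q Y by (simp add: assoc_mult_mat[of _ m m _ m _ m] mult_carrier_mat[of _ m m])
    then show "transpose_mat Q * ?f Y * Q = Y" using TQ Q Y by simp
  qed
  show "?f ` {Y \<in> K. det (border s v (\<Phi> Y)) \<noteq> 0} \<subseteq> {Y \<in> K. det (border s (v * P) (\<Phi> Y)) \<noteq> 0}"
  proof safe
    fix Y assume Y: "Y \<in> K" "det (border s v (\<Phi> Y)) \<noteq> 0"
    let ?W = "four_block_mat (1\<^sub>m 1) (0\<^sub>m 1 m) (0\<^sub>m m 1) P"
    let ?W' = "four_block_mat (1\<^sub>m 1) (0\<^sub>m 1 m) (0\<^sub>m m 1) (transpose_mat P)"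
    let ?X = "border s v (\<Phi> Y)"
    note p = \<Phi>[OF Y(1)]
    have c: "?W \<in> carrier_mat (1 + m) (1 + m)" "?W' \<in> carrier_mat (1 + m) (1 + m)" "?X \<in> carrier_mat (1 + m) (1 + m)"
      using P p by (intro four_block_carrier_mat, auto)+
    have s: "s \<cdot>\<^sub>m transpose_mat v \<in> carrier_mat m 1" using v by simp
    have "?X * ?W = four_block_mat (0\<^sub>m 1 1) (v * P) (s \<cdot>\<^sub>m transpose_mat v) (\<Phi> Y * P)"
      using P p v s by (subst mult_four_block_mat[of _ 1 1 _ m _ m]) (auto)
    then have "?W' * (?X * ?W) = four_block_mat (0\<^sub>m 1 1) (v * P)
        (transpose_mat P * (s \<cdot>\<^sub>m transpose_mat v)) (transpose_mat P * (\<Phi> Y * P))"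
      using P p v s by (simp only:) (subst mult_four_block_mat[of _ 1 1 _ m _ m], auto)
    also have "\<dots> = border s (v * P) (\<Phi> (?f Y))"
      using P p v equiv[OF Y(1)] by (simp add: transpose_mult[OF v P(1)] assoc_mult_mat[of _ m m _ m _ m]
          mult_smult_distrib[of _ m m _ 1])
    finally have "det (border s (v * P) (\<Phi> (?f Y))) = det (?W' * (?X * ?W))" by simp
    also have "\<dots> = det ?W' * (det ?X * det ?W)"
      using c by (simp add: det_mult[of _ "1 + m"] mult_carrier_mat[of _ "1 + m" "1 + m"])
    also have "det ?W = det P" by (subst det_four_block_mat_upper_right_zero[of _ 1 _ m]) (use P in auto)
    also have "det ?W' = det P"
      by (subst det_four_block_mat_upper_right_zero[of _ 1 _ m]) (use P det_transpose[OF P(1)] in auto)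
    finally show "det (border s (v * P) (\<Phi> (?f Y))) = 0 \<Longrightarrow> False" using P Y by simp
    show "?f Y \<in> K" by (rule closed[OF Y(1)])
  qed
  show "finite {Y \<in> K. det (border s (v * P) (\<Phi> Y)) \<noteq> 0}" using K by (intro finite_mats[of _ m m]) auto
qed

text \<open>Nonzero rows form one orbit under right multiplication by invertible matrices; the
  inequality is applied to \<open>P\<close> and to its inverse.\<close>

lemma card_border_eq:
  fixes v :: "'a::{field,finite} mat"
  assumes v: "v \<in> carrier_mat 1 (Suc m)" "v \<noteq> 0\<^sub>m 1 (Suc m)"
    and K: "K \<subseteq> carrier_mat (Suc m) (Suc m)"
    and closed: "\<And>P Y. P \<in> carrier_mat (Suc m) (Suc m) \<Longrightarrow> Y \<in> K \<Longrightarrow> transpose_mat P * Y * P \<in> K"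
    and \<Phi>: "\<And>Y. Y \<in> K \<Longrightarrow> \<Phi> Y \<in> carrier_mat (Suc m) (Suc m)"
    and equiv: "\<And>P Y. P \<in> carrier_mat (Suc m) (Suc m) \<Longrightarrow> Y \<in> K \<Longrightarrow>
      \<Phi> (transpose_mat P * Y * P) = transpose_mat P * \<Phi> Y * P"
  shows "card {Y \<in> K. det (border s v (\<Phi> Y)) \<noteq> 0} =
    card {Y \<in> K. det (border s (unit_row (Suc m)) (\<Phi> Y)) \<noteq> 0}"
proof -
  let ?n = "Suc m"
  let ?e = "unit_row ?n :: 'a mat"
  obtain P where P: "P \<in> carrier_mat ?n ?n" "det P \<noteq> 0" "?e * P = v"
    using ex_det_nonzero_first_row[OF v] by blast
  from det_nonzero_inverse[OF P(1,2)] obtain Y where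
    Y: "Y \<in> carrier_mat ?n ?n" "P * Y = 1\<^sub>m ?n" "Y * P = 1\<^sub>m ?n" "det Y \<noteq> 0" by blast
  have e: "?e \<in> carrier_mat 1 ?n" by simp
  have vY: "v * Y = ?e" unfolding P(3)[symmetric] using assoc_mult_mat[OF e P(1) Y(1)] Y(2) by simp
  show ?thesis
    using card_border_le[of P ?n ?e K \<Phi> s] card_border_le[of Y ?n v K \<Phi> s] P Y v e vY K closed \<Phi> equiv
    by (intro antisym) auto
qed

text \<open>Expansion along row 0 leaves only the entry at column 1, with sign -1; in the remaining
  minor the first column has only the entry \<open>s\<close>, now at the top left, with sign
  +1.\<close>

lemma det_hook:
  fixes X :: "'a::field mat"
  assumes X: "X \<in> carrier_mat (Suc (Suc m)) (Suc (Suc m))"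
    and row: "\<And>j. j < Suc (Suc m) \<Longrightarrow> X $$ (0, j) = (if j = 1 then 1 else 0)"
    and col: "\<And>i. i < Suc (Suc m) \<Longrightarrow> X $$ (i, 0) = (if i = 1 then s else 0)"
  shows "det X = - s * det (mat m m (\<lambda>(i, j). X $$ (Suc (Suc i), Suc (Suc j))))"
proof -
  let ?Y = "mat_delete X 0 1"
  have Y: "?Y \<in> carrier_mat (Suc m) (Suc m)" using mat_delete_carrier[OF X] by simp
  have "det X = (\<Sum>j<Suc (Suc m). X $$ (0, j) * cofactor X 0 j)"
    by (rule laplace_expansion_row[OF X]) simp
  also have "\<dots> = (\<Sum>j<Suc (Suc m). if j = 1 then cofactor X 0 1 else 0)"
    by (intro sum.cong) (auto simp: row)
  also have "\<dots> = - det ?Y" by (simp add: cofactor_def del: sum.lessThan_Suc)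
  also have "det ?Y = (\<Sum>i<Suc m. ?Y $$ (i, 0) * cofactor ?Y i 0)"
    by (rule laplace_expansion_column[OF Y]) simp
  also have "\<dots> = (\<Sum>i<Suc m. if i = 0 then s * cofactor ?Y 0 0 else 0)"
    using X by (intro sum.cong) (auto simp: mat_delete_def col)
  also have "\<dots> = s * det (mat_delete ?Y 0 0)" by (simp add: cofactor_def del: sum.lessThan_Suc)
  also have "mat_delete ?Y 0 0 = mat m m (\<lambda>(i, j). X $$ (Suc (Suc i), Suc (Suc j)))"
    using X by (intro eq_matI) (auto simp: mat_delete_def)
  finally show ?thesis by simp
qed

section \<open>Block decomposition by Schur complements\<close>

abbreviation dsum :: "'a::field mat \<Rightarrow> 'a mat \<Rightarrow> 'a mat" where
  "dsum A B \<equiv> four_block_mat A (0\<^sub>m (dim_row A) (dim_col B)) (0\<^sub>m (dim_row B) (dim_col A)) B"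

lemma eq_dsum_mult_transpose_iff:
  fixes P :: "'a::field mat"
  assumes c: "P \<in> carrier_mat a a" "Q \<in> carrier_mat a b" "R \<in> carrier_mat b a" "T \<in> carrier_mat b b"
    and h: "h1 \<in> carrier_mat a a" "h2 \<in> carrier_mat b b"
  shows "four_block_mat P Q R T = dsum h1 h2 * transpose_mat (four_block_mat P Q R T) \<longleftrightarrow>
    P = h1 * transpose_mat P \<and> Q = h1 * transpose_mat R \<and> R = h2 * transpose_mat Q \<and> T = h2 * transpose_mat T"
proof -
  have "dsum h1 h2 * transpose_mat (four_block_mat P Q R T) =
    four_block_mat (h1 * transpose_mat P) (h1 * transpose_mat R) (h2 * transpose_mat Q) (h2 * transpose_mat T)"
    unfolding transpose_four_block_mat[OF c]
    by (subst mult_four_block_mat[of _ a a _ b _ b]) (use c h in auto)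
  then show ?thesis
    using c h by (simp only:) (subst four_block_mat_inject[of _ a a _ b _ b], auto)
qed

lemma dsum_commute_iff:
  fixes P :: "'a::field mat"
  assumes c: "P \<in> carrier_mat a a" "Q \<in> carrier_mat a b" "R \<in> carrier_mat b a" "T \<in> carrier_mat b b"
    and h: "h1 \<in> carrier_mat a a" "h2 \<in> carrier_mat b b"
  shows "four_block_mat P Q R T * dsum h1 h2 = dsum h1 h2 * four_block_mat P Q R T \<longleftrightarrow>
    P * h1 = h1 * P \<and> Q * h2 = h1 * Q \<and> R * h1 = h2 * R \<and> T * h2 = h2 * T"
proof -
  have "dsum h1 h2 * four_block_mat P Q R T = four_block_mat (h1 * P) (h1 * Q) (h2 * R) (h2 * T)"
    by (subst mult_four_block_mat[of _ a a _ b _ b]) (use c h in auto)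
  moreover have "four_block_mat P Q R T * dsum h1 h2 = four_block_mat (P * h1) (Q * h2) (R * h1) (T * h2)"
    by (subst mult_four_block_mat[of _ a a _ b _ b]) (use c h in auto)
  ultimately show ?thesis
    using c h by (simp only:) (subst four_block_mat_inject[of _ a a _ b _ b], auto)
qed

text \<open>The domain on which the Schur complement is available. For the splitting of a largest
  part it turns out to be everything; for symmetric matrices and \<open>a = 1\<close> it is a
  genuine case distinction, namely whether the first basis vector is anisotropic.\<close>

definition pivot_block :: "nat \<Rightarrow> 'a::field mat \<Rightarrow> bool" where
  "pivot_block a X \<longleftrightarrow> det (mat a a (\<lambda>ij. X $$ ij)) \<noteq> 0"

lemma pivot_block_four_block_mat:
  assumes "P \<in> carrier_mat a a" "T \<in> carrier_mat b b"
  shows "pivot_block a (four_block_mat P Q R T) \<longleftrightarrow> det P \<noteq> 0"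
proof -
  have "mat a a (\<lambda>ij. four_block_mat P Q R T $$ ij) = P"
    using assms by (intro eq_matI) auto
  then show ?thesis by (simp add: pivot_block_def)
qed

lemma add_eq_add_mat_iff:
  fixes A :: "'a::field mat"
  assumes "A \<in> carrier_mat n m" "B \<in> carrier_mat n m" "C \<in> carrier_mat n m"
  shows "A + C = B + C \<longleftrightarrow> A = B"
proof
  assume eq: "A + C = B + C"
  show "A = B"
  proof (rule eq_matI)
    fix i j assume "i < dim_row B" "j < dim_col B"
    then show "A $$ (i, j) = B $$ (i, j)" using arg_cong[OF eq, of "\<lambda>X. X $$ (i, j)"] assms by auto
  qed (use assms in auto)
qed simp

lemma minus_add_cancel_mat_carrier:
  fixes A :: "'a::field mat"
  assumes "A \<in> carrier_mat n m" "C \<in> carrier_mat n m"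
  shows "A - C + C = A" 
proof (rule eq_matI)
  fix i j assume "i < dim_row A" "j < dim_col A"
  then show "(A - C + C) $$ (i, j) = A $$ (i, j)" using assms by simp
qed (use assms in simp_all)

text \<open>The equation forces \<open>R = h2 * Q'\<close>, which leaves a condition on
  \<open>Q\<close> alone. The correction \<open>?S P Q\<close> satisfies the same linear equation as
  forms of \<open>h2\<close>, so subtracting it turns the lower right block into a form of
  \<open>h2\<close> again.\<close>

lemma card_forms_schur:
  fixes h1 h2 :: "'a::{field,finite} mat"
  assumes h: "h1 \<in> carrier_mat a a" "h2 \<in> carrier_mat b b"
    and dh1: "det h1 \<noteq> 0"
  shows "card {X \<in> forms (dsum h1 h2). pivot_block a X} =
    card (forms h1) * card {Q \<in> carrier_mat a b. Q = h1 * Q * transpose_mat h2} * card (forms h2)"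
proof -
  let ?i = "\<lambda>P. inv\<^bsub>GL a\<^esub> P"
  let ?Q = "{Q \<in> carrier_mat a b. Q = h1 * Q * transpose_mat h2}"
  let ?S = "\<lambda>P Q. (h2 * transpose_mat Q) * ?i P * Q"
  let ?F = "\<lambda>(P, Q, T). four_block_mat P Q (h2 * transpose_mat Q) (T + ?S P Q)"
  let ?D = "forms h1 \<times> ?Q \<times> forms h2"
  have d: "dim_row h1 = a" "dim_row h2 = b" "dim_col h1 = a" "dim_col h2 = b" using h by auto
  have f1: "P \<in> carrier_mat a a" "det P \<noteq> 0" "P = h1 * transpose_mat P" "P \<in> carrier (GL a)"
    if "P \<in> forms h1" for P using that by (auto simp: forms_def d carrier_GL)
  have f2: "T \<in> carrier_mat b b" "det T \<noteq> 0" "T = h2 * transpose_mat T"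
    if "T \<in> forms h2" for T using that by (auto simp: forms_def d)
  have Sc: "?S P Q \<in> carrier_mat b b" if "P \<in> forms h1" "Q \<in> ?Q" for P Q
    using f1[OF that(1)] that h inv_GL[OF f1(4)[OF that(1)]] by auto
  have Ssym: "?S P Q = h2 * transpose_mat (?S P Q)" if P: "P \<in> forms h1" and Q: "Q \<in> ?Q" for P Q
  proof -
    note f = f1[OF P] and i = inv_GL[OF f1(4)[OF P]]
    have Qc: "Q \<in> carrier_mat a b" and Qe: "Q = h1 * Q * transpose_mat h2" using Q by auto
    \<comment> \<open>From \<open>P = h1 * P'\<close> one gets \<open>P^-1 * h1 * P' = 1\<close>, so
      \<open>P^-1 * h1\<close> is the inverse of \<open>P'\<close>.\<close>
    have "?i P * h1 = transpose_mat (?i P)"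
    proof -
      have "transpose_mat P * transpose_mat (?i P) = 1\<^sub>m a"
        using transpose_mult[OF i(1) f(1)] i(4) by simp
      then have "?i P * h1 = ?i P * (h1 * (transpose_mat P * transpose_mat (?i P)))"
        using h i by simp
      also have "\<dots> = ?i P * (h1 * transpose_mat P) * transpose_mat (?i P)"
        using h i f(1) by (simp add: assoc_mult_mat[of _ a a _ a _ a] mult_carrier_mat[of _ a a])
      also have "\<dots> = transpose_mat (?i P)" using f(3) i by simp
      finally show ?thesis .
    qed
    then have "transpose_mat (?i P) * (Q * transpose_mat h2) = ?i P * h1 * (Q * transpose_mat h2)" by simp
    also have "\<dots> = ?i P * (h1 * Q * transpose_mat h2)"
      using h i Qc by (simp add: assoc_mult_mat[of _ a a _ a _ b] assoc_mult_mat[of _ a a _ b _ b])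
    finally have iQ: "transpose_mat (?i P) * (Q * transpose_mat h2) = ?i P * Q" using Qe by simp
    have "transpose_mat (?S P Q) = transpose_mat Q * (transpose_mat (?i P) * (Q * transpose_mat h2))"
      using h i Qc by (simp add: transpose_mult[of _ b a _ b] transpose_mult[of _ b a _ a] transpose_mult[of _ b b _ a]
          mult_carrier_mat[of _ b a] mult_carrier_mat[of _ b b])
    then show ?thesis unfolding iQ
      using h i Qc by (simp add: assoc_mult_mat[of _ b b _ a _ b] assoc_mult_mat[of _ b a _ a _ b] mult_carrier_mat[of _ b a]
          mult_carrier_mat[of _ b b] mult_carrier_mat[of _ a a])
  qed
  have Ssym_iff: "T + ?S P Q = h2 * transpose_mat (T + ?S P Q) \<longleftrightarrow> T = h2 * transpose_mat T"
    if P: "P \<in> forms h1" and Q: "Q \<in> ?Q" and T: "T \<in> carrier_mat b b" for P Q T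
  proof -
    have "h2 * transpose_mat (T + ?S P Q) = h2 * transpose_mat T + ?S P Q"
      using Ssym[OF P Q] Sc[OF P Q] T h
      by (simp add: transpose_add[of _ b b] mult_add_distrib_mat[of _ b b _ b])
    then show ?thesis using add_eq_add_mat_iff[OF T _ Sc[OF P Q], of "h2 * transpose_mat T"] T h by simp
  qed
  have "bij_betw ?F ?D {X \<in> forms (dsum h1 h2). pivot_block a X}"
    unfolding bij_betw_def
  proof
    show "inj_on ?F ?D"
    proof -
      have key: "P = P' \<and> Q = Q' \<and> T = T'"
      if a: "P \<in> forms h1" "Q \<in> carrier_mat a b" "Q = h1 * Q * transpose_mat h2" "T \<in> forms h2"
        "P' \<in> forms h1" "Q' \<in> carrier_mat a b" "Q' = h1 * Q' * transpose_mat h2" "T' \<in> forms h2"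
        "four_block_mat P Q (h2 * transpose_mat Q) (T + ?S P Q) =
         four_block_mat P' Q' (h2 * transpose_mat Q') (T' + ?S P' Q')"
      for P Q T P' Q' T'
    proof -
      note S = Sc[of P Q] Sc[of P' Q']
      have "P = P' \<and> Q = Q' \<and> T + ?S P Q = T' + ?S P' Q'"
        using a f1[OF a(1)] f1[OF a(5)] f2[OF a(4)] f2[OF a(8)] S h
        by (subst (asm) four_block_mat_inject[of _ a a _ b _ b]) auto
      then show ?thesis
        using add_eq_add_mat_iff[OF f2(1)[OF a(4)] f2(1)[OF a(8)] Sc[of P Q]] a by auto
    qed
    show ?thesis
    proof (rule inj_onI)
      fix x y assume xy: "x \<in> ?D" "y \<in> ?D" "?F x = ?F y"
      obtain P Q T where x: "x = (P, Q, T)" by (cases x)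
      obtain P' Q' T' where y: "y = (P', Q', T')" by (cases y)
      have "P = P' \<and> Q = Q' \<and> T = T'"
        by (rule key) (use xy[unfolded x y mem_Sigma_iff mem_Collect_eq prod.case] in blast)+
      then show "x = y" unfolding x y by simp
    qed
    qed
    show "?F ` ?D = {X \<in> forms (dsum h1 h2). pivot_block a X}"
    proof (intro equalityI subsetI)
      fix X assume "X \<in> ?F ` ?D"
      then obtain P Q T where m: "P \<in> forms h1" "Q \<in> ?Q" "T \<in> forms h2" "X = ?F (P, Q, T)" by auto
      note f = f1[OF m(1)] and g = f2[OF m(3)] and S = Sc[OF m(1,2)] and i = inv_GL[OF f1(4)[OF m(1)]]
      have c: "Q \<in> carrier_mat a b" "h2 * transpose_mat Q \<in> carrier_mat b a" "T + ?S P Q \<in> carrier_mat b b"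
        using m(2) S h g(1) by (simp_all del: index_mat_four_block)
      have Qe: "Q = h1 * Q * transpose_mat h2" using m(2) by blast
      have Qe': "h1 * transpose_mat (h2 * transpose_mat Q) = h1 * Q * transpose_mat h2"
        using h c by (simp add: transpose_mult[of _ b b _ a] assoc_mult_mat[of _ a a _ b _ b])
      have "X = dsum h1 h2 * transpose_mat X"
        unfolding m(4) prod.case eq_dsum_mult_transpose_iff[OF f(1) c h] Ssym_iff[OF m(1,2) g(1)]
        by (intro conjI f(3) g(3) refl trans[OF Qe Qe'[symmetric]])
      moreover have "det X = det P * det T"
        unfolding m(4) prod.case by (rule det_four_block_mat_schur[OF f(1) c(1,2) g(1) i(1,4)])
      moreover have "X \<in> carrier_mat (a + b) (a + b)"
        unfolding m(4) prod.case using f(1) c(3) by (rule four_block_carrier_mat)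
      moreover have "pivot_block a X"
        unfolding m(4) prod.case pivot_block_four_block_mat[OF f(1) c(3)] using f(2) .
      ultimately show "X \<in> {X \<in> forms (dsum h1 h2). pivot_block a X}"
        using f(2) g(2) by (simp add: forms_def d)
    next
      fix X assume "X \<in> {X \<in> forms (dsum h1 h2). pivot_block a X}"
      then have X: "X \<in> carrier_mat (a + b) (a + b)" "det X \<noteq> 0" "X = dsum h1 h2 * transpose_mat X" "pivot_block a X"
        by (auto simp: forms_def d)
      from four_block_matE[OF X(1)] obtain P Q R T where b: "P \<in> carrier_mat a a" "Q \<in> carrier_mat a b"
        "R \<in> carrier_mat b a" "T \<in> carrier_mat b b" "X = four_block_mat P Q R T" by blast
      have e: "P = h1 * transpose_mat P" "Q = h1 * transpose_mat R" "R = h2 * transpose_mat Q" "T = h2 * transpose_mat T"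
        using X(3) unfolding b(5) eq_dsum_mult_transpose_iff[OF b(1-4) h] by blast+
      have "det P \<noteq> 0" using X(4) unfolding b(5) pivot_block_four_block_mat[OF b(1,4)] .
      then have P: "P \<in> forms h1" using e(1) b(1) unfolding forms_def d by blast
      have "transpose_mat R = Q * transpose_mat h2"
        using b(2) h arg_cong[OF e(3), of transpose_mat] by (simp add: transpose_mult[of _ b b _ a])
      then have "h1 * transpose_mat R = h1 * Q * transpose_mat h2"
        using b(2) h by (simp add: assoc_mult_mat[of _ a a _ b _ b])
      then have Q: "Q \<in> ?Q" using e(2) b(2) unfolding mem_Collect_eq by metis
      let ?T = "T - ?S P Q"
      note S = Sc[OF P Q] and i = inv_GL[OF f1(4)[OF P]]
      have Tc: "?T \<in> carrier_mat b b" using minus_carrier_mat[OF S] .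
      have TT: "?T + ?S P Q = T" by (rule minus_add_cancel_mat_carrier[OF b(4) S])
      have XF: "X = ?F (P, Q, ?T)" unfolding prod.case TT unfolding b(5) e(3)[symmetric] ..
      have "det X = det P * det ?T"
        unfolding XF prod.case by (rule det_four_block_mat_schur[OF b(1,2) _ Tc i(1,4)]) (use b h in simp)
      moreover have "?T = h2 * transpose_mat ?T"
        using Ssym_iff[OF P Q Tc] e(4) unfolding TT by blast
      ultimately have "?T \<in> forms h2" using X(2) Tc unfolding forms_def d by fastforce
      then show "X \<in> ?F ` ?D" using XF P Q by blast
    qed
  qed
  from bij_betw_same_card[OF this] show ?thesis by (simp add: card_cartesian_product mult.assoc)
qed

text \<open>Unlike for forms, \<open>Q\<close> and \<open>R\<close> are independent intertwiners,
  which gives two factors. The correction \<open>R * P^-1 * Q\<close> commutes with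
  \<open>h2\<close>, since \<open>h2\<close> can be moved through it as \<open>h1\<close> on the
  inner side of \<open>Q\<close> and \<open>R\<close>.\<close>

lemma card_centralizer_schur:
  fixes h1 h2 :: "'a::{field,finite} mat"
  assumes h: "h1 \<in> carrier_mat a a" "h2 \<in> carrier_mat b b"
  shows "card {X \<in> centralizer (dsum h1 h2). pivot_block a X} =
    card (centralizer h1) * card {Q \<in> carrier_mat a b. Q * h2 = h1 * Q} *
    card {R \<in> carrier_mat b a. R * h1 = h2 * R} * card (centralizer h2)"
proof -
  let ?i = "\<lambda>P. inv\<^bsub>GL a\<^esub> P"
  let ?Q = "{Q \<in> carrier_mat a b. Q * h2 = h1 * Q}"
  let ?R = "{R \<in> carrier_mat b a. R * h1 = h2 * R}"
  let ?S = "\<lambda>P Q R. R * ?i P * Q"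
  let ?F = "\<lambda>(P, Q, R, T). four_block_mat P Q R (T + ?S P Q R)"
  let ?D = "centralizer h1 \<times> ?Q \<times> ?R \<times> centralizer h2"
  have d: "dim_row h1 = a" "dim_row h2 = b" "dim_col h1 = a" "dim_col h2 = b" using h by auto
  have f1: "P \<in> carrier_mat a a" "det P \<noteq> 0" "P * h1 = h1 * P" "P \<in> carrier (GL a)"
    if "P \<in> centralizer h1" for P using that by (auto simp: centralizer_def d carrier_GL)
  have f2: "T \<in> carrier_mat b b" "det T \<noteq> 0" "T * h2 = h2 * T"
    if "T \<in> centralizer h2" for T using that by (auto simp: centralizer_def d)
  have Sc: "?S P Q R \<in> carrier_mat b b" if "P \<in> centralizer h1" "Q \<in> ?Q" "R \<in> ?R" for P Q R
    using f1[OF that(1)] that h inv_GL[OF f1(4)[OF that(1)]] by auto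
  have Scomm: "?S P Q R * h2 = h2 * ?S P Q R" if P: "P \<in> centralizer h1" and Q: "Q \<in> ?Q" and R: "R \<in> ?R" for P Q R
  proof -
    note f = f1[OF P] and i = inv_GL[OF f1(4)[OF P]]
    have Qc: "Q \<in> carrier_mat a b" and Rc: "R \<in> carrier_mat b a" using Q R by auto
    have ih: "?i P * h1 = h1 * ?i P"
    proof -
      have "?i P * h1 = ?i P * (h1 * P) * ?i P"
        using h i f(1) by (simp add: assoc_mult_mat[of _ a a _ a _ a] mult_carrier_mat[of _ a a])
      also have "\<dots> = (?i P * P) * h1 * ?i P"
        unfolding f(3)[symmetric] using h i(1) f(1) by (simp add: assoc_mult_mat[of _ a a _ a _ a] mult_carrier_mat[of _ a a])
      also have "\<dots> = h1 * ?i P" using i h by simp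
      finally show ?thesis .
    qed
    have "?S P Q R * h2 = R * ?i P * (Q * h2)"
      using h i Qc Rc by (intro assoc_mult_mat[of _ b a _ b _ b]) auto
    also have "\<dots> = R * (?i P * h1) * Q"
      using h i Qc Rc Q by (simp add: assoc_mult_mat[of _ b a _ a _ b] assoc_mult_mat[of _ a a _ a _ b])
    also have "\<dots> = (R * h1) * ?i P * Q"
      unfolding ih using h i Rc by (simp add: assoc_mult_mat[of _ b a _ a _ a])
    also have "\<dots> = h2 * ?S P Q R"
      using h i Qc Rc R by (simp add: assoc_mult_mat[of _ b b _ a _ a] assoc_mult_mat[of _ b b _ a _ b] mult_carrier_mat[of _ b a])
    finally show ?thesis .
  qed
  have Scomm_iff: "(T + ?S P Q R) * h2 = h2 * (T + ?S P Q R) \<longleftrightarrow> T * h2 = h2 * T"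
    if P: "P \<in> centralizer h1" and Q: "Q \<in> ?Q" and R: "R \<in> ?R" and T: "T \<in> carrier_mat b b" for P Q R T
  proof -
    have "(T + ?S P Q R) * h2 = T * h2 + ?S P Q R * h2"
      using add_mult_distrib_mat[OF T Sc[OF P Q R] h(2)] .
    moreover have "h2 * (T + ?S P Q R) = h2 * T + ?S P Q R * h2"
      unfolding Scomm[OF P Q R] by (rule mult_add_distrib_mat[OF h(2) T Sc[OF P Q R]])
    ultimately show ?thesis
      using add_eq_add_mat_iff[of "T * h2" b b "h2 * T" "?S P Q R * h2"] T h Sc[OF P Q R] by simp
  qed
  have "bij_betw ?F ?D {X \<in> centralizer (dsum h1 h2). pivot_block a X}"
    unfolding bij_betw_def
  proof
    show "inj_on ?F ?D"
    proof -
      have key: "P = P' \<and> Q = Q' \<and> R = R' \<and> T = T'"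
      if a: "P \<in> centralizer h1" "Q \<in> carrier_mat a b" "Q * h2 = h1 * Q"
        "R \<in> carrier_mat b a" "R * h1 = h2 * R" "T \<in> centralizer h2"
        "P' \<in> centralizer h1" "Q' \<in> carrier_mat a b" "Q' * h2 = h1 * Q'"
        "R' \<in> carrier_mat b a" "R' * h1 = h2 * R'" "T' \<in> centralizer h2"
        "four_block_mat P Q R (T + ?S P Q R) = four_block_mat P' Q' R' (T' + ?S P' Q' R')"
      for P Q R T P' Q' R' T'
    proof -
      note S = Sc[of P Q R] Sc[of P' Q' R']
      have "P = P' \<and> Q = Q' \<and> R = R' \<and> T + ?S P Q R = T' + ?S P' Q' R'"
        using a f1[OF a(1)] f1[OF a(7)] f2[OF a(6)] f2[OF a(12)] S h
        by (subst (asm) four_block_mat_inject[of _ a a _ b _ b]) auto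
      then show ?thesis
        using add_eq_add_mat_iff[OF f2(1)[OF a(6)] f2(1)[OF a(12)] Sc[of P Q R]] a by auto
    qed
    show ?thesis
    proof (rule inj_onI)
      fix x y assume xy: "x \<in> ?D" "y \<in> ?D" "?F x = ?F y"
      obtain P Q R T where x: "x = (P, Q, R, T)" by (cases x)
      obtain P' Q' R' T' where y: "y = (P', Q', R', T')" by (cases y)
      have "P = P' \<and> Q = Q' \<and> R = R' \<and> T = T'"
        by (rule key) (use xy[unfolded x y mem_Sigma_iff mem_Collect_eq prod.case] in blast)+
      then show "x = y" unfolding x y by simp
    qed
    qed
    show "?F ` ?D = {X \<in> centralizer (dsum h1 h2). pivot_block a X}"
    proof (intro equalityI subsetI)
      fix X assume "X \<in> ?F ` ?D"
      then obtain P Q R T where m: "P \<in> centralizer h1" "Q \<in> ?Q" "R \<in> ?R" "T \<in> centralizer h2" "X = ?F (P, Q, R, T)" by auto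
      note f = f1[OF m(1)] and g = f2[OF m(4)] and S = Sc[OF m(1-3)] and i = inv_GL[OF f1(4)[OF m(1)]]
      have c: "Q \<in> carrier_mat a b" "R \<in> carrier_mat b a" "T + ?S P Q R \<in> carrier_mat b b"
        using m(2,3) S h g(1) by simp_all
      have "X * dsum h1 h2 = dsum h1 h2 * X"
        unfolding m(5) prod.case dsum_commute_iff[OF f(1) c h] Scomm_iff[OF m(1-3) g(1)]
        using m f g by auto
      moreover have "det X = det P * det T"
        unfolding m(5) prod.case by (rule det_four_block_mat_schur[OF f(1) c(1,2) g(1) i(1,4)])
      moreover have "X \<in> carrier_mat (a + b) (a + b)"
        unfolding m(5) prod.case using f(1) c(3) by (rule four_block_carrier_mat)
      moreover have "pivot_block a X"
        unfolding m(5) prod.case pivot_block_four_block_mat[OF f(1) c(3)] using f(2) .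
      ultimately show "X \<in> {X \<in> centralizer (dsum h1 h2). pivot_block a X}"
        using f g by (simp add: centralizer_def d)
    next
      fix X assume "X \<in> {X \<in> centralizer (dsum h1 h2). pivot_block a X}"
      then have X: "X \<in> carrier_mat (a + b) (a + b)" "det X \<noteq> 0" "X * dsum h1 h2 = dsum h1 h2 * X" "pivot_block a X"
        by (auto simp: centralizer_def d)
      from four_block_matE[OF X(1)] obtain P Q R T where b: "P \<in> carrier_mat a a" "Q \<in> carrier_mat a b"
        "R \<in> carrier_mat b a" "T \<in> carrier_mat b b" "X = four_block_mat P Q R T" by blast
      have e: "P * h1 = h1 * P" "Q * h2 = h1 * Q" "R * h1 = h2 * R" "T * h2 = h2 * T"
        using X(3) unfolding b(5) dsum_commute_iff[OF b(1-4) h] by auto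
      have P: "P \<in> centralizer h1" using X(4) e(1) b by (simp add: centralizer_def d pivot_block_four_block_mat[of P a T b])
      have Q: "Q \<in> ?Q" and R: "R \<in> ?R" using e b by auto
      let ?T = "T - ?S P Q R"
      note S = Sc[OF P Q R] and i = inv_GL[OF f1(4)[OF P]]
      have Tc: "?T \<in> carrier_mat b b" using minus_carrier_mat[OF S] .
      have TT: "?T + ?S P Q R = T" by (rule minus_add_cancel_mat_carrier[OF b(4) S])
      have XF: "X = ?F (P, Q, R, ?T)" unfolding prod.case TT b(5) ..
      have "det X = det P * det ?T"
        unfolding XF prod.case by (rule det_four_block_mat_schur[OF b(1-3) Tc i(1,4)])
      moreover have "?T * h2 = h2 * ?T"
        using Scomm_iff[OF P Q R Tc] e(4) unfolding TT by simp
      ultimately have "?T \<in> centralizer h2" using X(2) Tc by (simp add: centralizer_def d)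
      then show "X \<in> ?F ` ?D" using XF P Q R by blast
    qed
  qed
  from bij_betw_same_card[OF this] show ?thesis by (simp add: card_cartesian_product mult.assoc)
qed

section \<open>Intertwiners of a layered unipotent matrix\<close>

lemma pow_mat_Suc_left:
  fixes A :: "'a::field mat"
  assumes "A \<in> carrier_mat n n"
  shows "A ^\<^sub>m Suc k = A * A ^\<^sub>m k"
  by (induction k) (use assms in \<open>auto simp: assoc_mult_mat[of _ n n _ n _ n]\<close>)

lemma transpose_pow_mat:
  fixes A :: "'a::field mat"
  assumes A: "A \<in> carrier_mat n n"
  shows "transpose_mat (A ^\<^sub>m k) = transpose_mat A ^\<^sub>m k"
proof (induction k)
  case (Suc k)
  have "transpose_mat (A ^\<^sub>m Suc k) = transpose_mat A * transpose_mat (A ^\<^sub>m k)"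
    using A by (simp add: transpose_mult[of _ n n _ n])
  also have "\<dots> = transpose_mat A ^\<^sub>m Suc k"
    unfolding Suc by (rule pow_mat_Suc_left[symmetric, of _ n]) (use A in simp)
  finally show ?case .
qed (use A in simp)

text \<open>Since \<open>b - 1 = - b * (c - 1)\<close> with commuting factors, the powers of
  \<open>b - 1\<close> contain the powers of \<open>c - 1\<close> as factors.\<close>

lemma inverse_minus_one_pow:
  fixes c :: "'a::field mat"
  assumes c: "c \<in> carrier_mat n n" and b: "b \<in> carrier_mat n n"
    and cb: "c * b = 1\<^sub>m n" "b * c = 1\<^sub>m n"
    and nil: "(c - 1\<^sub>m n) ^\<^sub>m k = 0\<^sub>m n n"
  shows "(b - 1\<^sub>m n) ^\<^sub>m k = 0\<^sub>m n n"
proof -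
  let ?N = "c - 1\<^sub>m n" and ?D = "b - 1\<^sub>m n"
  have N: "?N \<in> carrier_mat n n" and D: "?D \<in> carrier_mat n n" using c b by (auto intro: minus_carrier_mat)
  have DN: "?D = (- b) * ?N" "?D = ?N * (- b)"
    using c b cb by (simp_all add: mult_minus_distrib_mat[of _ n n _ n] minus_mult_distrib_mat[of _ n n _ _ n])
      (intro eq_matI; simp)+
  interpret R: ring "ring_mat TYPE('a) n ()" by (rule ring_mat)
  have "(?N * (- b)) ^\<^sub>m k = ?N ^\<^sub>m k * (- b) ^\<^sub>m k"
    using R.pow_mult_distrib[of ?N "- b" k] N b DN pow_mat_ring_pow[of ?N n _ "()"] pow_mat_ring_pow[of "- b" n _ "()"]
      pow_mat_ring_pow[of "?N * (- b)" n _ "()"]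
    by (simp add: ring_mat_simps)
  then show ?thesis unfolding DN(2) using nil b by simp
qed

lemma carrier_mat_eq_iff:
  assumes "A \<in> carrier_mat r c" "B \<in> carrier_mat r c"
  shows "A = B \<longleftrightarrow> (\<forall>i<r. \<forall>j<c. A $$ (i, j) = B $$ (i, j))"
proof
  assume "\<forall>i<r. \<forall>j<c. A $$ (i, j) = B $$ (i, j)"
  then show "A = B" using assms by (intro eq_matI) auto
qed simp

text \<open>A unipotent matrix with \<open>m\<close> Jordan blocks of size \<open>k\<close>, in a basis ordered by layers: the
  \<open>c\<close>-th vectors of all the blocks come before the \<open>(c + 1)\<close>-st ones. In this basis the forms and the
  centralizer are described by \<open>m \<times> m\<close> blocks.\<close>

definition shift_mat :: "nat \<Rightarrow> nat \<Rightarrow> 'a::field mat" where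
  "shift_mat k m = mat (k * m) (k * m) (\<lambda>(i, j). if i = j \<or> j = i + m then 1 else 0)"

lemma shift_mat_carrier [simp]: "shift_mat k m \<in> carrier_mat (k * m) (k * m)"
  by (simp add: shift_mat_def)

lemma shift_mat_dim [simp]: "dim_row (shift_mat k m) = k * m" "dim_col (shift_mat k m) = k * m"
  by (simp_all add: shift_mat_def)

lemma det_shift_mat: "det (shift_mat k m :: 'a::field mat) \<noteq> 0"
proof -
  have "upper_triangular (shift_mat k m :: 'a mat)" by (auto simp: shift_mat_def)
  then have "det (shift_mat k m :: 'a mat) = prod_list (diag_mat (shift_mat k m))"
    by (intro det_upper_triangular[of _ "k * m"]) auto
  then show ?thesis by (auto simp: prod_list_zero_iff diag_mat_def shift_mat_def)
qed

lemma shift_mat_mult_index: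
  fixes X :: "'a::field mat"
  assumes X: "X \<in> carrier_mat (k * m) c" and i: "i < k * m" and j: "j < c"
  shows "(shift_mat k m * X) $$ (i, j) = X $$ (i, j) + (if i + m < k * m then X $$ (i + m, j) else 0)"
proof -
  \<comment> \<open>With \<open>m = 0\<close> the positions \<open>i\<close> and
    \<open>i + m\<close> would coincide and the entry 1 would be counted twice below.\<close>
  have m: "m \<noteq> 0" using i by (cases m) auto
  have "(shift_mat k m * X) $$ (i, j) =
    (\<Sum>l<k * m. (if i = l \<or> l = i + m then 1 else 0) * X $$ (l, j))"
    using assms by (auto simp: shift_mat_def scalar_prod_def lessThan_atLeast0 intro!: sum.cong)
  also have "\<dots> = (\<Sum>l<k * m. (if l = i then X $$ (i, j) else 0) + (if l = i + m then X $$ (i + m, j) else 0))"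
    using m by (intro sum.cong) auto
  also have "\<dots> = X $$ (i, j) + (if i + m < k * m then X $$ (i + m, j) else 0)"
    using i by (simp add: sum.distrib)
  finally show ?thesis .
qed

lemma mult_shift_mat_index:
  fixes Y :: "'a::field mat"
  assumes Y: "Y \<in> carrier_mat r (k * m)" and i: "i < r" and j: "j < k * m"
  shows "(Y * shift_mat k m) $$ (i, j) = Y $$ (i, j) + (if m \<le> j then Y $$ (i, j - m) else 0)"
proof -
  have m: "m \<noteq> 0" using j by (cases m) auto
  have "(Y * shift_mat k m) $$ (i, j) =
    (\<Sum>l<k * m. Y $$ (i, l) * (if l = j \<or> j = l + m then 1 else 0))"
    using assms by (auto simp: shift_mat_def scalar_prod_def lessThan_atLeast0 intro!: sum.cong)
  also have "\<dots> = (\<Sum>l<k * m. (if l = j then Y $$ (i, j) else 0) +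
      (if l = j - m then (if m \<le> j then Y $$ (i, j - m) else 0) else 0))"
    using m by (intro sum.cong) auto
  also have "\<dots> = Y $$ (i, j) + (if m \<le> j then Y $$ (i, j - m) else 0)"
    using j by (auto simp: sum.distrib)
  finally show ?thesis .
qed

text \<open>After subtracting \<open>Q\<close> from both sides, the left side is \<open>Q\<close>
  moved up by one layer. So each layer times \<open>B - 1\<close> is the next layer, and the last
  layer times \<open>B - 1\<close> is 0.\<close>

lemma shift_mat_mult_eq_iff:
  fixes Q :: "'a::field mat"
  assumes Q: "Q \<in> carrier_mat (k * m) b" and B: "B \<in> carrier_mat b b"
  shows "shift_mat k m * Q = Q * B \<longleftrightarrow>
    (\<forall>i<k * m. \<forall>j<b. (Q * (B - 1\<^sub>m b)) $$ (i, j) = (if i + m < k * m then Q $$ (i + m, j) else 0))"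
    (is "?l \<longleftrightarrow> ?r")
proof -
  have e: "(Q * (B - 1\<^sub>m b)) $$ (i, j) = (Q * B) $$ (i, j) - Q $$ (i, j)" if "i < k * m" "j < b" for i j
    using that Q B by (simp add: mult_minus_distrib_mat[of _ "k * m" b _ b])
  have "?l \<longleftrightarrow> (\<forall>i<k * m. \<forall>j<b. (shift_mat k m * Q) $$ (i, j) = (Q * B) $$ (i, j))"
    using Q B by (intro carrier_mat_eq_iff) auto
  also have "\<dots> \<longleftrightarrow> ?r"
  proof (intro all_cong)
    fix i j assume ij: "i < k * m" "j < b"
    show "((shift_mat k m * Q) $$ (i, j) = (Q * B) $$ (i, j)) \<longleftrightarrow>
      ((Q * (B - 1\<^sub>m b)) $$ (i, j) = (if i + m < k * m then Q $$ (i + m, j) else 0))"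
      unfolding e[OF ij] shift_mat_mult_index[OF Q ij] by (auto simp: algebra_simps)
  qed
  finally show ?thesis .
qed

text \<open>Iterating the previous relation expresses layer \<open>t\<close> as the first layer
  times \<open>(B - 1)^t\<close>; an intertwiner is determined by its first layer.\<close>

lemma shift_intertwiner_index:
  fixes Q :: "'a::field mat"
  assumes Q: "Q \<in> carrier_mat (k * m) b" and B: "B \<in> carrier_mat b b"
    and HQ: "shift_mat k m * Q = Q * B"
    and t: "t < k" "i < m" "j < b"
  shows "Q $$ (t * m + i, j) = (mat m b (\<lambda>(i, j). Q $$ (i, j)) * (B - 1\<^sub>m b) ^\<^sub>m t) $$ (i, j)"
  using t
proof (induction t arbitrary: j)
  case 0
  then show ?case using B by (simp add: right_mult_one_mat[of _ m b])
next
  case (Suc t)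
  let ?W = "mat m b (\<lambda>(i, j). Q $$ (i, j))" and ?D = "B - 1\<^sub>m b"
  have D: "?D \<in> carrier_mat b b" using B by (auto intro: minus_carrier_mat)
  have le: "Suc (Suc t) * m \<le> k * m" using Suc.prems by (intro mult_right_mono) auto
  have ti: "t * m + i < k * m" "t * m + i + m < k * m" using Suc.prems le by simp_all
  have "Q $$ (Suc t * m + i, j) = (Q * ?D) $$ (t * m + i, j)"
    using HQ[unfolded shift_mat_mult_eq_iff[OF Q B]] ti Suc.prems by (simp add: algebra_simps)
  also have "\<dots> = (\<Sum>l<b. Q $$ (t * m + i, l) * ?D $$ (l, j))"
    using Q D ti Suc.prems by (simp add: scalar_prod_def lessThan_atLeast0)
  also have "\<dots> = (\<Sum>l<b. (?W * ?D ^\<^sub>m t) $$ (i, l) * ?D $$ (l, j))"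
    using Suc by (intro sum.cong) auto
  also have "\<dots> = (?W * ?D ^\<^sub>m t * ?D) $$ (i, j)"
    using D Suc.prems by (simp add: scalar_prod_def lessThan_atLeast0)
  also have "?W * ?D ^\<^sub>m t * ?D = ?W * ?D ^\<^sub>m Suc t"
    using D by (simp add: assoc_mult_mat[of _ m b _ b _ b])
  finally show ?case .
qed

text \<open>The last layer is the first one times \<open>(B - 1)^(k - 1)\<close>. This is the place
  where the other parts have to be smaller than \<open>k\<close>.\<close>

lemma shift_intertwiner_last_rows:
  fixes Q :: "'a::field mat"
  assumes Q: "Q \<in> carrier_mat (k * m) b" and B: "B \<in> carrier_mat b b"
    and HQ: "shift_mat k m * Q = Q * B"
    and nil: "(B - 1\<^sub>m b) ^\<^sub>m (k - 1) = 0\<^sub>m b b"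
    and i: "k * m - m \<le> i" "i < k * m" and j: "j < b"
  shows "Q $$ (i, j) = 0"
proof -
  have k: "0 < k" using i by (cases k) auto
  then have km: "k * m - m = (k - 1) * m" by (cases k) auto
  have "i = (k - 1) * m + (i - (k * m - m))" "i - (k * m - m) < m" using i km by auto
  then show ?thesis
    using shift_intertwiner_index[OF Q B HQ, of "k - 1" "i - (k * m - m)" j] j k nil
    by (simp add: right_mult_zero_mat[of _ m b])
qed

text \<open>The first layer can be prescribed freely: the one condition left, that the last layer
  times \<open>B - 1\<close> vanishes, follows from \<open>(B - 1)^k = 0\<close>.\<close>

lemma card_shift_intertwiners:
  fixes B :: "'a::{field,finite} mat"
  assumes B: "B \<in> carrier_mat b b" and nil: "(B - 1\<^sub>m b) ^\<^sub>m k = 0\<^sub>m b b" and k: "0 < k"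
  shows "card {Q \<in> carrier_mat (k * m) b. shift_mat k m * Q = Q * B} = CARD('a) ^ (m * b)"
proof (cases "m = 0")
  case True
  have "{Q \<in> carrier_mat 0 b. (shift_mat k 0 :: 'a mat) * Q = Q * B} = carrier_mat 0 b"
    using B by (auto intro!: eq_matI)
  then show ?thesis using True by (simp add: card_carrier_mat)
next
  case False
  let ?D = "B - 1\<^sub>m b"
  let ?S = "{Q \<in> carrier_mat (k * m) b. shift_mat k m * Q = Q * B}"
  let ?f = "\<lambda>W. mat (k * m) b (\<lambda>(i, j). (W * ?D ^\<^sub>m (i div m)) $$ (i mod m, j))"
  let ?g = "\<lambda>Q. mat m b (\<lambda>(i, j). Q $$ (i, j))"
  have D: "?D \<in> carrier_mat b b" using B by (auto intro: minus_carrier_mat)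
  have km: "i < k * m" if "i < m" for i using that k by (cases k) auto
  have "bij_betw ?f (carrier_mat m b) ?S"
  proof (rule bij_betw_byWitness[where f' = ?g])
    show "\<forall>W\<in>carrier_mat m b. ?g (?f W) = W"
      using B km by (auto intro!: eq_matI simp: right_mult_one_mat[of _ m b])
    show "\<forall>Q\<in>?S. ?f (?g Q) = Q"
    proof
      fix Q assume "Q \<in> ?S"
      then have Q: "Q \<in> carrier_mat (k * m) b" "shift_mat k m * Q = Q * B" by auto
      show "?f (?g Q) = Q"
      proof (rule eq_matI)
        fix i j assume "i < dim_row Q" "j < dim_col Q"
        then have ij: "i < k * m" "j < b" using Q by auto
        then have "i div m < k" "i mod m < m" using False by (auto simp: less_mult_imp_div_less)
        from shift_intertwiner_index[OF Q(1) B Q(2) this ij(2)] ij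
        show "?f (?g Q) $$ (i, j) = Q $$ (i, j)" by simp
      qed (use Q in auto)
    qed
    show "?f ` carrier_mat m b \<subseteq> ?S"
    proof (intro image_subsetI)
      fix W :: "'a mat" assume W: "W \<in> carrier_mat m b"
      have fW: "?f W \<in> carrier_mat (k * m) b" by simp
      have "(?f W * ?D) $$ (i, j) = (if i + m < k * m then ?f W $$ (i + m, j) else 0)"
        if ij: "i < k * m" "j < b" for i j
      proof -
        let ?t = "i div m" and ?r = "i mod m"
        have tr: "?t < k" "?r < m" using ij False by (auto simp: less_mult_imp_div_less)
        have "(?f W * ?D) $$ (i, j) = (\<Sum>l<b. ?f W $$ (i, l) * ?D $$ (l, j))"
          using ij D by (simp add: scalar_prod_def lessThan_atLeast0)
        also have "\<dots> = (\<Sum>l<b. (W * ?D ^\<^sub>m ?t) $$ (?r, l) * ?D $$ (l, j))"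
          using ij by (intro sum.cong) auto
        also have "\<dots> = (W * ?D ^\<^sub>m ?t * ?D) $$ (?r, j)"
          using ij D W tr by (simp add: scalar_prod_def lessThan_atLeast0)
        also have "W * ?D ^\<^sub>m ?t * ?D = W * ?D ^\<^sub>m Suc ?t"
          using D W by (simp add: assoc_mult_mat[of _ m b _ b _ b])
        also have "(W * ?D ^\<^sub>m Suc ?t) $$ (?r, j) = (if i + m < k * m then ?f W $$ (i + m, j) else 0)"
        proof (cases "i + m < k * m")
          case True
          then show ?thesis using ij False by simp
        next
          case ge: False
          \<comment> \<open>Row \<open>i\<close> lies in the last layer, so
            \<open>Suc ?t = k\<close> and nilpotency gives the required zero.\<close>
          have "i < m + ?t * m" using tr(2) div_mult_mod_eq[of i m] by linarith
          then have "k * m < (?t + 2) * m" using ge by simp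
          then have "Suc ?t = k" using tr(1) mult_less_cancel2[of k m "?t + 2"] by linarith
          then show ?thesis using ge nil W tr ij by (simp add: right_mult_zero_mat[of _ m b] del: pow_mat.simps)
        qed
        finally show ?thesis .
      qed
      then show "?f W \<in> ?S" using shift_mat_mult_eq_iff[OF fW B] fW by blast
    qed
  qed auto
  from bij_betw_same_card[OF this] show ?thesis by (simp add: card_carrier_mat)
qed

text \<open>Transposition exchanges the sides but makes the shift run backwards; reversing the order
  of the \<open>k * m\<close> indices repairs this. Hence \<open>?rev\<close>, which transposes and
  reverses at once.\<close>

lemma card_shift_intertwiners_right:
  fixes B :: "'a::{field,finite} mat"
  assumes B: "B \<in> carrier_mat b b" and nil: "(B - 1\<^sub>m b) ^\<^sub>m k = 0\<^sub>m b b" and k: "0 < k"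
  shows "card {R \<in> carrier_mat b (k * m). R * shift_mat k m = B * R} = CARD('a) ^ (m * b)"
proof -
  let ?n = "k * m"
  let ?H = "shift_mat k m :: 'a mat"
  let ?rev = "\<lambda>R. mat ?n b (\<lambda>(i, j). R $$ (j, ?n - Suc i)) :: 'a mat"
  let ?rev' = "\<lambda>R. mat b ?n (\<lambda>(i, j). R $$ (?n - Suc j, i)) :: 'a mat"
  have BT: "transpose_mat B \<in> carrier_mat b b" using B by simp
  have "(transpose_mat B - 1\<^sub>m b) ^\<^sub>m k = transpose_mat ((B - 1\<^sub>m b) ^\<^sub>m k)"
    using B by (subst transpose_pow_mat[of _ b]) (auto intro: minus_carrier_mat simp: transpose_minus[of _ b b])
  then have nilT: "(transpose_mat B - 1\<^sub>m b) ^\<^sub>m k = 0\<^sub>m b b" using nil by simp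
  have iff: "?H * ?rev R = ?rev R * transpose_mat B \<longleftrightarrow> R * ?H = B * R" if R: "R \<in> carrier_mat b ?n" for R
  proof -
    have c: "?rev R \<in> carrier_mat ?n b" by simp
    have 1: "(?H * ?rev R) $$ (i, j) = (R * ?H) $$ (j, ?n - Suc i)" if ij: "i < ?n" "j < b" for i j
      unfolding shift_mat_mult_index[OF c ij] using ij
      by (subst mult_shift_mat_index[OF R]) (auto intro!: arg_cong[of _ _ "\<lambda>l. R $$ (j, l)"])
    have 2: "(?rev R * transpose_mat B) $$ (i, j) = (B * R) $$ (j, ?n - Suc i)" if ij: "i < ?n" "j < b" for i j
      using ij R B by (auto simp: scalar_prod_def lessThan_atLeast0 mult.commute intro!: sum.cong)
    have "?H * ?rev R = ?rev R * transpose_mat B \<longleftrightarrow>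
      (\<forall>i<?n. \<forall>j<b. (?H * ?rev R) $$ (i, j) = (?rev R * transpose_mat B) $$ (i, j))"
      using B by (intro carrier_mat_eq_iff) auto
    also have "\<dots> \<longleftrightarrow> (\<forall>i<?n. \<forall>j<b. (R * ?H) $$ (j, ?n - Suc i) = (B * R) $$ (j, ?n - Suc i))"
      by (simp add: 1 2 del: index_mult_mat)
    also have "\<dots> \<longleftrightarrow> (\<forall>i<?n. \<forall>j<b. (R * ?H) $$ (j, i) = (B * R) $$ (j, i))"
      (is "(\<forall>i<?n. ?P (?n - Suc i)) \<longleftrightarrow> (\<forall>i<?n. ?P i)")
    proof
      assume a: "\<forall>i<?n. ?P (?n - Suc i)"
      show "\<forall>i<?n. ?P i"
      proof (intro allI impI)
        fix i j assume "i < ?n" "j < b"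
        then show "(R * ?H) $$ (j, i) = (B * R) $$ (j, i)"
          using a[rule_format, of "?n - Suc i" j] by (simp add: Suc_diff_Suc del: index_mult_mat)
      qed
    qed auto
    also have "\<dots> \<longleftrightarrow> R * ?H = B * R"
      using B R by (subst carrier_mat_eq_iff[of _ b ?n]) (auto simp del: index_mult_mat(1))
    finally show ?thesis .
  qed
  have "bij_betw ?rev {R \<in> carrier_mat b ?n. R * ?H = B * R}
      {Q \<in> carrier_mat ?n b. ?H * Q = Q * transpose_mat B}"
  proof (rule bij_betw_byWitness[where f' = ?rev'])
    show "\<forall>R\<in>{R \<in> carrier_mat b ?n. R * ?H = B * R}. ?rev' (?rev R) = R"
      by (auto intro!: eq_matI simp: Suc_diff_Suc)
    have inv: "?rev (?rev' Q) = Q" if "Q \<in> carrier_mat ?n b" for Q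
      using that by (auto intro!: eq_matI simp: Suc_diff_Suc)
    then show "\<forall>Q\<in>{Q \<in> carrier_mat ?n b. ?H * Q = Q * transpose_mat B}. ?rev (?rev' Q) = Q" by blast
    show "?rev ` {R \<in> carrier_mat b ?n. R * ?H = B * R} \<subseteq> {Q \<in> carrier_mat ?n b. ?H * Q = Q * transpose_mat B}"
      using iff by auto
    show "?rev' ` {Q \<in> carrier_mat ?n b. ?H * Q = Q * transpose_mat B} \<subseteq> {R \<in> carrier_mat b ?n. R * ?H = B * R}"
    proof (intro image_subsetI)
      fix Q assume Q: "Q \<in> {Q \<in> carrier_mat ?n b. ?H * Q = Q * transpose_mat B}"
      have c: "?rev' Q \<in> carrier_mat b ?n" by simp
      show "?rev' Q \<in> {R \<in> carrier_mat b ?n. R * ?H = B * R}"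
        using iff[OF c] inv[of Q] Q c by auto
    qed
  qed
  from bij_betw_same_card[OF this] show ?thesis
    using card_shift_intertwiners[OF BT nilT k, of m] by simp
qed

section \<open>Splitting off the largest parts\<close>

text \<open>Vectors are functions on all natural numbers here: shifting them by a layer, restricting
  them and extending them by 0 then involves no change of dimension.\<close>

definition left_null :: "'a::field mat \<Rightarrow> (nat \<Rightarrow> 'a) \<Rightarrow> bool" where
  "left_null X v \<longleftrightarrow> (\<forall>j<dim_col X. (\<Sum>i<dim_row X. X $$ (i, j) * v i) = 0)"

lemma det_eq_0_iff_left_null:
  fixes X :: "'a::field mat"
  assumes X: "X \<in> carrier_mat n n"
  shows "det X = 0 \<longleftrightarrow> (\<exists>v. left_null X v \<and> (\<exists>i<n. v i \<noteq> 0))"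
proof -
  have XT: "transpose_mat X \<in> carrier_mat n n" using X by simp
  have null: "transpose_mat X *\<^sub>v v = 0\<^sub>v n \<longleftrightarrow> left_null X (\<lambda>i. v $ i)" if v: "v \<in> carrier_vec n" for v
  proof -
    have "transpose_mat X *\<^sub>v v = 0\<^sub>v n \<longleftrightarrow> (\<forall>j<n. (transpose_mat X *\<^sub>v v) $ j = 0)"
      using XT by (auto intro!: eq_vecI simp del: index_mult_mat_vec)
    also have "\<dots> \<longleftrightarrow> left_null X (\<lambda>i. v $ i)"
      using X v by (auto simp: left_null_def scalar_prod_def lessThan_atLeast0)
    finally show ?thesis .
  qed
  have "det X = 0 \<longleftrightarrow> (\<exists>v \<in> carrier_vec n. v \<noteq> 0\<^sub>v n \<and> left_null X (\<lambda>i. v $ i))"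
    using det_0_iff_vec_prod_zero_field[OF XT] det_transpose[OF X] null by metis
  also have "\<dots> \<longleftrightarrow> (\<exists>v. left_null X v \<and> (\<exists>i<n. v i \<noteq> 0))"
  proof
    assume "\<exists>v \<in> carrier_vec n. v \<noteq> 0\<^sub>v n \<and> left_null X (\<lambda>i. v $ i)"
    then obtain v where v: "v \<in> carrier_vec n" "v \<noteq> 0\<^sub>v n" "left_null X (\<lambda>i. v $ i)" by blast
    have "\<exists>i<n. v $ i \<noteq> 0"
    proof (rule ccontr)
      assume "\<not> (\<exists>i<n. v $ i \<noteq> 0)"
      then have "v = 0\<^sub>v n" using v by (intro eq_vecI) auto
      then show False using v by simp
    qed
    then show "\<exists>v. left_null X v \<and> (\<exists>i<n. v i \<noteq> 0)" using v by blast
  next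
    assume "\<exists>v. left_null X v \<and> (\<exists>i<n. v i \<noteq> 0)"
    then obtain v i where v: "left_null X v" "i < n" "v i \<noteq> 0" by blast
    have "vec n v \<noteq> 0\<^sub>v n"
    proof
      assume "vec n v = 0\<^sub>v n"
      then have "vec n v $ i = 0\<^sub>v n $ i" by (rule arg_cong)
      then show False using v by simp
    qed
    moreover have "left_null X (\<lambda>i. vec n v $ i)" using v X by (auto simp: left_null_def)
    ultimately show "\<exists>v \<in> carrier_vec n. v \<noteq> 0\<^sub>v n \<and> left_null X (\<lambda>i. v $ i)" by auto
  qed
  finally show ?thesis .
qed

text \<open>The transpose of \<open>shift_mat k m - 1\<close> preserves the left null space of \<open>X\<close>; iterating this
  nilpotent map pushes a null vector into the last \<open>m\<close> coordinates.\<close>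

lemma shift_left_null:
  fixes X :: "'a::field mat"
  assumes X: "X \<in> carrier_mat (k * m) c" and B: "B \<in> carrier_mat c c"
    and HX: "shift_mat k m * X = X * B"
    and v: "left_null X v" "\<exists>i<k * m. v i \<noteq> 0"
  shows "\<exists>w. left_null X w \<and> (\<exists>i<k * m. w i \<noteq> 0) \<and> (\<forall>i<k * m - m. w i = 0)"
proof -
  have k: "0 < k" using v by (cases k) auto
  have "\<exists>w. left_null X w \<and> (\<exists>i<k * m. w i \<noteq> 0) \<and> (\<forall>i<t * m. w i = 0)" if "t < k" for t
    using that
  proof (induction t)
    case 0
    then show ?case using v by auto
  next
    case (Suc t)
    then obtain w where w: "left_null X w" "\<exists>i<k * m. w i \<noteq> 0" "\<forall>i<t * m. w i = 0" by auto
    show ?case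
    proof (cases "\<forall>i<Suc t * m. w i = 0")
      case True
      then show ?thesis using w by blast
    next
      case False
      then obtain l where l: "l < Suc t * m" "w l \<noteq> 0" by blast
      have le: "Suc (Suc t) * m \<le> k * m" using Suc.prems by (intro mult_right_mono) auto
      \<comment> \<open>If \<open>w\<close> is nonzero somewhere in layer \<open>t\<close>, it is
        moved down by one layer. The nonzero entry survives since layer \<open>t\<close> is not the
        last one. The result is still a null vector because \<open>X $$ (i + m, j)\<close> is the
        entry of \<open>X * B - X\<close> at \<open>(i, j)\<close>, and \<open>w\<close> annihilates
        both \<open>X * B\<close> and \<open>X\<close>.\<close>
      define u where "u i = (if m \<le> i then w (i - m) else 0)" for i
      have "left_null X u"
        unfolding left_null_def
      proof (intro allI impI)
        fix j assume "j < dim_col X"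
        then have j: "j < c" using X by simp
        have null: "(\<Sum>i<k * m. X $$ (i, l) * w i) = 0" if "l < c" for l
          using w(1) X that by (simp add: left_null_def)
        have "(\<Sum>i<k * m. X $$ (i, j) * u i) = (\<Sum>i\<in>{m..<k * m}. X $$ (i, j) * w (i - m))"
          by (rule sum.mono_neutral_cong_right) (auto simp: u_def)
        also have "\<dots> = (\<Sum>i<k * m - m. X $$ (i + m, j) * w i)"
          using sum.shift_bounds_nat_ivl[of "\<lambda>i. X $$ (i, j) * w (i - m)" 0 m "k * m - m"] le
          by (simp add: lessThan_atLeast0 le_add_diff_inverse2[OF add_leD1])
        also have "\<dots> = (\<Sum>i<k * m. (if i + m < k * m then X $$ (i + m, j) else 0) * w i)"
          by (rule sum.mono_neutral_cong_left) auto
        also have "\<dots> = (\<Sum>i<k * m. ((X * B) $$ (i, j) - X $$ (i, j)) * w i)"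
        proof (intro sum.cong refl)
          fix i assume "i \<in> {..<k * m}"
          then show "(if i + m < k * m then X $$ (i + m, j) else 0) * w i =
            ((X * B) $$ (i, j) - X $$ (i, j)) * w i"
            unfolding HX[symmetric] using shift_mat_mult_index[OF X _ j, of i] by simp
        qed
        also have "\<dots> = (\<Sum>i<k * m. (X * B) $$ (i, j) * w i) - (\<Sum>i<k * m. X $$ (i, j) * w i)"
          by (simp add: algebra_simps sum_subtractf del: index_mult_mat)
        also have "(\<Sum>i<k * m. (X * B) $$ (i, j) * w i) = (\<Sum>i<k * m. \<Sum>l<c. X $$ (i, l) * B $$ (l, j) * w i)"
          using X B j by (intro sum.cong) (auto simp: scalar_prod_def lessThan_atLeast0 sum_distrib_right)
        also have "\<dots> = (\<Sum>l<c. B $$ (l, j) * (\<Sum>i<k * m. X $$ (i, l) * w i))"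
          by (subst sum.swap) (simp add: sum_distrib_left mult.commute mult.left_commute)
        also have "\<dots> = 0" using null by simp
        finally show "(\<Sum>i<dim_row X. X $$ (i, j) * u i) = 0" using null[OF j] X by simp
      qed
      moreover have "l + m < k * m" using l le by simp
      then have "\<exists>i<k * m. u i \<noteq> 0" using l by (intro exI[of _ "l + m"]) (simp add: u_def)
      moreover have "\<forall>i<Suc t * m. u i = 0" using w(3) by (auto simp: u_def)
      ultimately show ?thesis by blast
    qed
  qed
  from this[of "k - 1"] k show ?thesis by (simp add: diff_mult_distrib)
qed

text \<open>A null vector of \<open>P\<close> supported on the last layer meets only zeros of
  \<open>Q\<close>, so extended by 0 it is a null vector of the whole matrix. \<open>B\<close> is
  left open: for the centralizer it is the shift matrix itself, for forms the inverse of its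
  transpose.\<close>

lemma shift_pivot_det_nonzero:
  fixes P :: "'a::field mat"
  assumes b: "P \<in> carrier_mat (k * m) (k * m)" "Q \<in> carrier_mat (k * m) b" "R \<in> carrier_mat b (k * m)"
      "T \<in> carrier_mat b b"
    and det: "det (four_block_mat P Q R T) \<noteq> 0"
    and B: "B \<in> carrier_mat (k * m) (k * m)" and HP: "shift_mat k m * P = P * B"
    and Q0: "\<And>i j. k * m - m \<le> i \<Longrightarrow> i < k * m \<Longrightarrow> j < b \<Longrightarrow> Q $$ (i, j) = 0"
  shows "det P \<noteq> 0"
proof
  let ?n = "k * m"
  let ?X = "four_block_mat P Q R T"
  assume "det P = 0"
  then obtain v where "left_null P v" "\<exists>i<?n. v i \<noteq> 0" using det_eq_0_iff_left_null[OF b(1)] by auto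
  from shift_left_null[OF b(1) B HP this] obtain w where
    w: "left_null P w" "\<exists>i<?n. w i \<noteq> 0" "\<forall>i<?n - m. w i = 0" by blast
  define u where "u i = (if i < ?n then w i else 0)" for i
  have "left_null ?X u"
    unfolding left_null_def
  proof (intro allI impI)
    fix j assume "j < dim_col ?X"
    then have j: "j < ?n + b" using b by auto
    have "(\<Sum>i<dim_row ?X. ?X $$ (i, j) * u i) = (\<Sum>i<?n. (if j < ?n then P $$ (i, j) else Q $$ (i, j - ?n)) * w i)"
      using b j by (intro sum.mono_neutral_cong_right) (auto simp: u_def)
    also have "\<dots> = 0"
    proof (cases "j < ?n")
      case True
      then show ?thesis using w(1) b(1) by (simp add: left_null_def)
    next
      case False
      have "Q $$ (i, j - ?n) * w i = 0" if "i < ?n" for i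
        using w(3) Q0[of i "j - ?n"] that j False by (cases "i < ?n - m") auto
      then show ?thesis using False by (simp add: sum.neutral del: mult_eq_0_iff)
    qed
    finally show "(\<Sum>i<dim_row ?X. ?X $$ (i, j) * u i) = 0" .
  qed
  moreover have "\<exists>i<?n + b. u i \<noteq> 0" using w(2) by (auto simp: u_def)
  ultimately have "det ?X = 0" using det_eq_0_iff_left_null[of ?X "?n + b"] b by auto
  then show False using det by simp
qed

text \<open>A singular \<open>X\<close> has a null vector supported on the last layer of rows, and
  these rows are zero outside the \<open>m\<close> columns from \<open>p\<close> on. So one block
  decides: the bottom left one for forms (\<open>p = 0\<close>), the last diagonal one for the
  centralizer.\<close>

lemma shift_corner_det:
  fixes X :: "'a::field mat"
  assumes X: "X \<in> carrier_mat (k * m) (k * m)" and B: "B \<in> carrier_mat (k * m) (k * m)"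
    and HX: "shift_mat k m * X = X * B" and k: "0 < k" and off: "p + m \<le> k * m"
    and X0: "\<And>i j. k * m - m \<le> i \<Longrightarrow> i < k * m \<Longrightarrow> j < k * m \<Longrightarrow> j < p \<or> p + m \<le> j \<Longrightarrow> X $$ (i, j) = 0"
  shows "det X = 0 \<longleftrightarrow> det (mat m m (\<lambda>(i, j). X $$ (k * m - m + i, p + j))) = 0"
proof -
  let ?n = "k * m"
  let ?Z = "mat m m (\<lambda>(i, j). X $$ (?n - m + i, p + j))"
  have mn: "m \<le> ?n" using k by (cases k) auto
  have restrict: "left_null X w \<longleftrightarrow> left_null ?Z (\<lambda>i. w (?n - m + i))" if w: "\<forall>i<?n - m. w i = 0" for w
  proof -
    have s: "(\<Sum>i<?n. X $$ (i, j) * w i) = (\<Sum>i<m. X $$ (?n - m + i, j) * w (?n - m + i))" for j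
    proof -
      have "(\<Sum>i<?n. X $$ (i, j) * w i) = (\<Sum>i\<in>{?n - m..<?n}. X $$ (i, j) * w i)"
        using w by (intro sum.mono_neutral_right) auto
      also have "\<dots> = (\<Sum>i<m. X $$ (?n - m + i, j) * w (?n - m + i))"
        using sum.shift_bounds_nat_ivl[of "\<lambda>i. X $$ (i, j) * w i" 0 "?n - m" m] mn
        by (simp add: lessThan_atLeast0 add.commute)
      finally show ?thesis .
    qed
    have z: "(\<Sum>i<m. X $$ (?n - m + i, j) * w (?n - m + i)) = 0" if "j < ?n" "j < p \<or> p + m \<le> j" for j
      using X0 that mn by (intro sum.neutral) auto
    have "left_null X w \<longleftrightarrow> (\<forall>j<?n. (\<Sum>i<m. X $$ (?n - m + i, j) * w (?n - m + i)) = 0)"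
      using X s by (simp add: left_null_def)
    also have "\<dots> \<longleftrightarrow> (\<forall>j<m. (\<Sum>i<m. X $$ (?n - m + i, p + j) * w (?n - m + i)) = 0)"
    proof
      assume r: "\<forall>j<m. (\<Sum>i<m. X $$ (?n - m + i, p + j) * w (?n - m + i)) = 0"
      show "\<forall>j<?n. (\<Sum>i<m. X $$ (?n - m + i, j) * w (?n - m + i)) = 0"
      proof (intro allI impI)
        fix j assume j: "j < ?n"
        show "(\<Sum>i<m. X $$ (?n - m + i, j) * w (?n - m + i)) = 0"
        proof (cases "j < p \<or> p + m \<le> j")
          case True
          then show ?thesis using z j by blast
        next
          case False
          then show ?thesis using r[rule_format, of "j - p"] by auto
        qed
      qed
    qed (use off in auto)
    also have "\<dots> \<longleftrightarrow> left_null ?Z (\<lambda>i. w (?n - m + i))" by (simp add: left_null_def)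
    finally show ?thesis .
  qed
  have Z: "?Z \<in> carrier_mat m m" by simp
  show ?thesis
  proof
    assume "det X = 0"
    then obtain v where "left_null X v" "\<exists>i<?n. v i \<noteq> 0" using det_eq_0_iff_left_null[OF X] by auto
    from shift_left_null[OF X B HX this] obtain w where
      w: "left_null X w" "\<exists>i<?n. w i \<noteq> 0" "\<forall>i<?n - m. w i = 0" by blast
    from w(2) obtain i where i: "i < ?n" "w i \<noteq> 0" by blast
    then have "?n - m \<le> i" using w(3) not_le_imp_less by blast
    then have "\<exists>i<m. w (?n - m + i) \<noteq> 0" using i by (intro exI[of _ "i - (?n - m)"]) auto
    then show "det ?Z = 0" using restrict[OF w(3)] w(1) det_eq_0_iff_left_null[OF Z] by blast
  next
    assume "det ?Z = 0"
    then obtain v where v: "left_null ?Z v" "\<exists>i<m. v i \<noteq> 0" using det_eq_0_iff_left_null[OF Z] by auto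
    define w where "w i = (if i < ?n - m then 0 else v (i - (?n - m)))" for i
    have w0: "\<forall>i<?n - m. w i = 0" by (simp add: w_def)
    have "(\<lambda>i. w (?n - m + i)) = v" by (auto simp: w_def)
    then have "left_null X w" using restrict[OF w0] v(1) by simp
    moreover have "\<exists>i<?n. w i \<noteq> 0"
    proof -
      from v(2) obtain i where i: "i < m" "v i \<noteq> 0" by blast
      then have "?n - m + i < ?n" using mn by linarith
      moreover have "w (?n - m + i) = v i" by (simp add: w_def)
      ultimately show ?thesis using i by metis
    qed
    ultimately show "det X = 0" using det_eq_0_iff_left_null[OF X] by blast
  qed
qed

text \<open>Substituting the equation into its own transpose gives \<open>X = h * X * h'\<close>:
  the asymmetry is an isometry of the form. This turns a form into an intertwiner, to which the null
  vector argument applies.\<close>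

lemma forms_intertwine:
  fixes X :: "'a::field mat"
  assumes h: "h \<in> carrier_mat n n" and X: "X \<in> carrier_mat n n" "X = h * transpose_mat X"
    and B: "B \<in> carrier_mat n n" "transpose_mat h * B = 1\<^sub>m n"
  shows "h * X = X * B"
proof -
  have "transpose_mat X = transpose_mat (h * transpose_mat X)" using X(2) by (rule arg_cong)
  also have "\<dots> = X * transpose_mat h" using h X(1) by (simp add: transpose_mult[of _ n n _ n])
  finally have "X = h * (X * transpose_mat h)" using X(2) by metis
  then have "X * B = h * (X * transpose_mat h) * B" by simp
  also have "\<dots> = h * (X * (transpose_mat h * B))"
    using h X(1) B(1) by (simp add: assoc_mult_mat[of _ n n _ n _ n])
  finally show ?thesis using B X(1) by simp
qed

lemma inverse_transpose_ex:
  fixes h :: "'a::field mat"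
  assumes "h \<in> carrier_mat n n" "det h \<noteq> 0"
  obtains B where "B \<in> carrier_mat n n" "transpose_mat h * B = 1\<^sub>m n" "B * transpose_mat h = 1\<^sub>m n"
proof -
  have "transpose_mat h \<in> carrier_mat n n" "det (transpose_mat h) \<noteq> 0"
    using assms by (auto simp: det_transpose)
  from det_nonzero_inverse[OF this] show ?thesis using that by blast
qed

lemma card_forms_dsum_shift:
  fixes h :: "'a::{field,finite} mat"
  assumes h: "h \<in> carrier_mat b b" "det h \<noteq> 0"
    and nil: "(h - 1\<^sub>m b) ^\<^sub>m (k - 1) = 0\<^sub>m b b" and k: "0 < k"
  shows "card (forms (dsum (shift_mat k m) h)) =
    card (forms (shift_mat k m :: 'a mat)) * CARD('a) ^ (m * b) * card (forms h)"
proof -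
  let ?H = "shift_mat k m :: 'a mat"
  let ?n = "k * m"
  obtain B where B: "B \<in> carrier_mat ?n ?n" "transpose_mat ?H * B = 1\<^sub>m ?n"
    using inverse_transpose_ex[OF shift_mat_carrier det_shift_mat] by metis
  obtain c where c: "c \<in> carrier_mat b b" "transpose_mat h * c = 1\<^sub>m b" "c * transpose_mat h = 1\<^sub>m b"
    using inverse_transpose_ex[OF h] by metis
  have "(transpose_mat h - 1\<^sub>m b) ^\<^sub>m (k - 1) = transpose_mat ((h - 1\<^sub>m b) ^\<^sub>m (k - 1))"
    using h by (subst transpose_pow_mat[of _ b]) (auto intro: minus_carrier_mat simp: transpose_minus[of _ b b])
  then have "(transpose_mat h - 1\<^sub>m b) ^\<^sub>m (k - 1) = 0\<^sub>m b b" using nil by simp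
  \<comment> \<open>The inverse transpose \<open>c\<close> of \<open>h\<close> is as nilpotent after
    subtracting 1 as \<open>h\<close>; it plays the role of \<open>B\<close> for the block
    \<open>Q\<close>.\<close>
  then have cnil: "(c - 1\<^sub>m b) ^\<^sub>m (k - 1) = 0\<^sub>m b b"
    using h by (intro inverse_minus_one_pow[OF _ c]) simp_all
  have cnil': "(c - 1\<^sub>m b) ^\<^sub>m k = 0\<^sub>m b b"
    using cnil k c(1) by (cases k) (auto simp: left_mult_zero_mat[of _ b b])
  have Qiff: "Q = ?H * Q * transpose_mat h \<longleftrightarrow> ?H * Q = Q * c" if Q: "Q \<in> carrier_mat ?n b" for Q
  proof
    have HQ: "?H * Q \<in> carrier_mat ?n b" using Q by (intro mult_carrier_mat[of _ _ ?n]) auto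
    assume "Q = ?H * Q * transpose_mat h"
    then have "Q * c = ?H * Q * transpose_mat h * c" by simp
    also have "\<dots> = ?H * Q * (transpose_mat h * c)"
      using HQ h c by (intro assoc_mult_mat[of _ ?n b _ b _ b]) auto
    also have "\<dots> = ?H * Q" unfolding c(2) by (rule right_mult_one_mat[OF HQ])
    finally show "?H * Q = Q * c" by simp
  next
    assume "?H * Q = Q * c"
    then have "?H * Q * transpose_mat h = Q * c * transpose_mat h" by simp
    also have "\<dots> = Q * (c * transpose_mat h)" using Q h c by (intro assoc_mult_mat[of _ ?n b _ b _ b]) auto
    finally show "Q = ?H * Q * transpose_mat h" using c Q by simp
  qed
  have "pivot_block ?n X" if "X \<in> forms (dsum ?H h)" for X
  proof -
    have X: "X \<in> carrier_mat (?n + b) (?n + b)" "det X \<noteq> 0" "X = dsum ?H h * transpose_mat X"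
      using that h unfolding forms_def by auto
    from four_block_matE[OF X(1)] obtain P Q R T where b: "P \<in> carrier_mat ?n ?n" "Q \<in> carrier_mat ?n b"
      "R \<in> carrier_mat b ?n" "T \<in> carrier_mat b b" "X = four_block_mat P Q R T" by blast
    have e: "P = ?H * transpose_mat P" "Q = ?H * transpose_mat R" "R = h * transpose_mat Q"
      using X(3) unfolding b(5) eq_dsum_mult_transpose_iff[OF b(1-4) shift_mat_carrier h(1)] by blast+
    have "transpose_mat R = Q * transpose_mat h"
      using b(2) h arg_cong[OF e(3), of transpose_mat] by (simp add: transpose_mult[of _ b b _ ?n])
    then have "?H * transpose_mat R = ?H * Q * transpose_mat h"
      using b(2) h by (simp add: assoc_mult_mat[of _ ?n ?n _ b _ b])
    then have HQ: "?H * Q = Q * c" using e(2) Qiff[OF b(2)] by metis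
    have "det P \<noteq> 0"
      using shift_pivot_det_nonzero[OF b(1-4) X(2)[unfolded b(5)] B(1) forms_intertwine[OF shift_mat_carrier b(1) e(1) B]]
        shift_intertwiner_last_rows[OF b(2) c(1) HQ cnil] by blast
    then show ?thesis unfolding b(5) pivot_block_four_block_mat[OF b(1,4)] .
  qed
  then have "{X \<in> forms (dsum ?H h). pivot_block ?n X} = forms (dsum ?H h)" by blast
  moreover have "{Q \<in> carrier_mat ?n b. Q = ?H * Q * transpose_mat h} = {Q \<in> carrier_mat ?n b. ?H * Q = Q * c}"
    using Qiff by blast
  ultimately show ?thesis
    using card_forms_schur[OF shift_mat_carrier h(1) det_shift_mat, of k m]
      card_shift_intertwiners[OF c(1) cnil' k, of m] by simp
qed

text \<open>The exponent is twice that for forms, because both off-diagonal blocks are free; the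
  pivot argument is the same.\<close>

lemma card_centralizer_dsum_shift:
  fixes h :: "'a::{field,finite} mat"
  assumes h: "h \<in> carrier_mat b b"
    and nil: "(h - 1\<^sub>m b) ^\<^sub>m (k - 1) = 0\<^sub>m b b" and k: "0 < k"
  shows "card (centralizer (dsum (shift_mat k m) h)) =
    card (centralizer (shift_mat k m :: 'a mat)) * CARD('a) ^ (2 * (m * b)) * card (centralizer h)"
proof -
  let ?H = "shift_mat k m :: 'a mat"
  let ?n = "k * m"
  have nil': "(h - 1\<^sub>m b) ^\<^sub>m k = 0\<^sub>m b b"
    using nil k h by (cases k) (auto simp: left_mult_zero_mat[of _ b b])
  have "pivot_block ?n X" if "X \<in> centralizer (dsum ?H h)" for X
  proof -
    have X: "X \<in> carrier_mat (?n + b) (?n + b)" "det X \<noteq> 0" "X * dsum ?H h = dsum ?H h * X"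
      using that h unfolding centralizer_def by auto
    from four_block_matE[OF X(1)] obtain P Q R T where b: "P \<in> carrier_mat ?n ?n" "Q \<in> carrier_mat ?n b"
      "R \<in> carrier_mat b ?n" "T \<in> carrier_mat b b" "X = four_block_mat P Q R T" by blast
    have e: "P * ?H = ?H * P" "Q * h = ?H * Q"
      using X(3) unfolding b(5) dsum_commute_iff[OF b(1-4) shift_mat_carrier h(1)] by blast+
    have "det P \<noteq> 0"
      using shift_pivot_det_nonzero[OF b(1-4) X(2)[unfolded b(5)] shift_mat_carrier e(1)[symmetric]]
        shift_intertwiner_last_rows[OF b(2) h e(2)[symmetric] nil] by blast
    then show ?thesis unfolding b(5) pivot_block_four_block_mat[OF b(1,4)] .
  qed
  then have "{X \<in> centralizer (dsum ?H h). pivot_block ?n X} = centralizer (dsum ?H h)" by blast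
  moreover have "{Q \<in> carrier_mat ?n b. Q * h = ?H * Q} = {Q \<in> carrier_mat ?n b. ?H * Q = Q * h}" by auto
  ultimately show ?thesis
    using card_centralizer_schur[OF shift_mat_carrier h, of k m]
      card_shift_intertwiners[OF h nil' k, of m] card_shift_intertwiners_right[OF h nil' k, of m]
    by (simp add: power_add mult_2 mult.assoc)
qed

section \<open>Jordan blocks of a single size\<close>

lemma mult_shift_mat_transpose_index:
  fixes X :: "'a::field mat"
  assumes X: "X \<in> carrier_mat (k * m) (k * m)" and i: "i < k * m" and j: "j < k * m"
  shows "(shift_mat k m * transpose_mat X) $$ (i, j) = X $$ (j, i) + (if i + m < k * m then X $$ (j, i + m) else 0)"
  by (subst shift_mat_mult_index[of _ k m "k * m"]) (use assms in auto)

lemma forms_shift_iff: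
  "X \<in> forms (shift_mat k m :: 'a::field mat) \<longleftrightarrow> X \<in> carrier_mat (k * m) (k * m) \<and> det X \<noteq> 0 \<and>
    (\<forall>i<k * m. \<forall>j<k * m. X $$ (i, j) = X $$ (j, i) + (if i + m < k * m then X $$ (j, i + m) else 0))"
proof (cases "X \<in> carrier_mat (k * m) (k * m)")
  case True
  have "X = shift_mat k m * transpose_mat X \<longleftrightarrow>
    (\<forall>i<k * m. \<forall>j<k * m. X $$ (i, j) = (shift_mat k m * transpose_mat X) $$ (i, j))"
    using True by (intro carrier_mat_eq_iff) auto
  also have "\<dots> \<longleftrightarrow> (\<forall>i<k * m. \<forall>j<k * m. X $$ (i, j) = X $$ (j, i) + (if i + m < k * m then X $$ (j, i + m) else 0))"
    by (simp add: mult_shift_mat_transpose_index[OF True] del: index_mult_mat)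
  finally show ?thesis using True by (simp add: forms_def)
qed (auto simp: forms_def)

text \<open>The whole linear solution space, singular matrices included. Passing from
  \<open>k\<close> to \<open>k + 2\<close> is a bijection on this level; invertibility is put back
  through the corner block.\<close>

definition shift_forms :: "nat \<Rightarrow> nat \<Rightarrow> 'a::field mat set" where
  "shift_forms k m = {X \<in> carrier_mat (k * m) (k * m).
    \<forall>i<k * m. \<forall>j<k * m. X $$ (i, j) = X $$ (j, i) + (if i + m < k * m then X $$ (j, i + m) else 0)}"

lemma forms_shift_eq: "forms (shift_mat k m) = {X \<in> shift_forms k m. det X \<noteq> 0}"
  unfolding shift_forms_def using forms_shift_iff by blast

lemma shift_forms_carrier: "X \<in> shift_forms k m \<Longrightarrow> X \<in> carrier_mat (k * m) (k * m)"
  unfolding shift_forms_def by blast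

lemma shift_formsD:
  "X \<in> shift_forms k m \<Longrightarrow> i < k * m \<Longrightarrow> j < k * m \<Longrightarrow>
    X $$ (i, j) = X $$ (j, i) + (if i + m < k * m then X $$ (j, i + m) else 0)"
  unfolding shift_forms_def by blast

text \<open>The relation for \<open>(i, j)\<close> and the one for \<open>(j, i)\<close> add up to
  this: moving one index by a layer is minus moving the other.\<close>

lemma shift_forms_swap:
  assumes "X \<in> shift_forms k m" "i < k * m" "j < k * m"
  shows "(if i + m < k * m then X $$ (j, i + m) else 0) = - (if j + m < k * m then X $$ (i, j + m) else 0)"
proof -
  have "X $$ (i, j) = X $$ (j, i) + (if i + m < k * m then X $$ (j, i + m) else 0)"
    "X $$ (j, i) = X $$ (i, j) + (if j + m < k * m then X $$ (i, j + m) else 0)"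
    using shift_formsD[OF assms(1)] assms(2,3) by blast+
  moreover have "a = - b" if "x = y + a" "y = x + b" for x y a b :: 'a
    using that by (simp add: eq_neg_iff_add_eq_0 add.commute)
  ultimately show ?thesis by blast
qed

text \<open>For \<open>i\<close> in the last layer the shifted term is out of range, so the swap
  rule at \<open>(i, j - m)\<close> says that the entry at \<open>(i, j)\<close> is 0; the defining
  relation transfers this to \<open>(j, i)\<close>.\<close>

lemma shift_forms_zero_right:
  assumes X: "X \<in> shift_forms k m" and "k * m \<le> i + m" "i < k * m" "m \<le> j" "j < k * m"
  shows "X $$ (i, j) = 0" "X $$ (j, i) = 0"
proof -
  show 1: "X $$ (i, j) = 0"
    using shift_forms_swap[OF X, of i "j - m"] assms by auto
  have "X $$ (i, j) = X $$ (j, i) + (if i + m < k * m then X $$ (j, i + m) else 0)"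
    using shift_formsD[OF X] assms by blast
  then show "X $$ (j, i) = 0" using 1 assms by simp
qed

text \<open>The bottom left block: by the vanishing just shown it contains everything in the last
  layer of rows that can be nonzero.\<close>

definition corner :: "nat \<Rightarrow> nat \<Rightarrow> 'a mat \<Rightarrow> 'a mat" where
  "corner k m X = mat m m (\<lambda>(i, j). X $$ (k * m - m + i, j))"

lemma det_shift_forms:
  fixes X :: "'a::field mat"
  assumes X: "X \<in> shift_forms k m" and k: "0 < k"
  shows "det X = 0 \<longleftrightarrow> det (corner k m X) = 0"
proof -
  have Xc: "X \<in> carrier_mat (k * m) (k * m)" using X by (rule shift_forms_carrier)
  have eq: "X = shift_mat k m * transpose_mat X"
  proof (subst carrier_mat_eq_iff[of _ "k * m" "k * m"])
    show "\<forall>i<k * m. \<forall>j<k * m. X $$ (i, j) = (shift_mat k m * transpose_mat X) $$ (i, j)"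
    proof (intro allI impI)
      fix i j assume ij: "i < k * m" "j < k * m"
      show "X $$ (i, j) = (shift_mat k m * transpose_mat X) $$ (i, j)"
        unfolding mult_shift_mat_transpose_index[OF Xc ij] by (rule shift_formsD[OF X ij])
    qed
  qed (use Xc in auto)
  obtain B :: "'a mat" where B: "B \<in> carrier_mat (k * m) (k * m)" "transpose_mat (shift_mat k m) * B = 1\<^sub>m (k * m)"
    using inverse_transpose_ex[OF shift_mat_carrier det_shift_mat] by metis
  have "m \<le> k * m" using k by (cases k) auto
  then show ?thesis
    using shift_corner_det[OF Xc B(1) forms_intertwine[OF shift_mat_carrier Xc eq B] k, of 0]
      shift_forms_zero_right(1)[OF X] by (auto simp: corner_def)
qed

lemma card_forms_shift_corner:
  "0 < k \<Longrightarrow> card (forms (shift_mat k m :: 'a::field mat)) = card {X \<in> shift_forms k m. det (corner k m X :: 'a mat) \<noteq> 0}"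
  unfolding forms_shift_eq by (rule arg_cong[of _ _ card]) (use det_shift_forms in auto)

text \<open>The defining relations determine every entry outside the top left block \<open>A\<close> and the middle
  part \<open>Y\<close>, which is a form for the shift matrix with two layers less.\<close>

definition extend_form :: "nat \<Rightarrow> nat \<Rightarrow> 'a::field mat \<Rightarrow> 'a mat \<Rightarrow> 'a mat" where
  "extend_form k m A Y = (let
     u = (\<lambda>j i. if i < m then A $$ (j, i) else if i < 2 * m then A $$ (i - m, j) - A $$ (j, i - m)
       else - Y $$ (i - 2 * m, j))
   in mat (Suc (Suc k) * m) (Suc (Suc k) * m) (\<lambda>(i, j).
     if i < m then u i j
     else if j < m then u j i + (if i + m < Suc (Suc k) * m then u j (i + m) else 0)
     else if i < Suc k * m \<and> j < Suc k * m then Y $$ (i - m, j - m) else 0))"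

text \<open>The clauses for the first layer of rows are forced. In the second layer of columns the
  defining relation inside the top left block gives
  \<open>A $$ (i - m, j) - A $$ (j, i - m)\<close>; further to the right the swap rule gives
  \<open>X $$ (j, i) = - X $$ (i - m, j + m)\<close>, an entry of \<open>- Y\<close>. The first
  layer of columns follows from the relation, and the remaining last layers are 0.\<close>

lemma extend_form_bij:
  "bij_betw (\<lambda>(A, Y). extend_form k m A Y) (carrier_mat m m \<times> shift_forms k m)
    (shift_forms (Suc (Suc k)) m :: 'a::field mat set)"
proof -
  let ?n = "Suc (Suc k) * m"
  let ?f = "\<lambda>(A, Y). extend_form k m A Y :: 'a mat"
  let ?g = "\<lambda>X :: 'a mat. (mat m m (\<lambda>(i, j). X $$ (i, j)), mat (k * m) (k * m) (\<lambda>(i, j). X $$ (i + m, j + m)))"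
  show ?thesis
  proof (rule bij_betw_byWitness[where f' = ?g])
    show "\<forall>p \<in> carrier_mat m m \<times> shift_forms k m. ?g (?f p) = p"
    proof
      fix p :: "'a mat \<times> 'a mat" assume "p \<in> carrier_mat m m \<times> shift_forms k m"
      then obtain A Y where p: "p = (A, Y)" and A: "A \<in> carrier_mat m m" and Y: "Y \<in> shift_forms k m" by blast
      have Yc: "Y \<in> carrier_mat (k * m) (k * m)" using Y by (rule shift_forms_carrier)
      have "mat m m (\<lambda>(i, j). extend_form k m A Y $$ (i, j)) = A"
        using A by (intro eq_matI) (auto simp: extend_form_def)
      moreover have "mat (k * m) (k * m) (\<lambda>(i, j). extend_form k m A Y $$ (i + m, j + m)) = Y"
        using Yc by (intro eq_matI) (auto simp: extend_form_def)
      ultimately show "?g (?f p) = p" unfolding p by simp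
    qed
    show "\<forall>X \<in> shift_forms (Suc (Suc k)) m. ?f (?g X) = X"
    proof
      fix X :: "'a mat" assume X: "X \<in> shift_forms (Suc (Suc k)) m"
      have Xc: "X \<in> carrier_mat ?n ?n" using X by (rule shift_forms_carrier)
      have rel: "X $$ (i, j) = X $$ (j, i) + (if i + m < ?n then X $$ (j, i + m) else 0)"
        if "i < ?n" "j < ?n" for i j using shift_formsD[OF X] that by blast
      note swap = shift_forms_swap[OF X] and zero = shift_forms_zero_right[OF X]
      define u where "u j i = (if i < m then X $$ (j, i) else if i < 2 * m then X $$ (i - m, j) - X $$ (j, i - m)
        else - X $$ (i - 2 * m + m, j + m))" for i j
      have u: "u j i = X $$ (j, i)" if "j < m" "i < ?n" for i j
      proof -
        have "u j i = X $$ (j, i)" if i: "m \<le> i" "i < 2 * m"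
          using rel[of "i - m" j] \<open>j < m\<close> \<open>i < ?n\<close> i by (auto simp: u_def)
        moreover have "u j i = X $$ (j, i)" if i: "2 * m \<le> i"
          using swap[of "i - m" j] \<open>j < m\<close> \<open>i < ?n\<close> i by (auto simp: u_def split: if_splits)
        ultimately show ?thesis using that by (cases "i < m"; cases "i < 2 * m") (auto simp: u_def)
      qed
      have "?f (?g X) = mat ?n ?n (\<lambda>(i, j).
         if i < m then u i j
         else if j < m then u j i + (if i + m < ?n then u j (i + m) else 0)
         else if i < Suc k * m \<and> j < Suc k * m then X $$ (i, j) else 0)"
      proof (cases "k = 0")
        case True
        then show ?thesis unfolding extend_form_def Let_def prod.case
          by (intro cong_mat refl) (auto simp: u_def)
      next
        case False
        then have "j < k * m" if "j < m" for j using that by (cases k) auto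
        then show ?thesis unfolding extend_form_def Let_def prod.case
          by (intro cong_mat refl) (auto simp: u_def)
      qed
      also have "\<dots> = X"
      proof (rule eq_matI)
        fix i j assume "i < dim_row X" "j < dim_col X"
        then have ij: "i < ?n" "j < ?n" using Xc by auto
        consider "i < m" | "m \<le> i" "j < m" | "m \<le> i" "m \<le> j" "i < Suc k * m" "j < Suc k * m"
          | "m \<le> i" "m \<le> j" "Suc k * m \<le> i" | "m \<le> i" "m \<le> j" "Suc k * m \<le> j" by linarith
        then show "mat ?n ?n (\<lambda>(i, j).
         if i < m then u i j
         else if j < m then u j i + (if i + m < ?n then u j (i + m) else 0)
         else if i < Suc k * m \<and> j < Suc k * m then X $$ (i, j) else 0) $$ (i, j) = X $$ (i, j)"
        proof cases
          case 2
          then show ?thesis using ij rel[of i j] by (simp add: u)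
        next
          case 4
          then show ?thesis using ij zero(1)[of i j] by simp
        next
          case 5
          then show ?thesis using ij zero(2)[of j i] by simp
        qed (use ij u in simp_all)
      qed (use Xc in auto)
      finally show "?f (?g X) = X" .
    qed
    show "?f ` (carrier_mat m m \<times> shift_forms k m) \<subseteq> shift_forms (Suc (Suc k)) m"
    proof (intro image_subsetI)
      fix p :: "'a mat \<times> 'a mat" assume "p \<in> carrier_mat m m \<times> shift_forms k m"
      then obtain A Y where p: "p = (A, Y)" and A: "A \<in> carrier_mat m m" and Y: "Y \<in> shift_forms k m" by blast
      have Yrel: "Y $$ (i, j) = Y $$ (j, i) + (if i + m < k * m then Y $$ (j, i + m) else 0)"
        if "i < k * m" "j < k * m" for i j using shift_formsD[OF Y] that by blast
      note Yzero = shift_forms_zero_right[OF Y] and Yswap = shift_forms_swap[OF Y]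
      let ?X = "extend_form k m A Y"
      have Xc: "?X \<in> carrier_mat ?n ?n" by (simp add: extend_form_def)
      have X1: "?X $$ (j, i) = (if i < m then A $$ (j, i) else if i < 2 * m then A $$ (i - m, j) - A $$ (j, i - m)
         else - Y $$ (i - 2 * m, j))" if "j < m" "i < ?n" for i j
        using that by (simp add: extend_form_def)
      have X2: "?X $$ (i, j) = ?X $$ (j, i) + (if i + m < ?n then ?X $$ (j, i + m) else 0)"
        if "m \<le> i" "i < ?n" "j < m" for i j
        using that by (auto simp: extend_form_def Let_def)
      have X3: "?X $$ (i, j) = (if i < Suc k * m \<and> j < Suc k * m then Y $$ (i - m, j - m) else 0)"
        if "m \<le> i" "i < ?n" "m \<le> j" "j < ?n" for i j
        using that by (auto simp: extend_form_def)
      have "?X $$ (i, j) = ?X $$ (j, i) + (if i + m < ?n then ?X $$ (j, i + m) else 0)"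
        if ij: "i < ?n" "j < ?n" for i j
      proof -
        consider "m \<le> i" "j < m" | "i < m" "j < m" | "i < m" "m \<le> j" | "m \<le> i" "m \<le> j" by linarith
        then show ?thesis
        proof cases
          case 1
          then show ?thesis using X2 ij by blast
        next
          case 2
          then show ?thesis using ij by (simp add: X1)
        next
          case 3
          have e: "?X $$ (j, i) = ?X $$ (i, j) + (if j + m < ?n then ?X $$ (i, j + m) else 0)"
            using X2[of j i] 3 ij by blast
          \<comment> \<open>The swap rule between the first layer and the middle part, built in by
            the minus sign in the third clause of \<open>extend_form\<close>. For
            \<open>k = 0\<close> there is no middle part and both sides are 0.\<close>
          have 4: "(if j + m < ?n then ?X $$ (i, j + m) else 0) = - ?X $$ (j, i + m)"
          proof (cases "k = 0")
            case True
            then show ?thesis using 3 ij X3[of j "i + m"] by simp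
          next
            case False
            then have "i < k * m" using 3 by (cases k) auto
            then show ?thesis using 3 ij by (auto simp: X1 X3)
          qed
          show ?thesis using e 4 3 ij by simp
        next
          case 4
          show ?thesis
          proof (cases "i < Suc k * m \<and> j < Suc k * m")
            case True
            then have "i - m < k * m" "j - m < k * m" using 4 by auto
            from Yrel[OF this] show ?thesis using True 4 by (auto simp: X3)
          next
            case False
            then show ?thesis using 4 ij by (auto simp: X3)
          qed
        qed
      qed
      then show "?f p \<in> shift_forms (Suc (Suc k)) m"
        using Xc unfolding p prod.case shift_forms_def by blast
    qed
    show "?g ` shift_forms (Suc (Suc k)) m \<subseteq> carrier_mat m m \<times> shift_forms k m"
    proof (intro image_subsetI SigmaI mat_carrier)
      fix X :: "'a mat" assume X: "X \<in> shift_forms (Suc (Suc k)) m"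
      let ?Y = "mat (k * m) (k * m) (\<lambda>(i, j). X $$ (i + m, j + m))"
      have "?Y $$ (i, j) = ?Y $$ (j, i) + (if i + m < k * m then ?Y $$ (j, i + m) else 0)"
        if ij: "i < k * m" "j < k * m" for i j
      proof (cases "i + m < k * m")
        case True
        then show ?thesis using shift_formsD[OF X, of "i + m" "j + m"] ij by simp
      next
        case False
        \<comment> \<open>The relation for \<open>X\<close> has a further term here that is missing
          in the one for \<open>?Y\<close>; it lies in the last layer of columns and
          vanishes.\<close>
        have "X $$ (j + m, i + m + m) = 0" if "i + m + m < ?n"
          using shift_forms_zero_right(2)[OF X, of "i + m + m" "j + m"] that False ij by simp
        then show ?thesis using shift_formsD[OF X, of "i + m" "j + m"] False ij by simp
      qed
      then show "?Y \<in> shift_forms k m" unfolding shift_forms_def using mat_carrier by blast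
    qed
  qed
qed

text \<open>For \<open>k > 0\<close> the corner of the extension is minus the corner of
  \<open>Y\<close>, so \<open>A\<close> does not influence invertibility and contributes the factor
  \<open>q^(m*m)\<close>.\<close>

lemma card_forms_shift_Suc_Suc:
  assumes k: "0 < k"
  shows "card (forms (shift_mat (Suc (Suc k)) m :: 'a::{field,finite} mat)) =
    CARD('a) ^ (m * m) * card (forms (shift_mat k m :: 'a mat))"
proof -
  let ?n = "Suc (Suc k) * m"
  have mk: "\<not> k * m + i < m" "k * m + i - m = k * m - m + i" for i using k by (cases k; simp)+
  have corner: "det (corner (Suc (Suc k)) m (extend_form k m A Y)) = 0 \<longleftrightarrow> det (corner k m Y) = 0"
    if Y: "Y \<in> shift_forms k m" for A Y :: "'a mat"
  proof -
    have "corner (Suc (Suc k)) m (extend_form k m A Y) = (- 1) \<cdot>\<^sub>m corner k m Y"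
      using mk by (intro eq_matI) (auto simp: corner_def extend_form_def)
    then show ?thesis by (simp add: det_smult corner_def)
  qed
  have "bij_betw (\<lambda>(A, Y). extend_form k m A Y) (carrier_mat m m \<times> {Y \<in> shift_forms k m. det (corner k m Y :: 'a mat) \<noteq> 0})
    {X \<in> shift_forms (Suc (Suc k)) m. det (corner (Suc (Suc k)) m X :: 'a mat) \<noteq> 0}"
  proof (rule bij_betw_subset[OF extend_form_bij[of k m]])
    show "(\<lambda>(A, Y). extend_form k m A Y) ` (carrier_mat m m \<times> {Y \<in> shift_forms k m. det (corner k m Y :: 'a mat) \<noteq> 0}) =
      {X \<in> shift_forms (Suc (Suc k)) m. det (corner (Suc (Suc k)) m X) \<noteq> 0}" (is "?f ` ?D = ?R")
    proof (intro equalityI subsetI)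
      fix X assume "X \<in> ?f ` ?D"
      then obtain A Y where AY: "A \<in> carrier_mat m m" "Y \<in> shift_forms k m" "det (corner k m Y) \<noteq> 0"
        "X = extend_form k m A Y" by auto
      then have "X \<in> shift_forms (Suc (Suc k)) m" using bij_betwE[OF extend_form_bij[of k m]] by auto
      then show "X \<in> ?R" using corner[OF AY(2)] AY by simp
    next
      fix X assume X: "X \<in> ?R"
      then have "X \<in> ?f ` (carrier_mat m m \<times> shift_forms k m)"
        using bij_betw_imp_surj_on[OF extend_form_bij[of k m, where ?'a = 'a]] by simp
      then obtain A Y where AY: "A \<in> carrier_mat m m" "Y \<in> shift_forms k m" "X = extend_form k m A Y" by auto
      then show "X \<in> ?f ` ?D" using corner[OF AY(2)] X by auto
    qed
  qed auto
  from bij_betw_same_card[OF this] show ?thesis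
    unfolding card_forms_shift_corner[OF k] card_forms_shift_corner[of "Suc (Suc k)", OF zero_less_Suc]
    by (simp add: card_cartesian_product card_carrier_mat)
qed

text \<open>Without a middle part the corner falls into the second clause of
  \<open>extend_form\<close> and is \<open>A - A'\<close>; here invertibility does restrict
  \<open>A\<close>.\<close>

lemma card_forms_shift_two:
  "card (forms (shift_mat 2 m :: 'a::{field,finite} mat)) =
    card {A \<in> carrier_mat m m. det (A - transpose_mat A :: 'a mat) \<noteq> 0}"
proof -
  have S0: "shift_forms 0 m = {0\<^sub>m 0 0 :: 'a mat}" by (auto simp: shift_forms_def intro!: eq_matI)
  have corner: "corner 2 m (extend_form 0 m A Y) = A - transpose_mat A" if "A \<in> carrier_mat m m" for A Y :: "'a mat"
    using that by (intro eq_matI) (auto simp: corner_def extend_form_def)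
  have two: "Suc (Suc 0) = 2" by simp
  have bij: "bij_betw (\<lambda>A. extend_form 0 m A (0\<^sub>m 0 0)) (carrier_mat m m) (shift_forms 2 m :: 'a mat set)"
  proof -
    have "bij_betw (\<lambda>A. (A, 0\<^sub>m 0 0 :: 'a mat)) (carrier_mat m m :: 'a mat set) (carrier_mat m m \<times> shift_forms 0 m)"
      unfolding S0 by (rule bij_betw_byWitness[where f' = fst]) auto
    from bij_betw_trans[OF this extend_form_bij[of 0 m]] show ?thesis by (simp add: comp_def two)
  qed
  have "bij_betw (\<lambda>A. extend_form 0 m A (0\<^sub>m 0 0)) {A \<in> carrier_mat m m. det (A - transpose_mat A :: 'a mat) \<noteq> 0}
    {X \<in> shift_forms 2 m. det (corner 2 m X) \<noteq> 0}"
  proof (rule bij_betw_subset[OF bij])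
    have im: "(\<lambda>A. extend_form 0 m A (0\<^sub>m 0 0)) ` carrier_mat m m = (shift_forms 2 m :: 'a mat set)"
      using bij by (rule bij_betw_imp_surj_on)
    show "(\<lambda>A. extend_form 0 m A (0\<^sub>m 0 0)) ` {A \<in> carrier_mat m m. det (A - transpose_mat A :: 'a mat) \<noteq> 0} =
      {X \<in> shift_forms 2 m. det (corner 2 m X) \<noteq> 0}"
      unfolding im[symmetric] using corner by auto
  qed auto
  from bij_betw_same_card[OF this] show ?thesis by (simp add: card_forms_shift_corner)
qed

lemma shift_mat_one: "shift_mat (Suc 0) m = 1\<^sub>m m"
  by (intro eq_matI) (auto simp: shift_mat_def)

section \<open>The centralizer of type \<open>k^m\<close>\<close>

lemma centralizer_shift_iff:
  fixes X :: "'a::field mat"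
  assumes X: "X \<in> carrier_mat (k * m) (k * m)"
  shows "X * shift_mat k m = shift_mat k m * X \<longleftrightarrow>
    (\<forall>i<k * m. \<forall>j<k * m. (if i + m < k * m then X $$ (i + m, j) else 0) = (if m \<le> j then X $$ (i, j - m) else 0))"
proof -
  have "X * shift_mat k m = shift_mat k m * X \<longleftrightarrow>
    (\<forall>i<k * m. \<forall>j<k * m. (X * shift_mat k m) $$ (i, j) = (shift_mat k m * X) $$ (i, j))"
    using X by (intro carrier_mat_eq_iff) auto
  also have "\<dots> \<longleftrightarrow> (\<forall>i<k * m. \<forall>j<k * m. (if i + m < k * m then X $$ (i + m, j) else 0) = (if m \<le> j then X $$ (i, j - m) else 0))"
  proof (intro all_cong)
    fix i j assume ij: "i < k * m" "j < k * m"
    show "(X * shift_mat k m) $$ (i, j) = (shift_mat k m * X) $$ (i, j) \<longleftrightarrow>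
      (if i + m < k * m then X $$ (i + m, j) else 0) = (if m \<le> j then X $$ (i, j - m) else 0)"
      unfolding mult_shift_mat_index[OF X ij] shift_mat_mult_index[OF X ij] add_left_cancel by (rule eq_commute)
  qed
  finally show ?thesis .
qed

text \<open>Commuting with the shift means being block upper triangular and constant along block
  diagonals. Such a matrix is determined by its first block row, here \<open>A\<close> followed by
  \<open>B\<close>, and it is invertible exactly if the diagonal block \<open>A\<close> is.\<close>

lemma card_centralizer_shift:
  "card (centralizer (shift_mat (Suc k) m :: 'a::{field,finite} mat)) =
    CARD('a) ^ (k * m * m) * card (inv_mats m :: 'a mat set)"
\<comment> \<open>The general case recovers block positions by dividing by \<open>m\<close>.\<close>
proof (cases "m = 0")
  case True
  have "centralizer (shift_mat (Suc k) 0 :: 'a mat) = inv_mats 0"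
    by (auto simp: centralizer_def intro!: eq_matI)
  then show ?thesis using True by simp
next
  case False
  let ?n = "Suc k * m"
  let ?H = "shift_mat (Suc k) m :: 'a mat"
  let ?f = "\<lambda>(A, B). mat ?n ?n (\<lambda>(i, j). if i div m * m \<le> j then
    (if j - i div m * m < m then A $$ (i mod m, j - i div m * m) else B $$ (i mod m, j - i div m * m - m)) else 0) :: 'a mat"
  let ?g = "\<lambda>X :: 'a mat. (mat m m (\<lambda>(i, j). X $$ (i, j)), mat m (k * m) (\<lambda>(i, j). X $$ (i, j + m)))"
  let ?C = "{X \<in> carrier_mat ?n ?n. X * ?H = ?H * X}"
  have bij: "bij_betw ?f (carrier_mat m m \<times> carrier_mat m (k * m)) ?C"
  proof (rule bij_betw_byWitness[where f' = ?g])
    show "\<forall>p \<in> carrier_mat m m \<times> carrier_mat m (k * m). ?g (?f p) = p"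
      by (auto intro!: eq_matI)
    show "\<forall>X \<in> ?C. ?f (?g X) = X"
    proof
      fix X assume "X \<in> ?C"
      then have Xc: "X \<in> carrier_mat ?n ?n" and X: "X * ?H = ?H * X" by auto
      note rel = X[unfolded centralizer_shift_iff[OF Xc], rule_format]
      \<comment> \<open>Going down one block row moves the content one block to the right and fills
        in zeros.\<close>
      have val: "X $$ (t * m + r, j) = (if t * m \<le> j then X $$ (r, j - t * m) else 0)"
        if "t \<le> k" "r < m" "j < ?n" for t r j
        using that
      proof (induction t arbitrary: j)
        case (Suc t)
        have le: "Suc t * m \<le> k * m" using Suc.prems by (intro mult_right_mono) auto
        have "X $$ (Suc t * m + r, j) = (if m \<le> j then X $$ (t * m + r, j - m) else 0)"
          using rel[of "t * m + r" j] Suc.prems le by (simp add: algebra_simps)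
        also have "\<dots> = (if Suc t * m \<le> j then X $$ (r, j - Suc t * m) else 0)"
        proof (cases "m \<le> j")
          case True
          then have "t * m \<le> j - m \<longleftrightarrow> Suc t * m \<le> j" by auto
          then show ?thesis using Suc.IH[of "j - m"] Suc.prems True by (simp add: diff_diff_left)
        qed auto
        finally show ?case .
      qed simp
      show "?f (?g X) = X"
      proof (rule eq_matI)
        fix i j assume "i < dim_row X" "j < dim_col X"
        then have ij: "i < ?n" "j < ?n" using Xc by auto
        have t: "i div m \<le> k" using ij(1) less_mult_imp_div_less[of i "Suc k" m] by simp
        show "?f (?g X) $$ (i, j) = X $$ (i, j)"
          using val[OF t, of "i mod m" j] ij False by auto
      qed (use Xc in auto)
    qed
    show "?f ` (carrier_mat m m \<times> carrier_mat m (k * m)) \<subseteq> ?C"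
    proof (intro image_subsetI)
      fix p :: "'a mat \<times> 'a mat"
      obtain A B where p: "p = (A, B)" by (cases p)
      let ?X = "?f (A, B)"
      have c: "?X \<in> carrier_mat ?n ?n" by simp
      define F where "F r l = (if l < m then A $$ (r, l) else B $$ (r, l - m))" for r l
      have X: "?X $$ (i, j) = (if i div m * m \<le> j then F (i mod m) (j - i div m * m) else 0)" if "i < ?n" "j < ?n" for i j
        using that by (simp add: F_def del: mult_Suc)
      have "?X * ?H = ?H * ?X"
        unfolding centralizer_shift_iff[OF c]
      proof (intro allI impI)
        fix i j assume ij: "i < ?n" "j < ?n"
        show "(if i + m < ?n then ?X $$ (i + m, j) else 0) = (if m \<le> j then ?X $$ (i, j - m) else 0)"
        proof (cases "i + m < ?n")
          case True
          have "(i + m) div m * m = i div m * m + m" using False by simp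
          then show ?thesis using X[OF True ij(2)] X[of i "j - m"] True ij False
            by (auto simp: diff_diff_left add.commute simp del: mult_Suc)
        next
          case ge: False
          have "k \<le> i div m" using ge False by (simp add: less_eq_div_iff_mult_less_eq)
          then have "k * m \<le> i div m * m" by simp
          moreover have "j < k * m + m" using ij by simp
          ultimately have "\<not> i div m * m \<le> j - m" if "m \<le> j" using that by linarith
          then show ?thesis using ge X[of i "j - m"] ij by (auto simp del: mult_Suc)
        qed
      qed
      then show "?f p \<in> ?C" unfolding p using c by blast
    qed
    show "?g ` ?C \<subseteq> carrier_mat m m \<times> carrier_mat m (k * m)"
      by (intro image_subsetI SigmaI mat_carrier)
  qed
  have det: "det (?f (A, B)) = 0 \<longleftrightarrow> det A = 0" if AB: "A \<in> carrier_mat m m" "B \<in> carrier_mat m (k * m)" for A B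
  proof -
    let ?X = "?f (A, B)"
    have X: "?X \<in> ?C" using bij_betwE[OF bij] AB by blast
    have c: "?X \<in> carrier_mat ?n ?n" by simp
    have z: "?X $$ (i, j) = 0" if "?n - m \<le> i" "i < ?n" "j < ?n" "j < k * m \<or> k * m + m \<le> j" for i j
    proof -
      have "k \<le> i div m" using that False by (simp add: less_eq_div_iff_mult_less_eq)
      then have "k * m \<le> i div m * m" by simp
      moreover have "j < k * m" using that by simp
      ultimately have "\<not> i div m * m \<le> j" by linarith
      then show ?thesis using that by simp
    qed
    have "mat m m (\<lambda>(i, j). ?X $$ (?n - m + i, k * m + j)) = A"
      using AB False by (intro eq_matI) auto
    then show ?thesis
      using shift_corner_det[OF c shift_mat_carrier _ zero_less_Suc _ z, of "k * m"] X by simp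
  qed
  have "bij_betw ?f (inv_mats m \<times> carrier_mat m (k * m)) (centralizer ?H)"
  proof (rule bij_betw_subset[OF bij])
    show "?f ` (inv_mats m \<times> carrier_mat m (k * m)) = centralizer ?H"
    proof (intro equalityI subsetI)
      fix X assume "X \<in> ?f ` (inv_mats m \<times> carrier_mat m (k * m))"
      then obtain A B where AB: "A \<in> carrier_mat m m" "det A \<noteq> 0" "B \<in> carrier_mat m (k * m)" "X = ?f (A, B)" by blast
      then have "X \<in> ?C" using bij_betwE[OF bij] by blast
      then show "X \<in> centralizer ?H" using det[OF AB(1,3)] AB by (auto simp: centralizer_def)
    next
      fix X assume X: "X \<in> centralizer ?H"
      then have "X \<in> ?C" by (auto simp: centralizer_def)
      then obtain A B where AB: "A \<in> carrier_mat m m" "B \<in> carrier_mat m (k * m)" "X = ?f (A, B)"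
        using bij_betw_imp_surj_on[OF bij] by blast
      moreover have "det A \<noteq> 0" using det[OF AB(1,2)] AB X by (auto simp: centralizer_def)
      ultimately show "X \<in> ?f ` (inv_mats m \<times> carrier_mat m (k * m))" by blast
    qed
  qed auto
  from bij_betw_same_card[OF this] show ?thesis
    by (simp add: card_cartesian_product card_carrier_mat mult.commute mult.left_commute)
qed

section \<open>Symmetric and alternating matrices\<close>

lemma forms_one: "forms (1\<^sub>m m :: 'a::field mat) = {X \<in> carrier_mat m m. det X \<noteq> 0 \<and> transpose_mat X = X}"
proof -
  have "X = 1\<^sub>m m * transpose_mat X \<longleftrightarrow> transpose_mat X = X" if "X \<in> carrier_mat m m" for X :: "'a mat"
  proof -
    have "1\<^sub>m m * transpose_mat X = transpose_mat X" by (rule left_mult_one_mat) (use that in simp)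
    then show ?thesis by (metis (no_types))
  qed
  then show ?thesis unfolding forms_def index_one_mat by (intro Collect_cong) (metis (no_types))
qed

lemma card_forms_one_1: "card (forms (1\<^sub>m 1 :: 'a::{field,finite} mat)) = CARD('a) - 1"
proof -
  have "forms (1\<^sub>m 1 :: 'a mat) = {v \<in> carrier_mat 1 1. v \<noteq> 0\<^sub>m 1 1}"
  proof (intro equalityI subsetI)
    fix X :: "'a mat" assume "X \<in> forms (1\<^sub>m 1)"
    then have "X \<in> carrier_mat 1 1" "det X \<noteq> 0" by (auto simp: forms_one)
    then show "X \<in> {v \<in> carrier_mat 1 1. v \<noteq> 0\<^sub>m 1 1}" by (auto simp: det_single)
  next
    fix X :: "'a mat" assume "X \<in> {v \<in> carrier_mat 1 1. v \<noteq> 0\<^sub>m 1 1}"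
    then have X: "X \<in> carrier_mat 1 1" "X \<noteq> 0\<^sub>m 1 1" by auto
    have "X $$ (0, 0) \<noteq> 0"
    proof
      assume "X $$ (0, 0) = 0"
      then have "X = 0\<^sub>m 1 1" using X by (intro eq_matI) auto
      then show False using X by simp
    qed
    moreover have "transpose_mat X = X" using X by (intro eq_matI) auto
    ultimately show "X \<in> forms (1\<^sub>m 1)" using X by (simp add: forms_one det_single)
  qed
  then show ?thesis using card_carrier_mat_nonzero[of 1 1, where ?'a = 'a] by simp
qed

lemma one_smult: "1 \<cdot>\<^sub>m (A :: 'a::field mat) = A"
  by (intro eq_matI) auto

abbreviation symm_mats :: "nat \<Rightarrow> 'a::field mat set" where
  "symm_mats m \<equiv> {Y \<in> carrier_mat m m. transpose_mat Y = Y}"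

lemma border_carrier: assumes "v \<in> carrier_mat 1 m" "Y \<in> carrier_mat m m" shows "border s v Y \<in> carrier_mat (Suc m) (Suc m)"
proof -
  have "border s v Y \<in> carrier_mat (1 + m) (1 + m)" by (rule four_block_carrier_mat) (use assms in auto)
  then show ?thesis by simp
qed

lemma det_border_zero:
  assumes "Y \<in> carrier_mat m m"
  shows "det (border s (0\<^sub>m 1 m) Y) = (0 :: 'a::field)"
proof -
  have "det (border s (0\<^sub>m 1 m) Y) = det (0\<^sub>m 1 1) * det Y"
    by (rule det_four_block_mat_upper_right_zero[OF _ refl _ assms]) simp_all
  then show ?thesis by (simp add: det_single)
qed

text \<open>With first row \<open>unit_row\<close>, the hook formula removes the first two rows and
  columns, so that \<open>b\<close>, \<open>c\<close> and \<open>d\<close> drop out.\<close>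

lemma det_border_unit_row:
  fixes b :: "'a::field mat"
  assumes "b \<in> carrier_mat 1 1" "c \<in> carrier_mat 1 k" "d \<in> carrier_mat k 1" "Z \<in> carrier_mat k k"
  shows "det (border s (unit_row (Suc k)) (four_block_mat b c d Z)) = - s * det Z"
proof -
  let ?Y = "four_block_mat b c d Z"
  let ?X = "border s (unit_row (Suc k)) ?Y"
  have Y: "?Y \<in> carrier_mat (Suc k) (Suc k)" using four_block_carrier_mat[OF assms(1,4)] by simp
  have X: "?X \<in> carrier_mat (Suc (Suc k)) (Suc (Suc k))" by (rule border_carrier[OF unit_row_carrier(1) Y])
  have "mat k k (\<lambda>(i, j). ?X $$ (Suc (Suc i), Suc (Suc j))) = Z"
    using assms Y by (intro eq_matI) auto
  moreover have "?X $$ (0, j) = (if j = 1 then 1 else 0)" if "j < Suc (Suc k)" for j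
    using that Y by (cases j) auto
  moreover have "?X $$ (i, 0) = (if i = 1 then s else 0)" if "i < Suc (Suc k)" for i
    using that Y by (cases i) auto
  ultimately show ?thesis using det_hook[OF X, of s] by simp
qed

lemma card_symm_border:
  "card {Y \<in> symm_mats (Suc k). det (border 1 (unit_row (Suc k)) Y :: 'a::{field,finite} mat) \<noteq> 0} =
    CARD('a) ^ Suc k * card (forms (1\<^sub>m k :: 'a mat))"
proof -
  let ?f = "\<lambda>(b, c, Z). four_block_mat b c (transpose_mat c) Z :: 'a mat"
  have sym: "transpose_mat b = b" if "b \<in> carrier_mat 1 1" for b :: "'a mat"
    using that by (intro eq_matI) auto
  have "bij_betw ?f (carrier_mat 1 1 \<times> carrier_mat 1 k \<times> forms (1\<^sub>m k))
    {Y \<in> symm_mats (Suc k). det (border 1 (unit_row (Suc k)) Y) \<noteq> 0}" (is "bij_betw _ ?D ?R")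
    unfolding bij_betw_def
  proof
    show "inj_on ?f ?D"
      by (rule inj_onI) (auto simp: forms_one four_block_mat_inject[of _ 1 1 _ k _ k])
    show "?f ` ?D = ?R"
    proof (intro equalityI subsetI)
      fix Y assume "Y \<in> ?f ` ?D"
      then obtain b c Z where bcZ: "b \<in> carrier_mat 1 1" "c \<in> carrier_mat 1 k" "Z \<in> carrier_mat k k" "det Z \<noteq> 0"
        "transpose_mat Z = Z" "Y = four_block_mat b c (transpose_mat c) Z" by (auto simp: forms_one)
      have "Y \<in> carrier_mat (Suc k) (Suc k)" using four_block_carrier_mat[OF bcZ(1,3)] bcZ(6) by simp
      moreover have "transpose_mat Y = Y" unfolding bcZ(6)
        by (subst transpose_four_block_mat[of _ 1 1 _ k _ k]) (use bcZ sym in auto)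
      ultimately show "Y \<in> ?R" using det_border_unit_row[OF bcZ(1,2) _ bcZ(3), of "transpose_mat c" 1] bcZ by simp
    next
      fix Y assume "Y \<in> ?R"
      then have Y: "Y \<in> carrier_mat (1 + k) (1 + k)" "transpose_mat Y = Y" "det (border 1 (unit_row (Suc k)) Y) \<noteq> 0" by auto
      from four_block_matE[OF Y(1)] obtain b c d Z where
        b: "b \<in> carrier_mat 1 1" "c \<in> carrier_mat 1 k" "d \<in> carrier_mat k 1" "Z \<in> carrier_mat k k" "Y = four_block_mat b c d Z" by blast
      have "d = transpose_mat c \<and> transpose_mat Z = Z"
        using Y(2) unfolding b(5) transpose_four_block_mat[OF b(1-4)]
        by (subst (asm) four_block_mat_inject[of _ 1 1 _ k _ k]) (use b in auto)
      moreover have "det Z \<noteq> 0" using Y(3) det_border_unit_row[OF b(1-4), of 1] b(5) by simp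
      ultimately show "Y \<in> ?f ` ?D" using b by (intro image_eqI[of _ _ "(b, c, Z)"]) (auto simp: forms_one)
    qed
  qed
  from bij_betw_same_card[OF this] show ?thesis by (simp add: card_cartesian_product card_carrier_mat)
qed

lemma congruence_transpose:
  fixes P Y :: "'a::field mat"
  assumes "P \<in> carrier_mat n n" "Y \<in> carrier_mat n n"
  shows "transpose_mat (transpose_mat P * Y * P) = transpose_mat P * transpose_mat Y * P"
  using assms by (simp add: transpose_mult[of _ n n _ n] mult_carrier_mat[of _ n n] assoc_mult_mat[of _ n n _ n _ n])

text \<open>A zero in the top left corner forces the rest \<open>v\<close> of the first row to be
  nonzero. All nonzero \<open>v\<close> allow equally many completions, so \<open>v\<close> may be
  taken to be \<open>unit_row\<close>, where the hook formula leaves a symmetric matrix two sizes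
  smaller.\<close>

lemma card_symm_isotropic:
  "card {X \<in> forms (1\<^sub>m (Suc (Suc k)) :: 'a::{field,finite} mat). \<not> pivot_block 1 X} =
    (CARD('a) ^ Suc k - 1) * (CARD('a) ^ Suc k * card (forms (1\<^sub>m k :: 'a mat)))"
proof -
  let ?m = "Suc k"
  let ?V = "{v \<in> carrier_mat 1 ?m. v \<noteq> (0\<^sub>m 1 ?m :: 'a mat)}"
  let ?Y = "\<lambda>v. {Y \<in> symm_mats ?m. det (border 1 v Y :: 'a mat) \<noteq> 0}"
  let ?f = "\<lambda>(v, Y). border 1 v Y :: 'a mat"
  have "bij_betw ?f (Sigma ?V ?Y) {X \<in> forms (1\<^sub>m (Suc ?m)). \<not> pivot_block 1 X}" (is "bij_betw _ ?D ?R")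
    unfolding bij_betw_def
  proof
    show "inj_on ?f ?D"
      by (rule inj_onI) (auto simp: four_block_mat_inject[of _ 1 1 _ ?m _ ?m])
    show "?f ` ?D = ?R"
    proof (intro equalityI subsetI)
      fix X assume "X \<in> ?f ` ?D"
      then obtain v Y where vY: "v \<in> carrier_mat 1 ?m" "Y \<in> carrier_mat ?m ?m" "transpose_mat Y = Y"
        "det (border 1 v Y) \<noteq> 0" "X = border 1 v Y" by auto
      have "transpose_mat X = X" unfolding vY(5)
        by (subst transpose_four_block_mat[of _ 1 1 _ ?m _ ?m]) (use vY in auto)
      moreover have "\<not> pivot_block 1 X" unfolding vY(5)
        by (subst pivot_block_four_block_mat[of _ 1 _ ?m]) (use vY in \<open>auto simp: det_single\<close>)
      ultimately show "X \<in> ?R" using border_carrier[OF vY(1,2), of 1] vY by (simp add: forms_one)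
    next
      fix X assume "X \<in> ?R"
      then have X: "X \<in> carrier_mat (1 + ?m) (1 + ?m)" "transpose_mat X = X" "det X \<noteq> 0" "\<not> pivot_block 1 X"
        by (auto simp: forms_one)
      from four_block_matE[OF X(1)] obtain a v w Y where
        b: "a \<in> carrier_mat 1 1" "v \<in> carrier_mat 1 ?m" "w \<in> carrier_mat ?m 1" "Y \<in> carrier_mat ?m ?m"
        "X = four_block_mat a v w Y" by blast
      have w: "w = transpose_mat v" and Y: "transpose_mat Y = Y"
        using X(2) unfolding b(5) transpose_four_block_mat[OF b(1-4)]
        by (subst (asm) four_block_mat_inject[of _ 1 1 _ ?m _ ?m]; use b in auto)+
      have "a $$ (0, 0) = 0" using X(4) b(1) unfolding b(5) pivot_block_four_block_mat[OF b(1,4)]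
        by (simp add: det_single)
      then have a: "a = 0\<^sub>m 1 1" using b(1) by (intro eq_matI) auto
      have Xf: "X = ?f (v, Y)" using b(5) a w by (simp add: one_smult)
      have "v \<noteq> 0\<^sub>m 1 ?m"
      proof
        assume "v = 0\<^sub>m 1 ?m"
        then have "det X = 0" using det_border_zero[OF b(4), of 1] Xf by simp
        then show False using X(3) by simp
      qed
      then show "X \<in> ?f ` ?D" using Xf b Y X(3) by (intro image_eqI[of _ _ "(v, Y)"]) auto
    qed
  qed
  then have "card ?R = card (Sigma ?V ?Y)" by (rule bij_betw_same_card[symmetric])
  also have "\<dots> = (\<Sum>v\<in>?V. card (?Y v))"
    by (rule card_SigmaI) (auto intro: finite_mats[of _ 1 ?m] finite_mats[of _ ?m ?m])
  also have "\<dots> = (\<Sum>v\<in>?V. CARD('a) ^ Suc k * card (forms (1\<^sub>m k :: 'a mat)))"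
  proof (intro sum.cong refl)
    fix v assume "v \<in> ?V"
    then have v: "v \<in> carrier_mat 1 ?m" "v \<noteq> 0\<^sub>m 1 ?m" by auto
    have "card {Y \<in> symm_mats ?m. det (border 1 v Y) \<noteq> 0} =
      card {Y \<in> symm_mats ?m. det (border 1 (unit_row ?m :: 'a mat) Y) \<noteq> 0}"
      by (rule card_border_eq[OF v, of "symm_mats ?m" "\<lambda>Y. Y" 1]) (auto simp: congruence_transpose)
    then show "card (?Y v) = CARD('a) ^ Suc k * card (forms (1\<^sub>m k :: 'a mat))"
      using card_symm_border[of k, where ?'a = 'a] by simp
  qed
  finally show ?thesis by (simp add: card_carrier_mat_nonzero)
qed

text \<open>The Schur count for the splitting of the identity into sizes 1 and \<open>m\<close>: a
  nonzero pivot, a free row, and a symmetric Schur complement.\<close>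

lemma card_symm_anisotropic:
  "card {X \<in> forms (1\<^sub>m (Suc m) :: 'a::{field,finite} mat). pivot_block 1 X} =
    (CARD('a) - 1) * CARD('a) ^ m * card (forms (1\<^sub>m m :: 'a mat))"
proof -
  have "{Q \<in> carrier_mat 1 m. Q = 1\<^sub>m 1 * Q * transpose_mat (1\<^sub>m m)} = (carrier_mat 1 m :: 'a mat set)"
    by auto
  then show ?thesis
    using card_forms_schur[of "1\<^sub>m 1 :: 'a mat" 1 "1\<^sub>m m" m] card_forms_one_1[where ?'a = 'a]
    by (simp add: card_carrier_mat)
qed

lemma finite_forms: "finite (forms h :: 'a::{field,finite} mat set)"
  by (rule finite_mats[of _ "dim_row h" "dim_row h"]) (auto simp: forms_def)

lemma card_symm_Suc_Suc:
  "card (forms (1\<^sub>m (Suc (Suc k)) :: 'a::{field,finite} mat)) =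
    (CARD('a) - 1) * CARD('a) ^ Suc k * card (forms (1\<^sub>m (Suc k) :: 'a mat)) +
    (CARD('a) ^ Suc k - 1) * (CARD('a) ^ Suc k * card (forms (1\<^sub>m k :: 'a mat)))"
proof -
  let ?F = "forms (1\<^sub>m (Suc (Suc k)) :: 'a mat)"
  have "?F = {X \<in> ?F. pivot_block 1 X} \<union> {X \<in> ?F. \<not> pivot_block 1 X}" by blast
  then have "card ?F = card {X \<in> ?F. pivot_block 1 X} + card {X \<in> ?F. \<not> pivot_block 1 X}"
    using finite_forms[of "1\<^sub>m (Suc (Suc k)) :: 'a mat"]
      card_Un_disjoint[of "{X \<in> ?F. pivot_block 1 X}" "{X \<in> ?F. \<not> pivot_block 1 X}"] by auto
  then show ?thesis using card_symm_anisotropic[of "Suc k", where ?'a = 'a] card_symm_isotropic[of k, where ?'a = 'a] by simp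
qed

lemma card_symm_0: "card (forms (1\<^sub>m 0 :: 'a::field mat)) = 1"
proof -
  have "forms (1\<^sub>m 0 :: 'a mat) = {1\<^sub>m 0}" by (auto simp: forms_one intro!: eq_matI)
  then show ?thesis by simp
qed

abbreviation asym_mats :: "nat \<Rightarrow> 'a::field mat set" where
  "asym_mats m \<equiv> {A \<in> carrier_mat m m. det (A - transpose_mat A) \<noteq> 0}"

lemma four_block_minus_transpose:
  fixes a :: "'a::field mat"
  assumes "a \<in> carrier_mat 1 1" "u \<in> carrier_mat 1 m" "w \<in> carrier_mat m 1" "B \<in> carrier_mat m m"
  shows "four_block_mat a u w B - transpose_mat (four_block_mat a u w B) =
    border (- 1) (u - transpose_mat w) (B - transpose_mat B)"
  by (rule eq_matI) (use assms in auto)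

text \<open>The blocks \<open>b\<close>, \<open>c\<close> and \<open>d\<close> are free, with
  \<open>1 + k + k\<close> entries; only the difference \<open>Z - Z'\<close> has to be
  invertible.\<close>

lemma card_asym_border:
  "card {Y \<in> carrier_mat (Suc k) (Suc k). det (border (- 1) (unit_row (Suc k)) (Y - transpose_mat Y) :: 'a::{field,finite} mat) \<noteq> 0} =
    CARD('a) ^ (2 * k + 1) * card (asym_mats k :: 'a mat set)"
proof -
  let ?f = "\<lambda>(b, c, d, Z). four_block_mat b c d Z :: 'a mat"
  have det: "det (border (- 1) (unit_row (Suc k)) (Y - transpose_mat Y)) = det (Z - transpose_mat Z)"
    if "b \<in> carrier_mat 1 1" "c \<in> carrier_mat 1 k" "d \<in> carrier_mat k 1" "Z \<in> carrier_mat k k" "Y = four_block_mat b c d Z"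
    for b c d Z Y :: "'a mat"
    unfolding that(5) four_block_minus_transpose[OF that(1-4)]
    by (subst det_border_unit_row[where k = k]) (use that in \<open>auto intro: minus_carrier_mat\<close>)
  have "bij_betw ?f (carrier_mat 1 1 \<times> carrier_mat 1 k \<times> carrier_mat k 1 \<times> asym_mats k)
    {Y \<in> carrier_mat (Suc k) (Suc k). det (border (- 1) (unit_row (Suc k)) (Y - transpose_mat Y)) \<noteq> 0}" (is "bij_betw _ ?D ?R")
    unfolding bij_betw_def
  proof
    show "inj_on ?f ?D"
      by (rule inj_onI) (auto simp: four_block_mat_inject[of _ 1 1 _ k _ k])
    show "?f ` ?D = ?R"
    proof (intro equalityI subsetI)
      fix Y assume "Y \<in> ?f ` ?D"
      then obtain b c d Z where b: "b \<in> carrier_mat 1 1" "c \<in> carrier_mat 1 k" "d \<in> carrier_mat k 1" "Z \<in> carrier_mat k k"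
        "Y = four_block_mat b c d Z" and dZ: "det (Z - transpose_mat Z) \<noteq> 0" by auto
      have "Y \<in> carrier_mat (Suc k) (Suc k)" using four_block_carrier_mat[OF b(1,4)] b(5) by simp
      then show "Y \<in> ?R" using det[OF b] dZ by simp
    next
      fix Y assume "Y \<in> ?R"
      then have Y: "Y \<in> carrier_mat (1 + k) (1 + k)" "det (border (- 1) (unit_row (Suc k)) (Y - transpose_mat Y)) \<noteq> 0" by auto
      from four_block_matE[OF Y(1)] obtain b c d Z where
        b: "b \<in> carrier_mat 1 1" "c \<in> carrier_mat 1 k" "d \<in> carrier_mat k 1" "Z \<in> carrier_mat k k" "Y = four_block_mat b c d Z" by blast
      then show "Y \<in> ?f ` ?D" using det[OF b] Y(2) by (intro image_eqI[of _ _ "(b, c, d, Z)"]) auto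
    qed
  qed
  from bij_betw_same_card[OF this] show ?thesis
    by (simp add: card_cartesian_product card_carrier_mat power_add mult_2 mult.assoc)
qed

text \<open>The diagonal of \<open>A - A'\<close> is zero, so there is no anisotropic term. The
  first row is written as \<open>v + w'\<close>, where \<open>v\<close> is the part of it seen by
  \<open>A - A'\<close>; then \<open>a\<close> and \<open>w\<close> are free, which gives
  \<open>k + 2\<close> entries, and \<open>v\<close> must be nonzero.\<close>

lemma card_asym_Suc_Suc:
  "card (asym_mats (Suc (Suc k)) :: 'a::{field,finite} mat set) =
    CARD('a) ^ (k + 2) * (CARD('a) ^ Suc k - 1) * (CARD('a) ^ (2 * k + 1) * card (asym_mats k :: 'a mat set))"
proof -
  let ?m = "Suc k"
  let ?V = "{v \<in> carrier_mat 1 ?m. v \<noteq> (0\<^sub>m 1 ?m :: 'a mat)}"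
  let ?Y = "\<lambda>v. {Y \<in> carrier_mat ?m ?m. det (border (- 1) v (Y - transpose_mat Y) :: 'a mat) \<noteq> 0}"
  let ?f = "\<lambda>(a, w, v, Y). four_block_mat a (v + transpose_mat w) w Y :: 'a mat"
  let ?D = "(carrier_mat 1 1 :: 'a mat set) \<times> (carrier_mat ?m 1 :: 'a mat set) \<times> Sigma ?V ?Y"
  have det: "det (X - transpose_mat X) = det (border (- 1) v (Y - transpose_mat Y))"
    if "a \<in> carrier_mat 1 1" "v \<in> carrier_mat 1 ?m" "w \<in> carrier_mat ?m 1" "Y \<in> carrier_mat ?m ?m"
      "X = ?f (a, w, v, Y)" for a v w Y X
  proof -
    have "v + transpose_mat w - transpose_mat w = v" using that by (intro eq_matI) auto
    then show ?thesis unfolding that(5) prod.case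
      by (subst four_block_minus_transpose[of _ _ ?m]) (use that in auto)
  qed
  have "bij_betw ?f ?D (asym_mats (Suc ?m))"
    unfolding bij_betw_def
  proof
    show "inj_on ?f ?D"
    proof (rule inj_onI)
      fix x y assume xy: "x \<in> ?D" "y \<in> ?D" "?f x = ?f y"
      obtain a w v Y a' w' v' Y' where x: "x = (a, w, v, Y)" and y: "y = (a', w', v', Y')" by (cases x, cases y)
      have c: "a \<in> carrier_mat 1 1" "w \<in> carrier_mat ?m 1" "v \<in> carrier_mat 1 ?m" "Y \<in> carrier_mat ?m ?m"
        "a' \<in> carrier_mat 1 1" "w' \<in> carrier_mat ?m 1" "v' \<in> carrier_mat 1 ?m" "Y' \<in> carrier_mat ?m ?m"
        using xy unfolding x y by auto
      have "a = a' \<and> v + transpose_mat w = v' + transpose_mat w' \<and> w = w' \<and> Y = Y'"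
        using xy(3) unfolding x y prod.case
        by (subst (asm) four_block_mat_inject[of _ 1 1 _ ?m _ ?m]) (use c in auto)
      then show "x = y" unfolding x y using add_eq_add_mat_iff[of v 1 ?m v' "transpose_mat w'"] c by auto
    qed
    show "?f ` ?D = asym_mats (Suc ?m)"
    proof (intro equalityI subsetI)
      fix X assume "X \<in> ?f ` ?D"
      then obtain a w v Y where c: "a \<in> carrier_mat 1 1" "v \<in> carrier_mat 1 ?m" "w \<in> carrier_mat ?m 1"
        "Y \<in> carrier_mat ?m ?m" "X = ?f (a, w, v, Y)" and d: "det (border (- 1) v (Y - transpose_mat Y)) \<noteq> 0" by auto
      have "X \<in> carrier_mat (Suc ?m) (Suc ?m)" using four_block_carrier_mat[OF c(1,4)] c(5) by simp
      then show "X \<in> asym_mats (Suc ?m)" using det[OF c] d by simp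
    next
      fix X :: "'a mat" assume "X \<in> asym_mats (Suc ?m)"
      then have X: "X \<in> carrier_mat (1 + ?m) (1 + ?m)" "det (X - transpose_mat X) \<noteq> 0" by auto
      from four_block_matE[OF X(1)] obtain a u w Y where
        b: "a \<in> carrier_mat 1 1" "u \<in> carrier_mat 1 ?m" "w \<in> carrier_mat ?m 1" "Y \<in> carrier_mat ?m ?m"
        "X = four_block_mat a u w Y" by blast
      let ?v = "u - transpose_mat w"
      have v: "?v \<in> carrier_mat 1 ?m" using b by (auto intro: minus_carrier_mat)
      have "?v + transpose_mat w = u" using b by (intro minus_add_cancel_mat_carrier) auto
      then have Xf: "X = ?f (a, w, ?v, Y)" using b(5) by simp
      note d = det[OF b(1) v b(3,4) Xf]
      have "Y - transpose_mat Y \<in> carrier_mat ?m ?m" using b(4) by (auto intro: minus_carrier_mat)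
      then have "?v \<noteq> 0\<^sub>m 1 ?m" using d X(2) det_border_zero[of "Y - transpose_mat Y" ?m "- 1"] by auto
      then show "X \<in> ?f ` ?D" by (intro image_eqI[of _ _ "(a, w, ?v, Y)"]) (use Xf b v d X(2) in auto)
    qed
  qed
  then have "card (asym_mats (Suc ?m) :: 'a mat set) = card ?D" by (rule bij_betw_same_card[symmetric])
  also have "\<dots> = CARD('a) ^ (k + 2) * card (Sigma ?V ?Y)"
    by (simp add: card_cartesian_product card_carrier_mat)
  also have "card (Sigma ?V ?Y) = (\<Sum>v\<in>?V. card (?Y v))"
    by (rule card_SigmaI) (auto intro: finite_mats[of _ 1 ?m] finite_mats[of _ ?m ?m])
  also have "\<dots> = (\<Sum>v\<in>?V. CARD('a) ^ (2 * k + 1) * card (asym_mats k :: 'a mat set))"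
  proof (intro sum.cong refl)
    fix v assume "v \<in> ?V"
    then have v: "v \<in> carrier_mat 1 ?m" "v \<noteq> 0\<^sub>m 1 ?m" by auto
    have "card (?Y v) = card (?Y (unit_row ?m))"
    proof (rule card_border_eq[OF v, of "carrier_mat ?m ?m" "\<lambda>Y. Y - transpose_mat Y" "- 1"])
      fix P Y :: "'a mat" assume PY: "P \<in> carrier_mat ?m ?m" "Y \<in> carrier_mat ?m ?m"
      show "transpose_mat P * Y * P - transpose_mat (transpose_mat P * Y * P) = transpose_mat P * (Y - transpose_mat Y) * P"
        unfolding congruence_transpose[OF PY] using PY by (simp add: mult_minus_distrib_mat[of _ ?m ?m _ ?m]
            minus_mult_distrib_mat[of _ ?m ?m _ _ ?m] mult_carrier_mat[of _ ?m ?m])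
    qed (auto intro: minus_carrier_mat)
    then show "card (?Y v) = CARD('a) ^ (2 * k + 1) * card (asym_mats k :: 'a mat set)"
      using card_asym_border[of k, where ?'a = 'a] by simp
  qed
  finally show ?thesis by (simp add: card_carrier_mat_nonzero mult.assoc)
qed

lemma card_asym_0: "card (asym_mats 0 :: 'a::field mat set) = 1"
proof -
  have d: "det (A - transpose_mat A) = 1" if "A \<in> carrier_mat 0 0" for A :: "'a mat"
    using that by (intro det_dim_zero minus_carrier_mat) simp
  then have "asym_mats 0 = {1\<^sub>m 0 :: 'a mat}" using d[of "1\<^sub>m 0"] by (auto intro!: eq_matI)
  then show ?thesis by simp
qed

lemma asym_mats_1: "asym_mats (Suc 0) = ({} :: 'a::field mat set)"
proof -
  have "det (A - transpose_mat A) = 0" if "A \<in> carrier_mat 1 1" for A :: "'a mat"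
    using that by (subst det_single) (auto intro: minus_carrier_mat)
  then show ?thesis by auto
qed

section \<open>Closed forms\<close>

definition phi :: "real \<Rightarrow> nat \<Rightarrow> real" where
  "phi q m = (\<Prod>j = 1..m div 2. 1 - 1 / q ^ (2 * j))"

lemma phi_0 [simp]: "phi q 0 = 1" and phi_1 [simp]: "phi q (Suc 0) = 1"
  by (simp_all add: phi_def)

lemma phi_Suc_even: "even m \<Longrightarrow> phi q (Suc m) = phi q m"
  by (simp add: phi_def)

lemma phi_Suc_Suc: "even m \<Longrightarrow> phi q (Suc (Suc m)) = phi q m * (1 - 1 / q ^ (m + 2))"
  by (auto simp: phi_def elim!: evenE)

lemma phi_nonzero: assumes "q > 1" shows "phi q m \<noteq> 0"
proof -
  have "1 - 1 / q ^ (2 * j) \<noteq> 0" if "j \<in> {1..m div 2}" for j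
  proof -
    have "1 < q ^ (2 * j)" using that assms by (intro one_less_power) auto
    then show ?thesis by simp
  qed
  then show ?thesis unfolding phi_def using prod_zero_iff[of "{1..m div 2}" "\<lambda>j. 1 - 1 / q ^ (2 * j)"] by blast
qed

lemma card_inv_mats_0: "card (inv_mats 0 :: 'a::field mat set) = 1"
proof -
  have "inv_mats 0 = {1\<^sub>m 0 :: 'a mat}" by (auto intro!: eq_matI)
  then show ?thesis by simp
qed

lemma real_card_inv_mats_Suc:
  "real (card (inv_mats (Suc m) :: 'a::{field,finite} mat set)) =
    (real CARD('a) ^ Suc m - 1) * real CARD('a) ^ m * real (card (inv_mats m :: 'a mat set))"
proof -
  have "1 \<le> CARD('a) ^ Suc m" using card_GT_1[where ?'a = 'a] by simp
  then show ?thesis unfolding card_inv_mats_Suc by (simp add: of_nat_diff)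
qed

lemma card_inv_mats_pos: "card (inv_mats m :: 'a::{field,finite} mat set) > 0"
proof -
  have "1\<^sub>m m \<in> (inv_mats m :: 'a mat set)" by simp
  moreover have "finite (inv_mats m :: 'a mat set)" by (rule finite_mats[of _ m m]) auto
  ultimately show ?thesis unfolding card_gt_0_iff by blast
qed

lemma Suc_choose_two: "Suc m choose 2 = m + (m choose 2)"
  by (simp add: numeral_2_eq_2)

text \<open>The closed form is stated as a ratio to the order of \<open>GL(m,q)\<close>, because
  that order will cancel against the centralizer.\<close>

lemma card_symm_closed_form:
  defines "q \<equiv> real CARD('a::{field,finite})"
  shows "real (card (forms (1\<^sub>m m :: 'a mat))) * q ^ (m choose 2) * phi q m = real (card (inv_mats m :: 'a mat set))"
proof -
  let ?s = "\<lambda>m. real (card (forms (1\<^sub>m m :: 'a mat)))" and ?g = "\<lambda>m. real (card (inv_mats m :: 'a mat set))"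
  have q: "q > 1" using card_GT_1[where ?'a = 'a] by (simp add: q_def)
  have s: "?s (Suc (Suc k)) = (q - 1) * q ^ Suc k * ?s (Suc k) + (q ^ Suc k - 1) * q ^ Suc k * ?s k" for k
  proof -
    have "1 \<le> CARD('a) ^ Suc k" "1 \<le> CARD('a)" using card_GT_1[where ?'a = 'a] by simp_all
    then show ?thesis unfolding card_symm_Suc_Suc q_def by (simp add: of_nat_diff)
  qed
  have g: "?g (Suc k) = (q ^ Suc k - 1) * q ^ k * ?g k" for k
    unfolding q_def by (rule real_card_inv_mats_Suc)
  \<comment> \<open>The recursion reaches back two steps, so two consecutive cases are proved
    together.\<close>
  have "?s m * q ^ (m choose 2) * phi q m = ?g m \<and> ?s (Suc m) * q ^ (Suc m choose 2) * phi q (Suc m) = ?g (Suc m)"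
  proof (induction m)
    case 0
    have "1 \<le> CARD('a)" using card_GT_1[where ?'a = 'a] by simp
    then have "?s (Suc 0) = q - 1" using card_forms_one_1[where ?'a = 'a] by (simp add: q_def of_nat_diff)
    then show ?case using g[of 0] by (simp add: card_symm_0 card_inv_mats_0 binomial_eq_0)
  next
    case (Suc k)
    let ?x = "q ^ k"
    have x: "?x \<noteq> 0" using q by simp
    have IH: "?s k * q ^ (k choose 2) * phi q k = ?g k" "?s (Suc k) * q ^ (Suc k choose 2) * phi q (Suc k) = ?g (Suc k)"
      using Suc by auto
    \<comment> \<open>The product \<open>phi\<close> grows only when its argument becomes even. For
      even \<open>k\<close> the new factor \<open>1 - 1 / q ^ (k + 2)\<close> multiplies both
      summands; for odd \<open>k\<close> the new factor \<open>1 - 1 / q ^ Suc k\<close> already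
      separates \<open>phi q (Suc k)\<close> from \<open>phi q k\<close> and affects only the second
      summand.\<close>
    have "?s (Suc (Suc k)) * q ^ (Suc (Suc k) choose 2) * phi q (Suc (Suc k)) = ?g (Suc (Suc k))"
    proof (cases "even k")
      case True
      have "?s (Suc (Suc k)) * q ^ (Suc (Suc k) choose 2) * phi q (Suc (Suc k)) =
        (1 - 1 / q ^ (k + 2)) * ((q - 1) * q ^ Suc k * q ^ Suc k * (?s (Suc k) * q ^ (Suc k choose 2) * phi q (Suc k)) +
          (q ^ Suc k - 1) * q ^ Suc k * (q ^ Suc k * ?x) * (?s k * q ^ (k choose 2) * phi q k))"
        using True by (simp add: s phi_Suc_even phi_Suc_Suc Suc_choose_two power_add algebra_simps)
      also have "\<dots> = (1 - 1 / q ^ (k + 2)) * ((q - 1) * q ^ Suc k * q ^ Suc k * ?g (Suc k) + q ^ Suc k * q ^ Suc k * ?g (Suc k))"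
        unfolding IH by (simp add: g[of k] algebra_simps)
      also have "\<dots> = (q ^ (k + 2) - 1) * q ^ Suc k * ?g (Suc k)"
        using x q by (simp add: field_simps)
      finally show ?thesis by (simp only: g[of "Suc k"] add_2_eq_Suc')
    next
      case False
      then have ph: "phi q (Suc (Suc k)) = phi q (Suc k)" "phi q (Suc k) = phi q k * (1 - 1 / q ^ Suc k)"
        using phi_Suc_even[of "Suc k" q] phi_Suc_Suc[of "k - 1" q] phi_Suc_even[of "k - 1" q] by (cases k; simp)+
      have "?s (Suc (Suc k)) * q ^ (Suc (Suc k) choose 2) * phi q (Suc (Suc k)) =
        (q - 1) * q ^ Suc k * q ^ Suc k * (?s (Suc k) * q ^ (Suc k choose 2) * phi q (Suc k)) +
          (1 - 1 / q ^ Suc k) * ((q ^ Suc k - 1) * q ^ Suc k * (q ^ Suc k * ?x) * (?s k * q ^ (k choose 2) * phi q k))"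
        by (simp add: s ph Suc_choose_two power_add algebra_simps)
      also have "\<dots> = (q - 1) * q ^ Suc k * q ^ Suc k * ?g (Suc k) + (1 - 1 / q ^ Suc k) * (q ^ Suc k * q ^ Suc k * ?g (Suc k))"
        unfolding IH by (simp add: g[of k] algebra_simps)
      also have "\<dots> = (q ^ (k + 2) - 1) * q ^ Suc k * ?g (Suc k)"
        using x q by (simp add: field_simps)
      finally show ?thesis by (simp only: g[of "Suc k"] add_2_eq_Suc')
    qed
    then show ?case using Suc by blast
  qed
  then show ?thesis by blast
qed

text \<open>No power of \<open>q\<close> appears in contrast to the symmetric case: the symmetric
  part of \<open>A\<close>, which \<open>A - A'\<close> does not see, is counted too.\<close>

lemma card_asym_closed_form:
  defines "q \<equiv> real CARD('a::{field,finite})"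
  assumes "even m"
  shows "real (card (asym_mats m :: 'a mat set)) * phi q m = real (card (inv_mats m :: 'a mat set))"
proof -
  let ?t = "\<lambda>m. real (card (asym_mats m :: 'a mat set))" and ?g = "\<lambda>m. real (card (inv_mats m :: 'a mat set))"
  have q: "q > 1" using card_GT_1[where ?'a = 'a] by (simp add: q_def)
  have t: "?t (Suc (Suc k)) = q ^ (k + 2) * (q ^ Suc k - 1) * q ^ (2 * k + 1) * ?t k" for k
  proof -
    have "1 \<le> CARD('a) ^ Suc k" using card_GT_1[where ?'a = 'a] by simp
    then show ?thesis unfolding card_asym_Suc_Suc q_def by (simp add: of_nat_diff)
  qed
  have g: "?g (Suc k) = (q ^ Suc k - 1) * q ^ k * ?g k" for k
    unfolding q_def by (rule real_card_inv_mats_Suc)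
  have "?t (2 * l) * phi q (2 * l) = ?g (2 * l)" for l
  proof (induction l)
    case 0
    show ?case by (simp add: card_asym_0 card_inv_mats_0)
  next
    case (Suc l)
    let ?k = "2 * l"
    have x: "q ^ ?k \<noteq> 0" using q by simp
    have "?t (Suc (Suc ?k)) * phi q (Suc (Suc ?k)) =
      q ^ (?k + 2) * (q ^ Suc ?k - 1) * q ^ (2 * ?k + 1) * (1 - 1 / q ^ (?k + 2)) * (?t ?k * phi q ?k)"
      by (simp add: t phi_Suc_Suc)
    also have "\<dots> = (q ^ Suc (Suc ?k) - 1) * q ^ Suc ?k * ((q ^ Suc ?k - 1) * q ^ ?k * ?g ?k)"
    proof -
      have "q ^ (?k + 2) * (1 - 1 / q ^ (?k + 2)) = q ^ Suc (Suc ?k) - 1" using q by (simp add: field_simps)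
      moreover have "q ^ (2 * ?k + 1) = q ^ Suc ?k * q ^ ?k" by (simp add: power_add[symmetric])
      moreover have "q ^ (?k + 2) * (q ^ Suc ?k - 1) * q ^ (2 * ?k + 1) * (1 - 1 / q ^ (?k + 2)) * ?g ?k =
        q ^ (?k + 2) * (1 - 1 / q ^ (?k + 2)) * (q ^ Suc ?k - 1) * q ^ (2 * ?k + 1) * ?g ?k"
        by (simp only: mult.assoc mult.left_commute mult.commute)
      ultimately show ?thesis unfolding Suc by (simp only: mult.assoc mult.left_commute mult.commute)
    qed
    also have "\<dots> = ?g (Suc (Suc ?k))" by (simp only: g)
    finally show ?case by simp
  qed
  from this[of "m div 2"] assms show ?thesis by simp
qed

lemma card_asym_odd: "odd m \<Longrightarrow> card (asym_mats m :: 'a::{field,finite} mat set) = 0"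
proof -
  assume "odd m"
  then obtain l where m: "m = Suc (2 * l)" by (auto elim: oddE)
  have "card (asym_mats (Suc (2 * l)) :: 'a mat set) = 0"
  proof (induction l)
    case 0
    show ?case by (simp add: asym_mats_1 del: One_nat_def)
  next
    case (Suc l)
    have "card (asym_mats (Suc (Suc (Suc (2 * l)))) :: 'a mat set) = 0" unfolding card_asym_Suc_Suc Suc by simp
    then show ?case by simp
  qed
  then show ?thesis using m by simp
qed

text \<open>For \<open>h\<close> in \<open>GL n\<close> this is the proportion sought. Defined
  without reference to \<open>GL n\<close>, it can be computed summand by summand.\<close>

definition mass :: "'a::field mat \<Rightarrow> real" where
  "mass h = real (card (forms h)) / real (card (centralizer h))"

text \<open>The exponent \<open>(k - 1) * m * m\<close> of the centralizer minus the exponent gained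
  from free blocks \<open>A\<close> in the forms, plus \<open>m choose 2\<close> from the symmetric
  matrices when \<open>k\<close> is odd.\<close>

definition layer_exponent :: "nat \<Rightarrow> nat \<Rightarrow> nat" where
  "layer_exponent k m = k div 2 * (m * m) + (if odd k then m choose 2 else 0)"

lemma card_forms_shift_odd:
  "card (forms (shift_mat (Suc (2 * l)) m :: 'a::{field,finite} mat)) =
    CARD('a) ^ (l * (m * m)) * card (forms (1\<^sub>m m :: 'a mat))"
proof (induction l)
  case 0
  then show ?case by (simp add: shift_mat_one)
next
  case (Suc l)
  then show ?case using card_forms_shift_Suc_Suc[of "Suc (2 * l)" m, where ?'a = 'a] by (simp add: power_add mult.assoc)
qed

lemma card_forms_shift_even:
  "card (forms (shift_mat (2 + 2 * l) m :: 'a::{field,finite} mat)) =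
    CARD('a) ^ (l * (m * m)) * card (asym_mats m :: 'a mat set)"
proof (induction l)
  case 0
  then show ?case by (simp add: card_forms_shift_two)
next
  case (Suc l)
  then show ?case using card_forms_shift_Suc_Suc[of "2 + 2 * l" m, where ?'a = 'a] by (simp add: power_add mult.assoc)
qed

lemma mass_shift:
  defines "q \<equiv> real CARD('a::{field,finite})"
  assumes k: "0 < k"
  shows "mass (shift_mat k m :: 'a mat) = (if even k \<and> odd m then 0 else 1 / (q ^ layer_exponent k m * phi q m))"
proof -
  let ?g = "real (card (inv_mats m :: 'a mat set))"
  have q: "q > 1" using card_GT_1[where ?'a = 'a] by (simp add: q_def)
  have g: "?g \<noteq> 0" using card_inv_mats_pos[of m, where ?'a = 'a] by linarith
  note p = phi_nonzero[OF q, of m]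
  have C: "real (card (centralizer (shift_mat k m :: 'a mat))) = q ^ ((k - 1) * m * m) * ?g"
    using card_centralizer_shift[of "k - 1" m, where ?'a = 'a] k by (simp add: q_def)
  show ?thesis
  proof (cases "even k")
    case True
    then obtain l where l: "k = 2 + 2 * l" using k by (auto elim!: evenE) (metis Suc_pred add_2_eq_Suc mult_Suc_right)
    have N: "real (card (forms (shift_mat k m :: 'a mat))) = q ^ (l * (m * m)) * real (card (asym_mats m :: 'a mat set))"
      unfolding l card_forms_shift_even by (simp add: q_def)
    show ?thesis
    proof (cases "even m")
      case False
      then show ?thesis using True N card_asym_odd[of m, where ?'a = 'a] by (simp add: mass_def)
    next
      case even: True
      have t: "real (card (asym_mats m :: 'a mat set)) = ?g / phi q m"
        using card_asym_closed_form[OF even, where ?'a = 'a] p unfolding q_def by (simp add: field_simps)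
      have "(k - 1) * m * m = l * (m * m) + layer_exponent k m"
        unfolding l by (simp add: layer_exponent_def algebra_simps)
      then show ?thesis using even g p q unfolding mass_def N C t by (simp add: power_add field_simps)
    qed
  next
    case False
    then obtain l where l: "k = Suc (2 * l)" by (auto elim: oddE)
    have N: "real (card (forms (shift_mat k m :: 'a mat))) = q ^ (l * (m * m)) * real (card (forms (1\<^sub>m m :: 'a mat)))"
      unfolding l card_forms_shift_odd by (simp add: q_def)
    have t: "real (card (forms (1\<^sub>m m :: 'a mat))) = ?g / (q ^ (m choose 2) * phi q m)"
      using card_symm_closed_form[of m, where ?'a = 'a] p q unfolding q_def by (simp add: field_simps)
    have "(k - 1) * m * m + (m choose 2) = l * (m * m) + layer_exponent k m"
      unfolding l by (simp add: layer_exponent_def algebra_simps)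
    then have "q ^ ((k - 1) * m * m) * q ^ (m choose 2) = q ^ (l * (m * m)) * q ^ layer_exponent k m"
      by (simp only: power_add[symmetric])
    then show ?thesis using False g p q unfolding mass_def N C t by (simp add: field_simps)
  qed
qed

text \<open>Forms contribute \<open>q ^ (m * b)\<close> and centralizers its square, hence a single
  power in the denominator.\<close>

lemma mass_dsum_shift:
  fixes h :: "'a::{field,finite} mat"
  assumes h: "h \<in> carrier_mat b b" "det h \<noteq> 0"
    and nil: "(h - 1\<^sub>m b) ^\<^sub>m (k - 1) = 0\<^sub>m b b" and k: "0 < k"
  shows "mass (dsum (shift_mat k m) h) = mass (shift_mat k m :: 'a mat) * mass h / real CARD('a) ^ (m * b)"
proof -
  have "real CARD('a) ^ (m * b) \<noteq> 0" by simp
  then show ?thesis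
    unfolding mass_def card_forms_dsum_shift[OF h nil k] card_centralizer_dsum_shift[OF h(1) nil k]
    by (simp add: mult_2 power_add)
qed

section \<open>Unipotent Jordan matrices\<close>

lemma similar_mat_permute:
  fixes A B :: "'a::field mat"
  assumes A: "A \<in> carrier_mat n n" and B: "B \<in> carrier_mat n n"
    and p: "bij_betw p {..<n} {..<n}"
    and AB: "\<And>i j. i < n \<Longrightarrow> j < n \<Longrightarrow> A $$ (i, j) = B $$ (p i, p j)"
  shows "similar_mat A B"
proof -
  let ?P = "mat n n (\<lambda>(i, j). if p i = j then 1 else 0 :: 'a)"
  let ?Q = "mat n n (\<lambda>(i, j). if p j = i then 1 else 0 :: 'a)"
  have pn: "p i < n" if "i < n" for i using p that by (auto simp: bij_betw_def)
  have inj: "p i = p j \<longleftrightarrow> i = j" if "i < n" "j < n" for i j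
    using p that by (auto simp: bij_betw_def inj_on_def)
  have PX: "(?P * X) $$ (i, j) = X $$ (p i, j)" if "X \<in> carrier_mat n n" "i < n" "j < n" for X i j
  proof -
    have "(?P * X) $$ (i, j) = (\<Sum>l<n. (if p i = l then 1 else 0) * X $$ (l, j))"
      using that by (simp add: scalar_prod_def lessThan_atLeast0 cong: sum.cong_simp)
    also have "\<dots> = (\<Sum>l<n. if p i = l then X $$ (l, j) else 0)" by (intro sum.cong) auto
    finally have "(?P * X) $$ (i, j) = (\<Sum>l<n. if p i = l then X $$ (l, j) else 0)" .
    then show ?thesis using pn that by (simp add: sum.delta)
  qed
  have XQ: "(X * ?Q) $$ (i, j) = X $$ (i, p j)" if "X \<in> carrier_mat n n" "i < n" "j < n" for X i j
  proof -
    have "(X * ?Q) $$ (i, j) = (\<Sum>l<n. X $$ (i, l) * (if p j = l then 1 else 0))"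
      using that by (simp add: scalar_prod_def lessThan_atLeast0 cong: sum.cong_simp)
    also have "\<dots> = (\<Sum>l<n. if p j = l then X $$ (i, l) else 0)" by (intro sum.cong) auto
    finally have "(X * ?Q) $$ (i, j) = (\<Sum>l<n. if p j = l then X $$ (i, l) else 0)" .
    then show ?thesis using pn that by (simp add: sum.delta)
  qed
  have PQ: "?P * ?Q = 1\<^sub>m n"
  proof (rule eq_matI)
    fix i j assume "i < dim_row (1\<^sub>m n :: 'a mat)" "j < dim_col (1\<^sub>m n :: 'a mat)"
    then show "(?P * ?Q) $$ (i, j) = 1\<^sub>m n $$ (i, j)"
      by (subst PX) (auto simp: pn inj simp del: index_mult_mat)
  qed auto
  have "det ?P * det ?Q = 1" using det_mult[of ?P n ?Q] PQ by simp
  then have "det ?P \<noteq> 0" by auto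
  then obtain Y where Y: "Y \<in> carrier_mat n n" "Y * ?P = 1\<^sub>m n" using det_nonzero_inverse[of ?P n] by auto
  have "?Q = (Y * ?P) * ?Q" using Y by simp
  also have "\<dots> = Y * (?P * ?Q)" using Y by (intro assoc_mult_mat[of _ n n _ n _ n]) auto
  also have "\<dots> = Y" using Y PQ by simp
  finally have QP: "?Q * ?P = 1\<^sub>m n" using Y by simp
  have "A = ?P * B * ?Q"
  proof (rule eq_matI)
    fix i j assume "i < dim_row (?P * B * ?Q)" "j < dim_col (?P * B * ?Q)"
    then have ij: "i < n" "j < n" by auto
    have "(?P * B * ?Q) $$ (i, j) = (?P * B) $$ (i, p j)" using B ij by (intro XQ) auto
    also have "\<dots> = B $$ (p i, p j)" using B ij pn by (intro PX) auto
    finally show "A $$ (i, j) = (?P * B * ?Q) $$ (i, j)" using AB ij by simp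
  qed (use A in auto)
  then show ?thesis using A B PQ QP by (intro similar_matI[of A B ?P ?Q n]) auto
qed

lemma similar_mat_dsum:
  fixes A B :: "'a::field mat"
  assumes "similar_mat A A'" "similar_mat B B'"
  shows "similar_mat (dsum A B) (dsum A' B')"
proof -
  obtain n where A: "A \<in> carrier_mat n n" "A' \<in> carrier_mat n n" using similar_matD[OF assms(1)] by auto
  obtain m where B: "B \<in> carrier_mat m m" "B' \<in> carrier_mat m m" using similar_matD[OF assms(2)] by auto
  show ?thesis using similar_mat_four_block_0_0[OF assms A(1) B(1)] A B by simp
qed

lemma similar_mat_dsum_commute:
  fixes A B :: "'a::field mat"
  assumes A: "A \<in> carrier_mat a a" and B: "B \<in> carrier_mat b b"
  shows "similar_mat (dsum A B) (dsum B A)"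
proof (rule similar_mat_permute[where n = "a + b" and p = "\<lambda>i. if i < a then b + i else i - a"])
  show "dsum A B \<in> carrier_mat (a + b) (a + b)" using A B by simp
  show "dsum B A \<in> carrier_mat (a + b) (a + b)" 
    using four_block_carrier_mat[OF B A] by (simp only: add.commute)
  show "bij_betw (\<lambda>i. if i < a then b + i else i - a) {..<a + b} {..<a + b}"
    by (rule bij_betw_byWitness[where f' = "\<lambda>i. if i < b then a + i else i - b"]) auto
  fix i j assume "i < a + b" "j < a + b"
  then show "dsum A B $$ (i, j) =
      dsum B A $$ (if i < a then b + i else i - a, if j < a then b + j else j - a)"
    using A B by auto
qed

definition unipotent_jordan :: "nat list \<Rightarrow> 'a::field mat" where
  "unipotent_jordan ks = jordan_matrix (map (\<lambda>k. (k, 1)) ks)"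

lemma unipotent_jordan_carrier [simp]:
  "unipotent_jordan ks \<in> carrier_mat (sum_list ks) (sum_list ks)"
  using jordan_matrix_carrier[of "map (\<lambda>k. (k, 1)) ks"] by (simp add: unipotent_jordan_def comp_def)

lemma unipotent_jordan_dim [simp]:
  "dim_row (unipotent_jordan ks) = sum_list ks" "dim_col (unipotent_jordan ks) = sum_list ks"
  by (simp_all add: unipotent_jordan_def comp_def)

lemma unipotent_jordan_Nil: "unipotent_jordan [] = 0\<^sub>m 0 0"
  by (simp add: unipotent_jordan_def jordan_matrix_def)

lemma unipotent_jordan_append: "unipotent_jordan (xs @ ys) = dsum (unipotent_jordan xs) (unipotent_jordan ys)"
  by (simp add: unipotent_jordan_def jordan_matrix_def diag_block_mat_append Let_def)

lemma unipotent_jordan_singleton: "unipotent_jordan [k] = jordan_block k 1"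
  by (auto simp: unipotent_jordan_def jordan_matrix_def intro!: eq_matI)

lemma unipotent_jordan_Cons: "unipotent_jordan (k # ks) = dsum (jordan_block k 1) (unipotent_jordan ks)"
  using unipotent_jordan_append[of "[k]" ks] by (simp add: unipotent_jordan_singleton)

lemma det_unipotent_jordan: "det (unipotent_jordan ks :: 'a::field mat) \<noteq> 0"
proof (induction ks)
  case Nil
  then show ?case by (simp add: unipotent_jordan_Nil)
next
  case (Cons k ks)
  have "det (jordan_block k 1 :: 'a mat) = prod_list (diag_mat (jordan_block k 1))"
    by (rule det_upper_triangular[of _ k]) auto
  then have "det (jordan_block k 1 :: 'a mat) \<noteq> 0" by (auto simp: prod_list_zero_iff diag_mat_def)
  moreover have "det (unipotent_jordan (k # ks) :: 'a mat) = det (jordan_block k 1 :: 'a mat) * det (unipotent_jordan ks :: 'a mat)"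
    unfolding unipotent_jordan_Cons
    by (rule det_four_block_mat_upper_right_zero[of _ k _ "sum_list ks"]) auto
  ultimately show ?case using Cons by simp
qed

lemma unipotent_jordan_nilpotent:
  assumes "\<forall>k \<in> set ks. k \<le> t"
  shows "(unipotent_jordan ks - 1\<^sub>m (sum_list ks)) ^\<^sub>m t = (0\<^sub>m (sum_list ks) (sum_list ks) :: 'a::field mat)"
  using assms
proof (induction ks)
  case Nil
  show ?case by (intro eq_matI) (auto simp: unipotent_jordan_Nil)
next
  case (Cons k ks)
  let ?n = "sum_list ks"
  let ?U = "unipotent_jordan ks - 1\<^sub>m ?n :: 'a mat"
  have U: "?U \<in> carrier_mat ?n ?n" by (intro minus_carrier_mat) simp
  have "unipotent_jordan (k # ks) - 1\<^sub>m (sum_list (k # ks)) =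
    four_block_mat (jordan_block k 0) (0\<^sub>m k ?n) (0\<^sub>m ?n k) ?U"
    unfolding unipotent_jordan_Cons by (rule eq_matI) auto
  then have "(unipotent_jordan (k # ks) - 1\<^sub>m (sum_list (k # ks))) ^\<^sub>m t =
    four_block_mat (jordan_block k 0 ^\<^sub>m t) (0\<^sub>m k ?n) (0\<^sub>m ?n k) (?U ^\<^sub>m t)"
    using pow_four_block_mat[OF jordan_block_carrier U] by simp
  also have "jordan_block k (0 :: 'a) ^\<^sub>m t = 0\<^sub>m k k"
    unfolding jordan_block_pow using Cons.prems by (intro eq_matI) (auto simp: power_0_left)
  also have "?U ^\<^sub>m t = 0\<^sub>m ?n ?n" using Cons by simp
  finally show ?case by simp
qed

text \<open>Direct summands commute up to similarity, so the first block can be moved past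
  \<open>y1\<close> to its place; the other blocks are handled by induction.\<close>

lemma similar_unipotent_jordan:
  "mset xs = mset ys \<Longrightarrow> similar_mat (unipotent_jordan xs :: 'a::field mat) (unipotent_jordan ys)"
proof (induction xs arbitrary: ys)
  case Nil
  then show ?case by (simp add: similar_mat_refl[of _ 0] unipotent_jordan_Nil)
next
  case (Cons x xs)
  then have "x \<in> set ys" by (metis list.set_intros(1) set_mset_mset)
  then obtain y1 y2 where ys: "ys = y1 @ x # y2" by (auto simp: in_set_conv_decomp)
  let ?J = "unipotent_jordan :: nat list \<Rightarrow> 'a mat"
  have refl: "similar_mat (?J zs) (?J zs)" for zs by (rule similar_mat_refl[OF unipotent_jordan_carrier])
  have "similar_mat (?J xs) (?J (y1 @ y2))" using Cons ys by simp
  then have "similar_mat (dsum (?J [x]) (?J xs)) (dsum (?J [x]) (?J (y1 @ y2)))"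
    by (rule similar_mat_dsum[OF refl])
  then have 1: "similar_mat (?J (x # xs)) (?J (([x] @ y1) @ y2))"
    unfolding unipotent_jordan_append[symmetric] by simp
  have "similar_mat (dsum (?J [x]) (?J y1)) (dsum (?J y1) (?J [x]))"
    by (rule similar_mat_dsum_commute) auto
  then have "similar_mat (?J ([x] @ y1)) (?J (y1 @ [x]))" unfolding unipotent_jordan_append .
  then have "similar_mat (dsum (?J ([x] @ y1)) (?J y2)) (dsum (?J (y1 @ [x])) (?J y2))"
    by (rule similar_mat_dsum[OF _ refl])
  then have "similar_mat (?J (([x] @ y1) @ y2)) (?J ys)"
    unfolding unipotent_jordan_append[symmetric] ys by simp
  then show ?case using 1 similar_mat_trans by blast
qed

lemma unipotent_jordan_replicate_index:
  "i < m * k \<Longrightarrow> j < m * k \<Longrightarrow> (unipotent_jordan (replicate m k) :: 'a::field mat) $$ (i, j) =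
    (if i div k = j div k then jordan_block k 1 $$ (i mod k, j mod k) else 0)"
proof (induction m arbitrary: i j)
  case (Suc m)
  then have k: "0 < k" by (cases k) auto
  have s: "sum_list (replicate m k) = m * k" by (simp add: sum_list_replicate)
  have ge: "i div k = Suc ((i - k) div k)" "i mod k = (i - k) mod k" if "\<not> i < k" for i
    using that k by (auto simp: le_div_geq le_mod_geq)
  have lt: "i div k = 0" "i mod k = i" if "i < k" for i using that by auto
  have "unipotent_jordan (replicate (Suc m) k) $$ (i, j) =
    (if i < k then if j < k then jordan_block k 1 $$ (i, j) else 0
     else if j < k then 0 else (unipotent_jordan (replicate m k) :: 'a mat) $$ (i - k, j - k))"
    using Suc.prems s by (auto simp: unipotent_jordan_Cons)
  also have "\<dots> = (if i div k = j div k then jordan_block k 1 $$ (i mod k, j mod k) else 0)"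
    using Suc.IH[of "i - k" "j - k"] Suc.prems ge[of i] ge[of j] lt[of i] lt[of j] by auto
  finally show ?case .
qed simp

text \<open>Listing the basis vectors layer by layer instead of block by block.\<close>

lemma similar_unipotent_jordan_replicate:
  assumes k: "0 < k" and m: "0 < m"
  shows "similar_mat (unipotent_jordan (replicate m k) :: 'a::field mat) (shift_mat k m)"
proof (rule similar_mat_permute[where n = "k * m" and p = "\<lambda>i. (i mod k) * m + i div k"])
  let ?p = "\<lambda>i. (i mod k) * m + i div k" and ?r = "\<lambda>i. (i mod m) * k + i div m"
  show "unipotent_jordan (replicate m k) \<in> carrier_mat (k * m) (k * m)"
    using unipotent_jordan_carrier[of "replicate m k"] by (simp add: sum_list_replicate mult.commute)
  show "shift_mat k m \<in> carrier_mat (k * m) (k * m)" by simp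
  \<comment> \<open>Stated for arbitrary \<open>k'\<close> and \<open>m'\<close>, since
    \<open>?r\<close> is \<open>?p\<close> with the roles of \<open>k\<close> and \<open>m\<close>
    exchanged.\<close>
  have bound: "(i mod k') * m' + i div k' < k' * m'" if "i < k' * m'" "0 < k'" for i k' m' :: nat
  proof -
    have "i div k' < m'" using that by (simp add: less_mult_imp_div_less mult.commute)
    then have "(i mod k') * m' + i div k' < (i mod k') * m' + m'" by simp
    also have "\<dots> = Suc (i mod k') * m'" by simp
    also have "\<dots> \<le> k' * m'" using that by (intro mult_right_mono) (auto simp: Suc_le_eq)
    finally show ?thesis .
  qed
  have inv: "((((i mod k') * m' + i div k') mod m') * k' + ((i mod k') * m' + i div k') div m') = i"
    if "i < k' * m'" for i k' m' :: nat
  proof -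
    have "i div k' < m'" using that by (simp add: less_mult_imp_div_less mult.commute)
    then show ?thesis by simp
  qed
  show "bij_betw ?p {..<k * m} {..<k * m}"
  proof (rule bij_betw_byWitness[where f' = ?r])
    show "\<forall>i\<in>{..<k * m}. ?r (?p i) = i" using inv by simp
    show "\<forall>i\<in>{..<k * m}. ?p (?r i) = i" using inv[of _ m k] by (simp add: mult.commute)
    show "?p ` {..<k * m} \<subseteq> {..<k * m}" using bound[of _ k m] k by auto
    show "?r ` {..<k * m} \<subseteq> {..<k * m}" using bound[of _ m k] m by (auto simp: mult.commute)
  qed
  fix i j assume ij: "i < k * m" "j < k * m"
  have d: "i div k < m" "j div k < m" using ij by (simp_all add: less_mult_imp_div_less mult.commute)
  have split: "a * m + r = b * m + s \<longleftrightarrow> a = b \<and> r = s" if "r < m" "s < m" for a b r s :: nat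
  proof
    assume e: "a * m + r = b * m + s"
    have "(a * m + r) div m = a" "(b * m + s) div m = b" using that by simp_all
    then have "a = b" using e by metis
    then show "a = b \<and> r = s" using e by simp
  qed simp
  have "?p i = ?p j \<longleftrightarrow> i mod k = j mod k \<and> i div k = j div k" using split d by simp
  \<comment> \<open>The next basis vector of the same block lies one layer further, so the
    superdiagonal entries of the blocks become the entries at distance \<open>m\<close>.\<close>
  moreover have "?p j = ?p i + m \<longleftrightarrow> j mod k = Suc (i mod k) \<and> j div k = i div k"
    using split[OF d(2,1), of "j mod k" "Suc (i mod k)"] by (simp add: add.commute add.left_commute)
  moreover have "?p i < k * m" "?p j < k * m" using bound[of _ k m] ij k by auto
  ultimately have "(shift_mat k m :: 'a mat) $$ (?p i, ?p j) =
    (if i mod k = j mod k \<and> i div k = j div k \<or> j mod k = Suc (i mod k) \<and> j div k = i div k then 1 else 0)"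
    by (simp add: shift_mat_def)
  then show "(unipotent_jordan (replicate m k) :: 'a mat) $$ (i, j) = shift_mat k m $$ (?p i, ?p j)"
    using unipotent_jordan_replicate_index[of i m k j] ij mod_less_divisor[OF k, of i] mod_less_divisor[OF k, of j]
    by (auto simp: mult.commute)
qed

lemma mass_similar: "similar_mat h h' \<Longrightarrow> mass (h :: 'a::{field,finite} mat) = mass h'"
  by (simp add: mass_def similar_mat_card_eq)

lemma unipotent_eigenvalue:
  fixes h :: "'a::field mat"
  assumes h: "h \<in> carrier_mat n n" and nil: "(h - 1\<^sub>m n) ^\<^sub>m t = 0\<^sub>m n n" and a: "eigenvalue h a"
  shows "a = 1"
proof -
  obtain v where v: "v \<in> carrier_vec n" "v \<noteq> 0\<^sub>v n" "h *\<^sub>v v = a \<cdot>\<^sub>v v"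
    using a h by (auto simp: eigenvalue_def eigenvector_def)
  have hm: "h - 1\<^sub>m n \<in> carrier_mat n n" by (intro minus_carrier_mat) simp
  have "(h - 1\<^sub>m n) *\<^sub>v v = h *\<^sub>v v - 1\<^sub>m n *\<^sub>v v"
    using h v by (intro minus_mult_distrib_mat_vec[of _ n n]) auto
  also have "\<dots> = (a - 1) \<cdot>\<^sub>v v" using v by (intro eq_vecI) (auto simp: algebra_simps)
  finally have "eigenvector (h - 1\<^sub>m n) v (a - 1)" using v hm by (simp add: eigenvector_def)
  from eigenvector_pow[OF hm this, of t] have e: "(a - 1) ^ t \<cdot>\<^sub>v v = 0\<^sub>m n n *\<^sub>v v"
    using nil by simp
  obtain i where i: "i < n" "v $ i \<noteq> 0"
  proof (rule ccontr)
    assume "\<not> thesis"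
    then have "\<forall>i<n. v $ i = 0" using that by blast
    then have "v = 0\<^sub>v n" using v(1) by (intro eq_vecI) auto
    then show False using v(2) by simp
  qed
  have "((a - 1) ^ t \<cdot>\<^sub>v v) $ i = (0\<^sub>m n n *\<^sub>v v) $ i" using e by simp
  then have "(a - 1) ^ t = 0" using i v(1) by (simp add: scalar_prod_def)
  then show ?thesis by (simp add: power_eq_0_iff)
qed

text \<open>Every eigenvalue listed in a Jordan form is a root of the characteristic polynomial, and
  a unipotent matrix has only the eigenvalue 1. So the form is determined by its block
  sizes.\<close>

lemma unipotent_jordan_type:
  fixes h :: "'a::field mat"
  assumes h: "h \<in> carrier_mat n n" and nil: "(h - 1\<^sub>m n) ^\<^sub>m t = 0\<^sub>m n n" and \<mu>: "has_jordan_type h \<mu>"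
  obtains ks where "similar_mat h (unipotent_jordan ks)" "mset ks = \<mu>" "0 \<notin> set ks" "sum_mset \<mu> = n"
proof -
  obtain n_as where J: "jordan_nf h n_as" "mset (map fst n_as) = \<mu>" using \<mu> by (auto simp: has_jordan_type_def)
  then have z: "0 \<notin> fst ` set n_as" and sim: "similar_mat h (jordan_matrix n_as)" by (auto simp: jordan_nf_def)
  have "a = 1" if ka: "(k, a) \<in> set n_as" for k a
  proof -
    \<comment> \<open>An empty block would not make its label \<open>a\<close> a root.\<close>
    have "k \<noteq> 0" using z ka by force
    have "char_poly h = (\<Prod>(k, a)\<leftarrow>n_as. [:- a, 1:] ^ k)"
      unfolding char_poly_similar[OF sim] jordan_matrix_char_poly ..
    then have "poly (char_poly h) a = (\<Prod>(k, b)\<leftarrow>n_as. (a - b) ^ k)"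
      by (simp add: poly_prod_list comp_def case_prod_unfold)
    also have "\<dots> = 0" using ka \<open>k \<noteq> 0\<close> by (force simp: prod_list_zero_iff)
    finally have "eigenvalue h a" using eigenvalue_root_char_poly[OF h] by simp
    then show ?thesis by (rule unipotent_eigenvalue[OF h nil])
  qed
  then have "n_as = map (\<lambda>k. (k, 1)) (map fst n_as)" by (induction n_as) auto
  then have "jordan_matrix n_as = unipotent_jordan (map fst n_as)" unfolding unipotent_jordan_def by metis
  then have s: "similar_mat h (unipotent_jordan (map fst n_as))" using sim by simp
  have "(unipotent_jordan (map fst n_as) :: 'a mat) \<in> carrier_mat n n" using similar_matE[OF s h] by blast
  then have "sum_list (map fst n_as) = n" by (metis carrier_matD(1) unipotent_jordan_dim(1))
  then have "sum_mset \<mu> = n" using J(2) by (metis sum_mset_sum_list)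
  then show ?thesis using that[OF s] J(2) z by auto
qed

section \<open>Partition statistics and the final count\<close>

lemma dual_part_eq_size: "dual_part \<mu> i = size {#j \<in># \<mu>. i \<le> j#}"
  unfolding dual_part_def size_multiset_overloaded_eq by (intro sum.cong) auto

lemma dual_part_union: "dual_part (\<mu> + \<nu>) i = dual_part \<mu> i + dual_part \<nu> i"
  by (simp add: dual_part_eq_size)

lemma dual_part_eq_0: "(\<And>p. p \<in># \<mu> \<Longrightarrow> p < i) \<Longrightarrow> dual_part \<mu> i = 0"
  unfolding dual_part_def by (intro sum.neutral) (auto simp: not_le dest: leD)

lemma dual_part_replicate: "dual_part (replicate_mset m k) i = (if i \<le> k then m else 0)"
  by (induction m) (auto simp: dual_part_eq_size)

text \<open>Dual parts vanish beyond the largest part, so any upper bound for the parts may serve as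
  the end of the sum; the induction needs the bound \<open>k\<close> for a partition with smaller
  parts.\<close>

lemma n_stat_upto:
  assumes "\<And>p. p \<in># \<mu> \<Longrightarrow> p \<le> K"
  shows "n_stat \<mu> = (\<Sum>i = 1..K. dual_part \<mu> i choose 2)"
proof -
  let ?M = "max K (sum_mset \<mu>)"
  have le: "p \<le> sum_mset \<mu>" if "p \<in># \<mu>" for p using that by (metis sum_mset.remove le_add1)
  have "(\<Sum>i = 1..L. dual_part \<mu> i choose 2) = (\<Sum>i = 1..?M. dual_part \<mu> i choose 2)"
    if "L \<le> ?M" "\<And>p. p \<in># \<mu> \<Longrightarrow> p \<le> L" for L
  proof (rule sum.mono_neutral_left)
    show "\<forall>i\<in>{1..?M} - {1..L}. dual_part \<mu> i choose 2 = 0"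
    proof
      fix i assume "i \<in> {1..?M} - {1..L}"
      then have "dual_part \<mu> i = 0" using that(2) by (intro dual_part_eq_0) fastforce
      then show "dual_part \<mu> i choose 2 = 0" by simp
    qed
  qed (use that in auto)
  from this[of K] this[of "sum_mset \<mu>"] show ?thesis
    unfolding n_stat_def using assms le by simp
qed

text \<open>Counts the boxes of the Young diagram by columns instead of rows; a new part
  \<open>p\<close> adds one box to each of the first \<open>p\<close> columns.\<close>

lemma sum_dual_part:
  assumes "\<And>p. p \<in># \<mu> \<Longrightarrow> p \<le> K"
  shows "(\<Sum>i = 1..K. dual_part \<mu> i) = sum_mset \<mu>"
  using assms
proof (induction \<mu>)
  case empty
  show ?case by (simp add: dual_part_eq_size)
next
  case (add p \<mu>)
  have "dual_part (add_mset p \<mu>) i = (if i \<le> p then 1 else 0) + dual_part \<mu> i" for i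
    by (simp add: dual_part_eq_size)
  then have "(\<Sum>i = 1..K. dual_part (add_mset p \<mu>) i) = (\<Sum>i = 1..K. if i \<le> p then 1 else 0) + sum_mset \<mu>"
    using add by (simp add: sum.distrib)
  also have "(\<Sum>i = 1..K. if i \<le> p then 1 else 0) = (\<Sum>i = 1..p. 1 :: nat)"
    using add.prems[of p] by (intro sum.mono_neutral_cong_right) auto
  finally show ?case by simp
qed

lemma choose_two_add: "(a + b) choose 2 = (a choose 2) + a * b + (b choose 2)"
  by (induction b) (simp_all add: Suc_choose_two binomial_eq_0)

lemma real_choose_two: "real (m choose 2) = real m * (real m - 1) / 2"
  by (induction m) (simp_all add: Suc_choose_two binomial_eq_0 field_simps)

text \<open>Adjoining \<open>m\<close> parts \<open>k\<close> on top raises each of the first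
  \<open>k\<close> dual parts by \<open>m\<close>. Expanding the binomials gives the cross term
  \<open>m\<close> times the sum of the dual parts, that is, the sum of the smaller parts.\<close>

lemma n_stat_add_replicate:
  assumes "\<And>p. p \<in># \<nu> \<Longrightarrow> p < k"
  shows "n_stat (replicate_mset m k + \<nu>) = n_stat \<nu> + m * sum_mset \<nu> + k * (m choose 2)"
proof -
  have \<nu>: "p \<le> k" if "p \<in># \<nu>" for p using assms[OF that] by simp
  have \<mu>: "p \<le> k" if "p \<in># replicate_mset m k + \<nu>" for p using \<nu> that by (auto split: if_splits)
  have "n_stat (replicate_mset m k + \<nu>) = (\<Sum>i = 1..k. dual_part (replicate_mset m k + \<nu>) i choose 2)"
    using \<mu> by (rule n_stat_upto)
  also have "\<dots> = (\<Sum>i = 1..k. (m + dual_part \<nu> i) choose 2)"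
    by (intro sum.cong) (auto simp: dual_part_union dual_part_replicate)
  also have "\<dots> = (\<Sum>i = 1..k. (dual_part \<nu> i choose 2) + m * dual_part \<nu> i + (m choose 2))"
    by (intro sum.cong refl) (simp add: choose_two_add)
  also have "\<dots> = (\<Sum>i = 1..k. dual_part \<nu> i choose 2) + m * (\<Sum>i = 1..k. dual_part \<nu> i) + k * (m choose 2)"
    by (simp add: sum.distrib sum_distrib_left)
  also have "(\<Sum>i = 1..k. dual_part \<nu> i choose 2) = n_stat \<nu>"
    using \<nu> by (rule n_stat_upto[symmetric])
  also have "(\<Sum>i = 1..k. dual_part \<nu> i) = sum_mset \<nu>"
    using \<nu> by (rule sum_dual_part)
  finally show ?thesis .
qed

definition form_exponent :: "nat multiset \<Rightarrow> real" where
  "form_exponent \<mu> = real (n_stat \<mu>) + real (sum_mset \<mu>) / 2 - real (num_odd_parts \<mu>) / 2"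

text \<open>The right side is the exponent of the theorem for the partition with \<open>m\<close>
  parts \<open>k\<close>, whose statistic \<open>n_stat\<close> is
  \<open>k * (m choose 2)\<close>.\<close>

lemma real_layer_exponent:
  "real (layer_exponent k m) = real k * real (m choose 2) + real k * real m / 2 - (if odd k then real m / 2 else 0)"
proof (cases "even k")
  case True
  then show ?thesis by (auto simp: layer_exponent_def real_choose_two field_simps elim!: evenE)
next
  case False
  then show ?thesis by (auto simp: layer_exponent_def real_choose_two field_simps elim!: oddE)
qed

text \<open>The cross term \<open>m * sum_mset \<nu>\<close> is exactly the power of
  \<open>q\<close> lost in \<open>mass_dsum_shift\<close>, so exponent and mass obey the same
  recursion.\<close>

lemma form_exponent_add_replicate:
  assumes "\<And>p. p \<in># \<nu> \<Longrightarrow> p < k"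
  shows "form_exponent (replicate_mset m k + \<nu>) = real (layer_exponent k m) + form_exponent \<nu> + real (m * sum_mset \<nu>)"
proof -
  have "num_odd_parts (replicate_mset m k + \<nu>) = (if odd k then m else 0) + num_odd_parts \<nu>"
    by (induction m) (auto simp: num_odd_parts_def)
  moreover have "n_stat (replicate_mset m k + \<nu>) = n_stat \<nu> + m * sum_mset \<nu> + k * (m choose 2)"
    using assms by (rule n_stat_add_replicate)
  moreover have "sum_mset (replicate_mset m k + \<nu>) = k * m + sum_mset \<nu>" by simp
  ultimately show ?thesis
    unfolding form_exponent_def real_layer_exponent by (simp only: of_nat_add of_nat_mult) (simp add: algebra_simps add_divide_distrib)
qed

definition even_parts_paired :: "nat multiset \<Rightarrow> bool" where
  "even_parts_paired \<mu> \<longleftrightarrow> (\<forall>i \<in># \<mu>. even i \<longrightarrow> even (count \<mu> i))"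

text \<open>Induction on the number of blocks, removing all copies of the largest part in one step;
  each step multiplies by the mass of a single block size and a power of \<open>q\<close>.\<close>

lemma mass_unipotent_jordan:
  defines "q \<equiv> real CARD('a::{field,finite})"
  assumes "0 \<notin> set ks"
  shows "mass (unipotent_jordan ks :: 'a mat) = (if even_parts_paired (mset ks)
    then 1 / (q powr form_exponent (mset ks) * (\<Prod>i \<in> set ks. phi q (count (mset ks) i))) else 0)"
  using assms(2)
proof (induction "length ks" arbitrary: ks rule: less_induct)
  case less
  have q: "q > 1" using card_GT_1[where ?'a = 'a] by (simp add: q_def)
  let ?J = "unipotent_jordan :: nat list \<Rightarrow> 'a mat"
  show ?case
  proof (cases "ks = []")
    case True
    have "0\<^sub>m 0 0 = (1\<^sub>m 0 :: 'a mat)" by (intro eq_matI) auto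
    then have "forms (?J []) = {1\<^sub>m 0}" "centralizer (?J []) = {1\<^sub>m 0}"
      by (auto simp: unipotent_jordan_Nil forms_def centralizer_def intro!: eq_matI)
    then show ?thesis using True q
      by (simp add: mass_def even_parts_paired_def form_exponent_def n_stat_def num_odd_parts_def)
  next
    case False
    define k where "k = Max (set ks)"
    define m where "m = count (mset ks) k"
    define ls where "ls = filter (\<lambda>p. p \<noteq> k) ks"
    have kin: "k \<in> set ks" using False by (simp add: k_def)
    then have k: "0 < k" using less.prems by (metis gr0I)
    have m: "0 < m" using kin by (simp add: m_def)
    have lt: "p < k" if "p \<in> set ls" for p
    proof -
      have "p \<in> set ks" "p \<noteq> k" using that by (auto simp: ls_def)
      then show ?thesis using Max_ge[of "set ks" p] unfolding k_def by (metis List.finite_set le_neq_implies_less)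
    qed
    have ms: "mset ks = replicate_mset m k + mset ls"
      by (rule multiset_eqI) (auto simp: ls_def m_def)
    have kls: "k \<notin> set ls" using lt by blast
    have sk: "set ks = insert k (set ls)"
      using kin by (auto simp: ls_def)
    have "length ls < length ks" unfolding ls_def using kin by (metis (mono_tags, lifting) length_filter_less)
    then have IH: "mass (?J ls) = (if even_parts_paired (mset ls)
      then 1 / (q powr form_exponent (mset ls) * (\<Prod>i \<in> set ls. phi q (count (mset ls) i))) else 0)"
      using less.hyps[of ls] less.prems by (simp add: ls_def)
    have "mset ks = mset (replicate m k @ ls)" using ms by simp
    then have "similar_mat (?J ks) (?J (replicate m k @ ls))" by (rule similar_unipotent_jordan)
    \<comment> \<open>Only the summand with the largest blocks is brought into the layered basis;
      the rest stays in Jordan form for the induction hypothesis.\<close>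
    moreover have "similar_mat (dsum (?J (replicate m k)) (?J ls)) (dsum (shift_mat k m) (?J ls))"
      by (rule similar_mat_dsum[OF similar_unipotent_jordan_replicate[OF k m] similar_mat_refl[OF unipotent_jordan_carrier]])
    ultimately have "similar_mat (?J ks) (dsum (shift_mat k m) (?J ls))"
      unfolding unipotent_jordan_append using similar_mat_trans by blast
    then have "mass (?J ks) = mass (dsum (shift_mat k m) (?J ls))" by (rule mass_similar)
    also have "\<dots> = mass (shift_mat k m :: 'a mat) * mass (?J ls) / q ^ (m * sum_list ls)"
      unfolding q_def
    proof (rule mass_dsum_shift[OF unipotent_jordan_carrier det_unipotent_jordan _ k])
      \<comment> \<open>The exponent is \<open>k - 1\<close> and not \<open>k\<close>, since all
        copies of \<open>k\<close> have been removed from \<open>ls\<close>.\<close>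
      show "(?J ls - 1\<^sub>m (sum_list ls)) ^\<^sub>m (k - 1) = 0\<^sub>m (sum_list ls) (sum_list ls)"
      proof (rule unipotent_jordan_nilpotent, intro ballI)
        fix p assume "p \<in> set ls"
        then show "p \<le> k - 1" using lt[of p] by simp
      qed
    qed
    finally have mass: "mass (?J ks) = mass (shift_mat k m :: 'a mat) * mass (?J ls) / q ^ (m * sum_list ls)" .
    have cnt: "count (mset ks) p = count (mset ls) p" if "p \<in> set ls" for p
      using that kls ms by auto
    \<comment> \<open>The condition at \<open>k\<close> is the negation of the case in which
      \<open>mass_shift\<close> gives 0, so a violation at any part makes the whole product
      vanish.\<close>
    have paired: "even_parts_paired (mset ks) \<longleftrightarrow> (even k \<longrightarrow> even m) \<and> even_parts_paired (mset ls)"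
      unfolding even_parts_paired_def set_mset_mset sk using cnt by (auto simp: m_def)
    have prod: "(\<Prod>i \<in> set ks. phi q (count (mset ks) i)) = phi q m * (\<Prod>i \<in> set ls. phi q (count (mset ls) i))"
      unfolding sk using kls cnt by (simp add: m_def)
    have "form_exponent (mset ks) = real (layer_exponent k m) + form_exponent (mset ls) + real (m * sum_list ls)"
      unfolding ms using lt by (subst form_exponent_add_replicate) (auto simp: sum_mset_sum_list)
    then have pow: "q powr form_exponent (mset ks) =
      q ^ layer_exponent k m * q powr form_exponent (mset ls) * q ^ (m * sum_list ls)"
      using q by (simp add: powr_add powr_realpow del: of_nat_mult)
    show ?thesis
      unfolding mass mass_shift[OF k, where ?'a = 'a, folded q_def] IH paired prod pow by (auto simp: mult_ac)
  qed
qed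

theorem theorem3p3:
  fixes h :: "'a::{field,finite} mat"
    and n q :: nat
    and \<mu> :: "nat multiset"
  assumes "q = CARD('a)"
    and "unipotent n h"
    and "has_jordan_type h \<mu>"
  shows
    "(\<not> (\<forall>i \<in># \<mu>. even i \<longrightarrow> even (count \<mu> i)) \<longrightarrow>
        proportion (carrier (GL n))
          (\<lambda>g. conjugate_in_GL n (g \<otimes>\<^bsub>GL n\<^esub> inverse_transpose n g) h) = 0) \<and>
     ((\<forall>i \<in># \<mu>. even i \<longrightarrow> even (count \<mu> i)) \<longrightarrow>
        proportion (carrier (GL n))
          (\<lambda>g. conjugate_in_GL n (g \<otimes>\<^bsub>GL n\<^esub> inverse_transpose n g) h) =
        1 / (real q powr (real (n_stat \<mu>) + real n / 2 - real (num_odd_parts \<mu>) / 2) *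
             (\<Prod>i \<in> set_mset \<mu>. \<Prod>j = 1..count \<mu> i div 2. 1 - 1 / real q ^ (2 * j))))"
proof -
  obtain t where h: "h \<in> carrier (GL n)" "h \<in> carrier_mat n n" and nil: "(h - 1\<^sub>m n) ^\<^sub>m t = 0\<^sub>m n n"
    using assms(2) by (auto simp: unipotent_def carrier_GL)
  obtain ks where ks: "similar_mat h (unipotent_jordan ks)" "mset ks = \<mu>" "0 \<notin> set ks" "sum_mset \<mu> = n"
    using unipotent_jordan_type[OF h(2) nil assms(3)] by metis
  have "proportion (carrier (GL n)) (\<lambda>g. conjugate_in_GL n (g \<otimes>\<^bsub>GL n\<^esub> inverse_transpose n g) h) =
    mass h"
    unfolding proportion_conjugate[OF h(1)] mass_def ..
  also have "\<dots> = mass (unipotent_jordan ks :: 'a mat)" by (rule mass_similar[OF ks(1)])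
  also have "\<dots> = (if even_parts_paired \<mu>
    then 1 / (real q powr form_exponent \<mu> * (\<Prod>i \<in> set_mset \<mu>. phi (real q) (count \<mu> i))) else 0)"
    using mass_unipotent_jordan[OF ks(3), where ?'a = 'a] unfolding assms(1) ks(2)[symmetric] by simp
  finally have "proportion (carrier (GL n)) (\<lambda>g. conjugate_in_GL n (g \<otimes>\<^bsub>GL n\<^esub> inverse_transpose n g) h) =
    (if even_parts_paired \<mu>
      then 1 / (real q powr form_exponent \<mu> * (\<Prod>i \<in> set_mset \<mu>. phi (real q) (count \<mu> i))) else 0)" .
  moreover have "(\<not> A \<longrightarrow> x = 0) \<and> (A \<longrightarrow> x = y)" if "x = (if A then y else 0)" for A and x y :: real
    using that by simp
  ultimately show ?thesis unfolding even_parts_paired_def form_exponent_def phi_def ks(4) by blast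
qed

end
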